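(* Let $F:[B(\mathcal H)^n]_1\to[B(\mathcal H)^m]_1^-$ be a free holomorphic function with $\|F(0)\|<1$ and let $a\in\mathbb B_n$. Then there exists a free holomorphic function $\Gamma:[B(\mathcal H)^n]_1\to B(\mathcal H)\bar\otimes_{min}M_{n\times m}$ with $\|\Gamma\|_\infty\le1$ such that $$\Phi_{F(a)}(F(X))=\Phi_a(X)\,(\Gamma\circ\Phi_a)(X),\qquad X\in[B(\mathcal H)^n]_1,$$ where $\Phi_a$ and $\Phi_{F(a)}$ are the corresponding free holomorphic automorphisms of $[B(\mathcal H)^n]_1$ and $[B(\mathcal H)^m]_1$, respectively. Consequently, $$\Phi_{F(a)}(F(X))\Phi_{F(a)}(F(X))^*\le\Phi_a(X)\Phi_a(X)^*,\qquad X\in[B(\mathcal H)^n]_1,$$ and $$\|\Phi_{F(a)}(F(X))\|\le\|\Phi_a(X)\|,\qquad X\in[B(\mathcal H)^n]_1.$$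
   Context: $\mathcal H$ is a separable infinite dimensional Hilbert space. A tuple $X=(X_1,\dots,X_n)\in B(\mathcal H)^n$ is identified with the row operator $[X_1\,\cdots\,X_n]:\mathcal H^{(n)}\to\mathcal H$; $\|X\|=\|\sum_iX_iX_i^*\|^{1/2}$, $[B(\mathcal H)^n]_1=\{X:\|X\|<1\}$, $[B(\mathcal H)^n]_1^-=\{X:\|X\|\le1\}$. $\mathbb B_n$ is the open Euclidean unit ball of $\mathbb C^n$. $\mathbb F_n^+$ is the unital free semigroup on $g_1,\dots,g_n$; for $\alpha=g_{i_1}\cdots g_{i_k}$ put $|\alpha|=k$, $X_\alpha=X_{i_1}\cdots X_{i_k}$ ($X_\alpha=I$ for the neutral element, of length $0$). A free holomorphic function on $[B(\mathcal H)^n]_1$ with coefficients in a space of operators (or matrices) is a map $X\mapsto\sum_{k=0}^\infty\sum_{|\alpha|=k}X_\alpha\otimes A_{(\alpha)}$, the series in $k$ converging in operator norm for all $X\in[B(\mathcal H)^n]_1$; for $\Gamma$ the coefficients lie in $M_{n\times m}$, the $n\times m$ scalar matrices. $F:[B(\mathcal H)^n]_1\to[B(\mathcal H)^m]_1^-$ is free holomorphic if $F=(F_1,\dots,F_m)$ with each $F_j:[B(\mathcal H)^n]_1\to B(\mathcal H)$ free holomorphic with scalar coefficients. $\|\Gamma\|_\infty=\sup_{\|X\|<1}\|\Gamma(X)\|$. For $a\in\mathbb B_n$ (identified with $(a_1I,\dots,a_nI)$), $F(a)$ is identified with a vector of $\mathbb C^m$, which lies in $\mathbb B_m$. For $\lambda=(\lambda_1,\dots,\lambda_n)\in\mathbb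 B_n$, also viewed as the row operator $[\lambda_1I,\dots,\lambda_nI]$, $$\Phi_\lambda(X)=\lambda-\Delta_\lambda\Big(I_{\mathcal H}-\sum_{i=1}^n\bar\lambda_iX_i\Big)^{-1}[X_1,\dots,X_n]\,\Delta_{\lambda^*},$$ where $\Delta_\lambda=(1-\|\lambda\|_2^2)^{1/2}$ and $\Delta_{\lambda^*}=(I-\lambda^*\lambda)^{1/2}$. It is an involutive free holomorphic automorphism of $[B(\mathcal H)^n]_1$ interchanging $0$ and $\lambda$. *)

theory Defs
  imports "HOL-Analysis.Analysis"
begin

section \<open>Complex Hilbert spaces\<close>

class scaleC =
  fixes scaleC :: "complex \<Rightarrow> 'a \<Rightarrow> 'a" (infixr \<open>*\<^sub>C\<close> 75)

class complex_vector = real_vector + scaleC +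
  assumes scaleC_add_right: "c *\<^sub>C (x + y) = c *\<^sub>C x + c *\<^sub>C y"
    and scaleC_add_left: "(c + d) *\<^sub>C x = c *\<^sub>C x + d *\<^sub>C x"
    and scaleC_scaleC: "c *\<^sub>C d *\<^sub>C x = (c * d) *\<^sub>C x"
    and scaleC_of_real: "complex_of_real r *\<^sub>C x = r *\<^sub>R x"

lemma scaleC_one [simp]: "1 *\<^sub>C x = (x :: 'a :: complex_vector)"
  using scaleC_of_real[of 1 x] by simp

lemma vector_space_scaleC: "vector_space (scaleC :: complex \<Rightarrow> 'a \<Rightarrow> 'a :: complex_vector)"
  by unfold_locales (simp_all add: scaleC_add_right scaleC_add_left scaleC_scaleC)

class complex_normed_vector = real_normed_vector + complex_vector +
  assumes norm_scaleC: "norm (c *\<^sub>C x) = cmod c * norm x"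

text \<open>The inner product is linear in the first argument.\<close>

class complex_inner = complex_normed_vector +
  fixes cinner :: "'a \<Rightarrow> 'a \<Rightarrow> complex"
  assumes cinner_commute: "cinner x y = cnj (cinner y x)"
    and cinner_add_left: "cinner (x + y) z = cinner x z + cinner y z"
    and cinner_scaleC_left: "cinner (c *\<^sub>C x) y = c * cinner x y"
    and cinner_self: "cinner x x = complex_of_real ((norm x)\<^sup>2)"

class chilbert_space = complex_inner + complete_space

definition cinfinite_dimensional :: "'a :: complex_vector itself \<Rightarrow> bool" where
  "cinfinite_dimensional _ \<longleftrightarrow> \<not> (\<exists>B :: 'a set. finite B \<and> module.span scaleC B = UNIV)"

lemma bounded_linear_scaleC: "bounded_linear (\<lambda>x :: 'a :: complex_normed_vector. c *\<^sub>C x)"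
proof (rule bounded_linear_intro[where K = "cmod c"])
  fix r :: real and x :: 'a
  show "c *\<^sub>C r *\<^sub>R x = r *\<^sub>R c *\<^sub>C x"
    by (simp add: scaleC_of_real[symmetric] scaleC_scaleC mult.commute)
qed (simp_all add: scaleC_add_right norm_scaleC mult.commute)

text \<open>The direct sum \<open>H\<^sup>n\<close> of copies of a Hilbert space; the library norm on \<open>'a ^ 'n\<close> is the
  \<open>\<ell>\<^sup>2\<close>-norm.\<close>

instantiation vec :: (complex_vector, finite) complex_vector
begin
definition "scaleC c x = (\<chi> i. c *\<^sub>C (x $ i))"
instance
  by standard (simp_all add: scaleC_vec_def vec_eq_iff scaleC_add_right scaleC_add_left
      scaleC_scaleC scaleC_of_real)
end

instance vec :: (complex_normed_vector, finite) complex_normed_vector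
  by standard (simp add: scaleC_vec_def norm_vec_def norm_scaleC L2_set_right_distrib)

instantiation vec :: (complex_inner, finite) complex_inner
begin
definition "cinner x y = (\<Sum>i\<in>UNIV. cinner (x $ i) (y $ i))"
instance
proof
  fix x y z :: "'a ^ 'b" and c :: complex
  show "cinner x y = cnj (cinner y x)"
    unfolding cinner_vec_def cnj_sum by (intro sum.cong refl cinner_commute)
  show "cinner (x + y) z = cinner x z + cinner y z"
    by (simp add: cinner_vec_def cinner_add_left sum.distrib)
  show "cinner (c *\<^sub>C x) y = c * cinner x y"
    by (simp add: cinner_vec_def scaleC_vec_def cinner_scaleC_left sum_distrib_left)
  show "cinner x x = complex_of_real ((norm x)\<^sup>2)"
    by (simp add: cinner_vec_def cinner_self norm_vec_def L2_set_def sum_nonneg)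
qed
end

instance vec :: (chilbert_space, finite) chilbert_space ..


section \<open>Bounded operators\<close>

text \<open>The library type of bounded operators consists of the real-linear ones; the bounded
  operators between complex spaces are those in \<open>clinear_ops\<close>.\<close>

definition clinear_ops :: "('a :: complex_normed_vector \<Rightarrow>\<^sub>L 'b :: complex_normed_vector) set" where
  "clinear_ops = {T. \<forall>c x. blinfun_apply T (c *\<^sub>C x) = c *\<^sub>C blinfun_apply T x}"

instantiation blinfun :: (real_normed_vector, complex_normed_vector) complex_vector
begin
lift_definition scaleC_blinfun :: "complex \<Rightarrow> 'a \<Rightarrow>\<^sub>L 'b \<Rightarrow> 'a \<Rightarrow>\<^sub>L 'b" is "\<lambda>c T x. c *\<^sub>C T x"
  by (rule bounded_linear_compose[OF bounded_linear_scaleC])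
instance
  by standard (transfer; simp add: fun_eq_iff scaleC_add_right scaleC_add_left
      scaleC_scaleC scaleC_of_real)+
end

definition adj :: "('a :: complex_inner \<Rightarrow>\<^sub>L 'b :: complex_inner) \<Rightarrow> 'b \<Rightarrow>\<^sub>L 'a" where
  "adj T = (THE S. \<forall>x y. cinner (blinfun_apply T x) y = cinner x (blinfun_apply S y))"

definition positive_op :: "('a :: complex_inner \<Rightarrow>\<^sub>L 'a) \<Rightarrow> bool" where
  "positive_op T \<longleftrightarrow> T \<in> clinear_ops \<and>
     (\<forall>x. cinner (blinfun_apply T x) x \<in> \<real> \<and> 0 \<le> Re (cinner (blinfun_apply T x) x))"

definition op_le :: "('a :: complex_inner \<Rightarrow>\<^sub>L 'a) \<Rightarrow> ('a \<Rightarrow>\<^sub>L 'a) \<Rightarrow> bool" (infix \<open>\<le>\<^sub>o\<^sub>p\<close> 50) where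
  "S \<le>\<^sub>o\<^sub>p T \<longleftrightarrow> positive_op (T - S)"

definition sqrt_op :: "('a :: complex_inner \<Rightarrow>\<^sub>L 'a) \<Rightarrow> 'a \<Rightarrow>\<^sub>L 'a" where
  "sqrt_op T = (THE S. positive_op S \<and> S o\<^sub>L S = T)"

definition inv_op :: "('a :: real_normed_vector \<Rightarrow>\<^sub>L 'a) \<Rightarrow> 'a \<Rightarrow>\<^sub>L 'a" where
  "inv_op T = (THE S. S o\<^sub>L T = id_blinfun \<and> T o\<^sub>L S = id_blinfun)"


section \<open>Tuples of operators and the noncommutative ball\<close>

type_synonym ('h, 'n) op_tuple = "'n \<Rightarrow> 'h \<Rightarrow>\<^sub>L 'h"

text \<open>The row operator \<open>[X\<^sub>1 \<dots> X\<^sub>n]\<close> of a tuple, and the tuple of entries of a row operator.\<close>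

lift_definition row_op :: "('h :: complex_normed_vector, 'n :: finite) op_tuple \<Rightarrow> ('h ^ 'n) \<Rightarrow>\<^sub>L 'h"
  is "\<lambda>X v. \<Sum>i\<in>UNIV. X i (v $ i)"
  by (intro bounded_linear_sum bounded_linear_compose[OF _ bounded_linear_vec_nth])

lift_definition embed :: "'n :: finite \<Rightarrow> 'h :: complex_normed_vector \<Rightarrow>\<^sub>L ('h ^ 'n)"
  is "\<lambda>i x. axis i x"
  by (rule bounded_linear_intro[where K = 1])
    (simp_all add: axis_def vec_eq_iff norm_vec_def L2_set_def if_distrib[of norm]
      if_distrib[of "\<lambda>t. t\<^sup>2"] cong: if_cong)

definition entries :: "(('h :: complex_normed_vector ^ 'n :: finite) \<Rightarrow>\<^sub>L 'h) \<Rightarrow> ('h, 'n) op_tuple" where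
  "entries R = (\<lambda>i. R o\<^sub>L embed i)"

lemma row_op_entries:
  fixes R :: "('h :: complex_normed_vector ^ 'n :: finite) \<Rightarrow>\<^sub>L 'h"
  shows "row_op (entries R) = R"
proof (rule blinfun_eqI)
  fix v :: "'h ^ 'n"
  have "(\<Sum>i\<in>UNIV. axis i (v $ i)) = v"
    by (simp add: vec_eq_iff axis_def)
  then show "blinfun_apply (row_op (entries R)) v = blinfun_apply R v"
    by (simp add: row_op.rep_eq entries_def embed.rep_eq blinfun.sum_right[symmetric])
qed

lemma entries_row_op:
  fixes X :: "('h :: complex_normed_vector, 'n :: finite) op_tuple"
  shows "entries (row_op X) = X"
proof (intro ext blinfun_eqI)
  fix i :: 'n and v :: 'h
  have "(\<Sum>j\<in>UNIV. blinfun_apply (X j) (axis i v $ j))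
      = (\<Sum>j\<in>UNIV. if j = i then blinfun_apply (X j) v else 0)"
    by (intro sum.cong) (auto simp: axis_def)
  then show "blinfun_apply (entries (row_op X) i) v = blinfun_apply (X i) v"
    by (simp add: row_op.rep_eq entries_def embed.rep_eq)
qed

definition tuple_norm :: "('h :: complex_inner, 'n :: finite) op_tuple \<Rightarrow> real" where
  "tuple_norm X = sqrt (norm (\<Sum>i\<in>UNIV. X i o\<^sub>L adj (X i)))"

definition op_ball :: "('h :: complex_inner, 'n :: finite) op_tuple set" where
  "op_ball = {X. (\<forall>i. X i \<in> clinear_ops) \<and> tuple_norm X < 1}"

definition op_cball :: "('h :: complex_inner, 'n :: finite) op_tuple set" where
  "op_cball = {X. (\<forall>i. X i \<in> clinear_ops) \<and> tuple_norm X \<le> 1}"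

text \<open>\<open>(a\<^sub>1 I, \<dots>, a\<^sub>n I)\<close> for \<open>a \<in> \<complex>\<^sup>n\<close>, and the converse identification.\<close>

definition scalar_tuple :: "complex ^ 'n \<Rightarrow> ('h :: complex_normed_vector, 'n :: finite) op_tuple" where
  "scalar_tuple a = (\<lambda>i. (a $ i) *\<^sub>C id_blinfun)"

definition tuple_scalars :: "('h :: complex_normed_vector, 'n :: finite) op_tuple \<Rightarrow> complex ^ 'n" where
  "tuple_scalars X = (THE a. scalar_tuple a = X)"


section \<open>Free holomorphic functions\<close>

text \<open>Words over the generators are lists over the index type.\<close>

definition word_op :: "('h :: real_normed_vector, 'n) op_tuple \<Rightarrow> 'n list \<Rightarrow> 'h \<Rightarrow>\<^sub>L 'h" where
  "word_op X w = foldr (\<lambda>i T. X i o\<^sub>L T) w id_blinfun"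

text \<open>\<open>T \<otimes> A\<close> for a scalar \<open>n \<times> m\<close> matrix \<open>A\<close>, as the operator matrix \<open>(A\<^sub>i\<^sub>j T)\<^sub>i\<^sub>j\<close> from \<open>H\<^sup>m\<close>
  to \<open>H\<^sup>n\<close>; the minimal tensor product of \<open>B(H)\<close> with the \<open>n \<times> m\<close> matrices is the space
  of bounded operators from \<open>H\<^sup>m\<close> to \<open>H\<^sup>n\<close> with the operator norm.\<close>

lift_definition tensor_mat ::
  "('h :: complex_normed_vector \<Rightarrow>\<^sub>L 'h) \<Rightarrow> complex ^ 'm ^ 'n \<Rightarrow> ('h ^ 'm :: finite) \<Rightarrow>\<^sub>L ('h ^ 'n :: finite)"
  is "\<lambda>T A v. \<chi> i. \<Sum>j\<in>UNIV. (A $ i $ j) *\<^sub>C T (v $ j)"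
proof -
  fix T :: "'h \<Rightarrow> 'h" and A :: "complex ^ 'm ^ 'n"
  assume T: "bounded_linear T"
  have "bounded_linear (\<lambda>v. \<Sum>i\<in>UNIV. blinfun_apply (embed i)
      (\<Sum>j\<in>UNIV. (A $ i $ j) *\<^sub>C T (v $ j)))"
    by (intro bounded_linear_sum bounded_linear_compose[OF blinfun.bounded_linear_right]
        bounded_linear_compose[OF bounded_linear_scaleC] bounded_linear_compose[OF T]
        bounded_linear_vec_nth)
  moreover have "(\<Sum>i\<in>UNIV. blinfun_apply (embed i) (f i)) = (\<chi> i. f i)" for f :: "'n \<Rightarrow> 'h"
    by (simp add: vec_eq_iff embed.rep_eq axis_def)
  ultimately show "bounded_linear (\<lambda>v. \<chi> i. \<Sum>j\<in>UNIV. (A $ i $ j) *\<^sub>C T (v $ j))"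
    by simp
qed

definition free_holomorphic ::
  "(('h :: complex_inner, 'n :: finite) op_tuple \<Rightarrow> 'h \<Rightarrow>\<^sub>L 'h) \<Rightarrow> bool" where
  "free_holomorphic f \<longleftrightarrow> (\<exists>c :: 'n list \<Rightarrow> complex. \<forall>X \<in> op_ball.
     (\<lambda>k. \<Sum>w | length w = k. c w *\<^sub>C word_op X w) sums f X)"

definition free_holomorphic_mat ::
  "(('h :: complex_inner, 'n :: finite) op_tuple \<Rightarrow> ('h ^ 'q :: finite) \<Rightarrow>\<^sub>L ('h ^ 'p :: finite)) \<Rightarrow> bool"
  where
  "free_holomorphic_mat G \<longleftrightarrow> (\<exists>A :: 'n list \<Rightarrow> complex ^ 'q ^ 'p. \<forall>X \<in> op_ball.
     (\<lambda>k. \<Sum>w | length w = k. tensor_mat (word_op X w) (A w)) sums G X)"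

definition free_holomorphic_tuple ::
  "(('h :: complex_inner, 'n :: finite) op_tuple \<Rightarrow> ('h, 'm :: finite) op_tuple) \<Rightarrow> bool" where
  "free_holomorphic_tuple F \<longleftrightarrow> (\<forall>j. free_holomorphic (\<lambda>X. F X j))"

text \<open>The supremum is taken in the extended reals, so that it is infinite for unbounded functions.\<close>

definition sup_norm ::
  "(('h :: complex_inner, 'n :: finite) op_tuple \<Rightarrow> 'b :: real_normed_vector) \<Rightarrow> ereal" where
  "sup_norm G = (SUP X \<in> op_ball. ereal (norm (G X)))"


section \<open>The automorphisms of the noncommutative ball\<close>

definition Phi ::
  "complex ^ 'n :: finite \<Rightarrow> ('h :: complex_inner, 'n) op_tuple \<Rightarrow> ('h, 'n) op_tuple" where
  "Phi l X = (let L = row_op (scalar_tuple l) in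
     entries (L - sqrt (1 - (norm l)\<^sup>2) *\<^sub>R
       (inv_op (id_blinfun - (\<Sum>i\<in>UNIV. cnj (l $ i) *\<^sub>C X i)) o\<^sub>L row_op X
         o\<^sub>L sqrt_op (id_blinfun - (adj L o\<^sub>L L)))))"

end

theory Submission
  imports Defs
begin

text \<open>
  Moving the point \<open>a\<close> and its value \<open>b = F(a)\<close> to the origin turns the theorem into a Schwarz
  lemma for \<open>G = \<Phi>\<^sub>b \<circ> F \<circ> \<Phi>\<^sub>a\<close>, which maps the ball into the closed ball and vanishes at \<open>0\<close>.
  Since \<open>\<Phi>\<^sub>a\<close> is involutive, a factorisation \<open>G(Z) = Z \<Gamma>(Z)\<close> with \<open>\<parallel>\<Gamma>\<parallel> \<le> 1\<close> gives the
  identity of the theorem at \<open>Z = \<Phi>\<^sub>a(X)\<close>, and both inequalities follow from it.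

  Schwarz lemma (\<open>schwarz_lemma\<close>).  The series of \<open>G\<close> has no constant term, so splitting off the
  first letter of every word gives \<open>G(X) = \<Sum>\<^sub>i X\<^sub>i \<Gamma>\<^sub>i(X)\<close>.  If \<open>X\<close> were a row isometry, then
  \<open>\<parallel>\<Gamma>(X)\<parallel> = \<parallel>G(X)\<parallel> \<le> 1\<close> would be immediate.  In general, one dilation step is enough: choose isometries
  \<open>V\<close> from \<open>H\<^sup>n\<close> and \<open>T\<close> from \<open>H\<close> into \<open>H\<close> with \<open>T\<^sup>*V = [X\<^sub>1 \<dots> X\<^sub>n]\<close>.  The contractive
  tuple \<open>Y\<^sub>i = V e\<^sub>i T\<^sup>*\<close>, where \<open>e\<^sub>i\<close> embeds the \<open>i\<close>-th summand of \<open>H\<^sup>n\<close>, satisfies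
  \<open>Y\<^sub>i\<^sub>w T = V e\<^sub>i X\<^sub>w\<close>.  Up to a scaling of \<open>X\<close> and \<open>Y\<close> into the open ball,
  \<open>G(Y) T = V \<Gamma>(X)\<close>, and \<open>V\<close> preserves norms.

  Composition.  That \<open>G\<close> is again given by a free power series is shown with locally uniform
  approximation by noncommutative polynomials, a notion that is visibly stable under sums, products,
  compositions and limits (\<open>poly_approx\<close>).  It is equivalent to free holomorphy: on the creation
  operators the vectors \<open>X\<^sub>w \<Omega>\<close> are orthonormal, so the coefficients of degree \<open>k\<close> of a series are
  controlled in the \<open>\<ell>\<^sup>2\<close>-sense by one value of the function, while the same \<open>\<ell>\<^sup>2\<close>-norm bounds
  the homogeneous part of degree \<open>k\<close> on every tuple.

  The automorphisms.  With \<open>s = (1 - \<parallel>l\<parallel>\<^sup>2)\<^sup>1\<^sup>/\<^sup>2\<close> and \<open>E = s \<Delta>\<^sup>-\<^sup>1\<close> for the square root \<open>\<Delta>\<close> of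
  \<open>I - l\<^sup>*l\<close>, one has \<open>\<Phi>\<^sub>l(X) = (I - X l\<^sup>*)\<^sup>-\<^sup>1 (l - X E)\<close>, where \<open>E = E\<^sup>*\<close>,
  \<open>E\<^sup>2 = s\<^sup>2 I + l\<^sup>*l\<close> and \<open>l E = l\<close>.  These relations give the involution and a bound for
  \<open>\<parallel>\<Phi>\<^sub>l(X)\<parallel>\<close> that is uniform below \<open>1\<close> on smaller balls.

  The map \<open>\<Phi>\<^sub>b\<close> requires \<open>\<parallel>F(a)\<parallel> < 1\<close>.  This comes from the Schwarz lemma as well:
  it applies to \<open>\<Phi>\<^bsub>F(0)\<^esub> \<circ> F\<close>, whose value at \<open>a\<close> therefore has norm at most \<open>\<parallel>a\<parallel>\<close>.
\<close>

section \<open>Complex inner products\<close>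

lemma cinner_add_right: "cinner x (y + z) = cinner x y + cinner (x :: 'a :: complex_inner) z"
  by (metis cinner_commute cinner_add_left complex_cnj_add)

lemma cinner_scaleC_right: "cinner x (c *\<^sub>C y) = cnj c * cinner (x :: 'a :: complex_inner) y"
  by (metis cinner_commute cinner_scaleC_left complex_cnj_mult)

lemma cinner_scaleR_left: "cinner (r *\<^sub>R x) y = complex_of_real r * cinner (x :: 'a :: complex_inner) y"
  by (metis cinner_scaleC_left scaleC_of_real)

lemma cinner_scaleR_right: "cinner x (r *\<^sub>R y) = complex_of_real r * cinner (x :: 'a :: complex_inner) y"
  by (metis cinner_scaleC_right scaleC_of_real complex_cnj_complex_of_real)

lemma cinner_diff_left: "cinner (x - y) z = cinner x z - cinner (y :: 'a :: complex_inner) z"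
  using cinner_add_left[of "x - y" y z] by simp

lemma cinner_diff_right: "cinner x (y - z) = cinner x y - cinner (x :: 'a :: complex_inner) z"
  using cinner_add_right[of x "y - z" z] by simp

lemmas cinner_linear = cinner_add_left cinner_add_right cinner_diff_left cinner_diff_right
  cinner_scaleC_left cinner_scaleC_right cinner_scaleR_left cinner_scaleR_right

lemma Re_cinner_self: "Re (cinner x x) = (norm (x :: 'a :: complex_inner))\<^sup>2"
  by (simp add: cinner_self)

lemma Re_cinner_commute: "Re (cinner y x) = Re (cinner (x :: 'a :: complex_inner) y)"
  by (subst cinner_commute) simp

lemma norm_add_sq:
  "(norm (x + y :: 'a :: complex_inner))\<^sup>2 = (norm x)\<^sup>2 + 2 * Re (cinner x y) + (norm y)\<^sup>2"
  using Re_cinner_commute[of x y]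
  by (simp add: Re_cinner_self[symmetric] cinner_add_left cinner_add_right)

lemma norm_diff_sq:
  "(norm (x - y :: 'a :: complex_inner))\<^sup>2 = (norm x)\<^sup>2 - 2 * Re (cinner x y) + (norm y)\<^sup>2"
  using Re_cinner_commute[of x y]
  by (simp add: Re_cinner_self[symmetric] cinner_diff_left cinner_diff_right)

lemma Cauchy_Schwarz_cinner: "cmod (cinner x y) \<le> norm x * norm (y :: 'a :: complex_inner)"
proof (cases "y = 0")
  case True
  have "cinner x 0 = 0" using cinner_diff_right[of x 0 0] by simp
  then show ?thesis using True by simp
next
  case False
  define c where "c = cinner x y"
  define N where "N = (norm y)\<^sup>2"
  have N: "N > 0" using False by (simp add: N_def)
  have c2: "c * cnj c = complex_of_real ((cmod c)\<^sup>2)"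
    using complex_norm_square[of c] by simp
  have yx: "cinner y x = cnj c" unfolding c_def by (rule cinner_commute)
  have "complex_of_real ((norm (N *\<^sub>R x - c *\<^sub>C y))\<^sup>2)
     = complex_of_real N * (complex_of_real N * complex_of_real ((norm x)\<^sup>2) - c * cnj c)"
    unfolding cinner_self[symmetric]
    by (simp add: cinner_linear yx c_def[symmetric] cinner_self[of y] N_def[symmetric] algebra_simps)
  also have "\<dots> = complex_of_real (N * (N * (norm x)\<^sup>2 - (cmod c)\<^sup>2))"
    unfolding c2 by simp
  finally have "(norm (N *\<^sub>R x - c *\<^sub>C y))\<^sup>2 = N * (N * (norm x)\<^sup>2 - (cmod c)\<^sup>2)"
    by (rule of_real_eq_iff[THEN iffD1])
  then have "0 \<le> N * (N * (norm x)\<^sup>2 - (cmod c)\<^sup>2)" by (metis zero_le_power2)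
  then have "(cmod c)\<^sup>2 \<le> (norm x * norm y)\<^sup>2"
    using N by (simp add: zero_le_mult_iff N_def power_mult_distrib mult.commute)
  then show ?thesis unfolding c_def by (rule power2_le_imp_le) simp
qed

lemma Re_cinner_le: "Re (cinner x y) \<le> norm x * norm (y :: 'a :: complex_inner)"
  using Cauchy_Schwarz_cinner[of x y] complex_Re_le_cmod[of "cinner x y"] by linarith

lemma bounded_bilinear_cinner: "bounded_bilinear (cinner :: 'a :: complex_inner \<Rightarrow> 'a \<Rightarrow> complex)"
  by (intro bounded_bilinear.intro exI[of _ 1])
    (simp_all add: cinner_linear scaleR_conv_of_real Cauchy_Schwarz_cinner)

interpretation cinner: bounded_bilinear "cinner :: 'a :: complex_inner \<Rightarrow> 'a \<Rightarrow> complex"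
  by (rule bounded_bilinear_cinner)

declare cinner.zero_left [simp] cinner.zero_right [simp]

lemma cinner_ext:
  assumes "\<And>z. cinner z x = cinner z (y :: 'a :: complex_inner)"
  shows "x = y"
proof -
  have "cinner (x - y) (x - y) = 0" using assms[of "x - y"] by (simp add: cinner_diff_right)
  then show ?thesis by (simp add: cinner_self)
qed

text \<open>The representing vector minimises \<open>J x = \<parallel>x\<parallel>\<^sup>2 - 2 Re (\<phi> x)\<close>: by the parallelogram
  identity every minimising sequence is Cauchy, and the first variation of \<open>J\<close> vanishes at its
  limit.\<close>

lemma riesz_representation:
  fixes \<phi> :: "'a :: chilbert_space \<Rightarrow> complex"
  assumes bl: "bounded_linear \<phi>" and lin: "\<And>c x. \<phi> (c *\<^sub>C x) = c * \<phi> x"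
  shows "\<exists>u. \<forall>x. \<phi> x = cinner x u"
proof -
  interpret \<phi>: bounded_linear \<phi> by (rule bl)
  obtain K where K: "\<And>x. cmod (\<phi> x) \<le> norm x * K" using \<phi>.pos_bounded by blast
  define J where "J x = (norm x)\<^sup>2 - 2 * Re (\<phi> x)" for x
  have J_ge: "J x \<ge> - K\<^sup>2" for x
  proof -
    have "Re (\<phi> x) \<le> norm x * K" using K[of x] complex_Re_le_cmod[of "\<phi> x"] by linarith
    moreover have "0 \<le> (norm x - K)\<^sup>2" by simp
    ultimately show ?thesis unfolding J_def by (simp add: power2_diff)
  qed
  define m where "m = Inf (range J)"
  have bdd: "bdd_below (range J)" using J_ge by (intro bdd_belowI) auto
  have m_le: "m \<le> J x" for x unfolding m_def by (intro cInf_lower bdd) auto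
  have "\<exists>x. J x < m + 1 / real (Suc n)" for n
    using cInf_lessD[of "range J" "m + 1 / real (Suc n)"] unfolding m_def by auto
  then obtain u where u: "\<And>n. J (u n) < m + 1 / real (Suc n)" by metis
  have par: "(norm (x - y))\<^sup>2 = 2 * (J x + J y) - 4 * J ((1/2) *\<^sub>R (x + y))" for x y
  proof -
    have "(norm ((1/2) *\<^sub>R (x + y)))\<^sup>2 = (norm (x + y))\<^sup>2 / 4"
      by (simp add: power_divide)
    moreover have "Re (\<phi> ((1/2) *\<^sub>R (x + y))) = (Re (\<phi> x) + Re (\<phi> y)) / 2"
      unfolding \<phi>.scaleR \<phi>.add by simp
    ultimately show ?thesis
      unfolding J_def by (simp add: norm_add_sq norm_diff_sq)
  qed
  have dist: "(norm (u p - u q))\<^sup>2 \<le> 2 / real (Suc p) + 2 / real (Suc q)" for p q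
    using par[of "u p" "u q"] m_le[of "(1/2) *\<^sub>R (u p + u q)"] u[of p] u[of q] by simp
  have "Cauchy u"
  proof (rule metric_CauchyI)
    fix e :: real assume e: "e > 0"
    obtain N where N: "real N > 4 / e\<^sup>2" using reals_Archimedean2 by blast
    show "\<exists>M. \<forall>p\<ge>M. \<forall>q\<ge>M. dist (u p) (u q) < e"
    proof (intro exI allI impI)
      fix p q assume "p \<ge> N" "q \<ge> N"
      then have "2 / real (Suc p) + 2 / real (Suc q) \<le> 2 / real (Suc N) + 2 / real (Suc N)"
        by (intro add_mono divide_left_mono) auto
      also have "\<dots> < e\<^sup>2"
      proof -
        have "4 < real N * e\<^sup>2" using N e by (simp add: divide_less_eq)
        also have "\<dots> \<le> real (Suc N) * e\<^sup>2" by (intro mult_right_mono) auto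
        finally have "4 / real (Suc N) < e\<^sup>2" by (simp add: divide_less_eq mult.commute)
        then show ?thesis by simp
      qed
      finally have "(norm (u p - u q))\<^sup>2 < e\<^sup>2" using dist[of p q] by linarith
      then show "dist (u p) (u q) < e" unfolding dist_norm using e
        by (auto intro: power2_less_imp_less)
    qed
  qed
  then obtain l where l: "u \<longlonglongrightarrow> l" using Cauchy_convergent convergent_def by blast
  have "(\<lambda>n. J (u n)) \<longlonglongrightarrow> J l"
    unfolding J_def by (intro tendsto_intros l \<phi>.tendsto)
  moreover have "(\<lambda>n. m + 1 / real (Suc n)) \<longlonglongrightarrow> m + 0"
    by (intro tendsto_add tendsto_const) (rule LIMSEQ_inverse_real_of_nat[unfolded inverse_eq_divide])
  ultimately have "J l \<le> m + 0"
    by (rule LIMSEQ_le) (use u less_imp_le in blast)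
  then have Jl: "J l \<le> m" by simp
  have Re_eq: "Re (\<phi> v) = Re (cinner v l)" for v
  proof -
    define d where "d = Re (cinner v l) - Re (\<phi> v)"
    define V where "V = (norm v)\<^sup>2"
    have V: "V \<ge> 0" by (simp add: V_def)
    have pos: "0 \<le> t\<^sup>2 * V + 2 * t * d" for t
    proof -
      have "J (l + t *\<^sub>R v) = J l + (t\<^sup>2 * V + 2 * t * d)"
        unfolding J_def d_def V_def norm_add_sq \<phi>.add \<phi>.scaleR
        by (simp add: power_mult_distrib cinner_scaleR_right Re_cinner_commute[of v] algebra_simps)
      then show ?thesis using Jl m_le[of "l + t *\<^sub>R v"] by linarith
    qed
    define t where "t = - d / (V + 1)"
    have t: "t * (V + 1) = - d" using V by (simp add: t_def)
    have "0 \<le> (V + 1)\<^sup>2 * (t\<^sup>2 * V + 2 * t * d)"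
      by (intro mult_nonneg_nonneg pos) auto
    also have "\<dots> = (t * (V + 1))\<^sup>2 * V + 2 * (t * (V + 1)) * (V + 1) * d"
      by (simp add: power2_eq_square algebra_simps)
    also have "\<dots> = - (d\<^sup>2 * (V + 2))"
      unfolding t by (simp add: power2_eq_square algebra_simps)
    finally have "d\<^sup>2 * (V + 2) \<le> 0" by simp
    then have "d = 0" using V by (simp add: mult_le_0_iff)
    then show ?thesis by (simp add: d_def)
  qed
  have "\<phi> v = cinner v l" for v
  proof (rule complex_eqI)
    show "Im (\<phi> v) = Im (cinner v l)"
      using Re_eq[of "(- \<i>) *\<^sub>C v"] by (simp add: lin cinner_scaleC_left)
  qed (rule Re_eq)
  then show ?thesis by blast
qed

section \<open>Complex-linear operators and adjoints\<close>

instance blinfun :: (real_normed_vector, complex_normed_vector) complex_normed_vector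
proof
  fix c :: complex and T :: "'a \<Rightarrow>\<^sub>L 'b"
  have le: "norm (c *\<^sub>C T) \<le> cmod c * norm T" for c and T :: "'a \<Rightarrow>\<^sub>L 'b"
    by (rule norm_blinfun_bound)
      (auto simp: scaleC_blinfun.rep_eq norm_scaleC mult.assoc intro: mult_left_mono norm_blinfun)
  show "norm (c *\<^sub>C T) = cmod c * norm T"
  proof (cases "c = 0")
    case False
    have "norm T = norm (inverse c *\<^sub>C c *\<^sub>C T)" using False by (simp add: scaleC_scaleC)
    also have "\<dots> \<le> inverse (cmod c) * norm (c *\<^sub>C T)" using le[of "inverse c"] by (simp add: norm_inverse)
    finally show ?thesis using False le[of c T] by (simp add: field_simps)
  qed (use le[of c T] in simp)
qed

lemma clinear_opsD: "T \<in> clinear_ops \<Longrightarrow> blinfun_apply T (c *\<^sub>C x) = c *\<^sub>C blinfun_apply T x"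
  by (simp add: clinear_ops_def)

lemma scaleC_minus_right: "c *\<^sub>C (- x) = - (c *\<^sub>C (x :: 'a :: complex_vector))"
proof -
  have "c *\<^sub>C x + c *\<^sub>C (- x) = 0"
    using scaleC_add_right[of c 0 "0 :: 'a"] scaleC_add_right[of c x "- x"] by simp
  then show ?thesis by (simp add: eq_neg_iff_add_eq_0 add.commute)
qed

lemma scaleC_diff_right: "c *\<^sub>C (x - y) = c *\<^sub>C x - c *\<^sub>C (y :: 'a :: complex_vector)"
  using scaleC_add_right[of c x "- y"] by (simp add: scaleC_minus_right)

lemma scaleC_zero_right [simp]: "c *\<^sub>C 0 = (0 :: 'a :: complex_vector)"
  using scaleC_diff_right[of c 0 0] by simp

lemma scaleC_zero_left [simp]: "0 *\<^sub>C x = (0 :: 'a :: complex_vector)"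
  using scaleC_of_real[of 0 x] by simp

lemma scaleC_sum_right: "c *\<^sub>C (\<Sum>i\<in>I. f i) = (\<Sum>i\<in>I. c *\<^sub>C (f i :: 'a :: complex_vector))"
  by (induction I rule: infinite_finite_induct) (simp_all add: scaleC_add_right)

lemma scaleC_sum_left: "(\<Sum>i\<in>I. f i) *\<^sub>C x = (\<Sum>i\<in>I. f i *\<^sub>C (x :: 'a :: complex_vector))"
  by (induction I rule: infinite_finite_induct) (simp_all add: scaleC_add_left)

lemma scaleC_scaleR: "c *\<^sub>C (r *\<^sub>R x) = r *\<^sub>R (c *\<^sub>C (x :: 'a :: complex_vector))"
  by (simp add: scaleC_of_real[symmetric] scaleC_scaleC mult.commute)

lemma clinear_ops_id [simp]: "id_blinfun \<in> clinear_ops"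
  and clinear_ops_0 [simp]: "0 \<in> clinear_ops"
  by (simp_all add: clinear_ops_def)

lemma clinear_ops_compose: "S \<in> clinear_ops \<Longrightarrow> T \<in> clinear_ops \<Longrightarrow> S o\<^sub>L T \<in> clinear_ops"
  by (simp add: clinear_ops_def)

lemma clinear_ops_add: "S \<in> clinear_ops \<Longrightarrow> T \<in> clinear_ops \<Longrightarrow> S + T \<in> clinear_ops"
  by (simp add: clinear_ops_def blinfun.add_left scaleC_add_right)

lemma clinear_ops_diff: "S \<in> clinear_ops \<Longrightarrow> T \<in> clinear_ops \<Longrightarrow> S - T \<in> clinear_ops"
  by (simp add: clinear_ops_def blinfun.diff_left scaleC_diff_right)

lemma clinear_ops_scaleR: "T \<in> clinear_ops \<Longrightarrow> r *\<^sub>R T \<in> clinear_ops"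
  by (simp add: clinear_ops_def blinfun.scaleR_left scaleC_scaleR)

lemma clinear_ops_scaleC: "T \<in> clinear_ops \<Longrightarrow> d *\<^sub>C T \<in> clinear_ops"
  by (simp add: clinear_ops_def scaleC_blinfun.rep_eq scaleC_scaleC mult.commute)

lemma clinear_ops_sum: "(\<And>i. i \<in> I \<Longrightarrow> f i \<in> clinear_ops) \<Longrightarrow> (\<Sum>i\<in>I. f i) \<in> clinear_ops"
  by (induction I rule: infinite_finite_induct) (simp_all add: clinear_ops_add)

lemma clinear_ops_embed [simp]: "embed i \<in> clinear_ops"
  by (simp add: clinear_ops_def embed.rep_eq axis_def scaleC_vec_def vec_eq_iff)

lemma clinear_ops_row_op: "(\<And>i. X i \<in> clinear_ops) \<Longrightarrow> row_op X \<in> clinear_ops"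
  by (simp add: clinear_ops_def row_op.rep_eq scaleC_vec_def scaleC_sum_right)

lemmas clinear_ops_intros = clinear_ops_id clinear_ops_0 clinear_ops_compose clinear_ops_add
  clinear_ops_diff clinear_ops_scaleR clinear_ops_scaleC clinear_ops_sum clinear_ops_embed
  clinear_ops_row_op

lemma adj_eqI:
  assumes "\<And>x y. cinner (blinfun_apply T x) y = cinner x (blinfun_apply S y)"
  shows "adj T = S"
  unfolding adj_def
proof (rule the_equality)
  fix S' assume "\<forall>x y. cinner (blinfun_apply T x) y = cinner x (blinfun_apply S' y)"
  then show "S' = S" using assms by (intro blinfun_eqI cinner_ext) metis
qed (use assms in blast)

text \<open>The representation theorem supplies the adjoint, so that the definite description in
  \<open>adj\<close> denotes.\<close>

lemma cinner_adj_right: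
  fixes T :: "'a :: chilbert_space \<Rightarrow>\<^sub>L 'b :: complex_inner"
  assumes T: "T \<in> clinear_ops"
  shows "cinner (blinfun_apply T x) y = cinner x (blinfun_apply (adj T) y)"
proof -
  have "\<exists>u. \<forall>x. cinner (blinfun_apply T x) y = cinner x u" for y
    by (rule riesz_representation)
      (auto simp: clinear_opsD[OF T] cinner_scaleC_left
        intro: bounded_linear_compose[OF cinner.bounded_linear_left blinfun.bounded_linear_right])
  then obtain S where S: "\<And>x y. cinner (blinfun_apply T x) y = cinner x (S y)" by metis
  have "bounded_linear S"
  proof (rule bounded_linear_intro[where K = "norm T"])
    fix x y
    show "S (x + y) = S x + S y"
      by (rule cinner_ext) (metis S cinner_add_right)
    have sq: "(norm (S x))\<^sup>2 \<le> (norm T * norm (S x)) * norm x"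
    proof -
      have "(norm (S x))\<^sup>2 = Re (cinner (blinfun_apply T (S x)) x)" by (simp add: S cinner_self)
      also have "\<dots> \<le> norm (blinfun_apply T (S x)) * norm x"
        by (rule Re_cinner_le)
      also have "\<dots> \<le> (norm T * norm (S x)) * norm x"
        by (intro mult_right_mono norm_blinfun) auto
      finally show ?thesis .
    qed
    show "norm (S x) \<le> norm x * norm T"
    proof (cases "S x = 0")
      case False
      have "norm (S x) * norm (S x) \<le> norm (S x) * (norm x * norm T)"
        using sq by (simp add: power2_eq_square algebra_simps)
      then show ?thesis using False by (subst (asm) mult_le_cancel_left_pos) auto
    qed simp
  next
    fix r x show "S (r *\<^sub>R x) = r *\<^sub>R S x"
      by (rule cinner_ext) (metis S cinner_scaleR_right)
  qed
  then have "blinfun_apply (Blinfun S) = S" by (rule bounded_linear_Blinfun_apply)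
  then have "adj T = Blinfun S" by (intro adj_eqI) (simp add: S)
  then show ?thesis using \<open>blinfun_apply (Blinfun S) = S\<close> S by simp
qed

lemma cinner_adj_left:
  fixes T :: "'a :: chilbert_space \<Rightarrow>\<^sub>L 'b :: complex_inner"
  assumes "T \<in> clinear_ops"
  shows "cinner (blinfun_apply (adj T) y) x = cinner y (blinfun_apply T x)"
  by (metis assms cinner_adj_right cinner_commute)

lemma clinear_ops_adj:
  fixes T :: "'a :: chilbert_space \<Rightarrow>\<^sub>L 'b :: complex_inner"
  assumes T: "T \<in> clinear_ops"
  shows "adj T \<in> clinear_ops"
proof -
  have "blinfun_apply (adj T) (c *\<^sub>C y) = c *\<^sub>C blinfun_apply (adj T) y" for c y
    by (rule cinner_ext) (simp only: cinner_adj_right[OF T, symmetric] cinner_scaleC_right)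
  then show ?thesis by (simp add: clinear_ops_def)
qed

lemma adj_adj:
  fixes T :: "'a :: chilbert_space \<Rightarrow>\<^sub>L 'b :: complex_inner"
  assumes T: "T \<in> clinear_ops"
  shows "adj (adj T) = T"
  by (rule adj_eqI) (simp add: cinner_adj_left[OF T])

lemma norm_op_le_norm_compose_adj:
  fixes T :: "'a :: chilbert_space \<Rightarrow>\<^sub>L 'b :: complex_inner"
  assumes T: "T \<in> clinear_ops"
  shows "(norm (adj T))\<^sup>2 \<le> norm (T o\<^sub>L adj T)"
proof -
  have "norm (adj T) \<le> sqrt (norm (T o\<^sub>L adj T))"
  proof (rule norm_blinfun_bound)
    fix y
    have "(norm (blinfun_apply (adj T) y))\<^sup>2 = Re (cinner (blinfun_apply (T o\<^sub>L adj T) y) y)"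
      by (simp add: Re_cinner_self[symmetric] cinner_adj_right[OF T])
    also have "\<dots> \<le> norm (blinfun_apply (T o\<^sub>L adj T) y) * norm y"
      by (rule Re_cinner_le)
    also have "\<dots> \<le> (norm (T o\<^sub>L adj T) * norm y) * norm y"
      by (intro mult_right_mono norm_blinfun) auto
    also have "\<dots> = (sqrt (norm (T o\<^sub>L adj T)) * norm y)\<^sup>2"
      by (simp add: power_mult_distrib power2_eq_square algebra_simps)
    finally show "norm (blinfun_apply (adj T) y) \<le> sqrt (norm (T o\<^sub>L adj T)) * norm y"
      by (rule power2_le_imp_le) simp
  qed simp
  then have "(norm (adj T))\<^sup>2 \<le> (sqrt (norm (T o\<^sub>L adj T)))\<^sup>2" by (rule power_mono) simp
  then show ?thesis by simp
qed

lemma norm_adj: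
  fixes T :: "'a :: chilbert_space \<Rightarrow>\<^sub>L 'b :: chilbert_space"
  assumes T: "T \<in> clinear_ops"
  shows "norm (adj T) = norm T"
proof -
  have le: "norm (adj T) \<le> norm T" if T: "T \<in> clinear_ops"
    for T :: "'x :: chilbert_space \<Rightarrow>\<^sub>L 'y :: complex_inner"
  proof (cases "norm (adj T) = 0")
    case False
    have "norm (adj T) * norm (adj T) \<le> norm T * norm (adj T)"
      using norm_op_le_norm_compose_adj[OF T] norm_blinfun_compose[of T "adj T"]
      by (simp add: power2_eq_square)
    then show ?thesis using False by simp
  qed simp
  show ?thesis using le[OF T] le[OF clinear_ops_adj[OF T]] adj_adj[OF T] by simp
qed

lemma norm_compose_adj:
  fixes T :: "'a :: chilbert_space \<Rightarrow>\<^sub>L 'b :: chilbert_space"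
  assumes T: "T \<in> clinear_ops"
  shows "norm (T o\<^sub>L adj T) = (norm T)\<^sup>2"
  using norm_op_le_norm_compose_adj[OF T] norm_blinfun_compose[of T "adj T"] norm_adj[OF T]
  by (simp add: power2_eq_square)

section \<open>Row operators\<close>

lemma embed_nth: "blinfun_apply (embed i) x $ j = (if j = i then x else 0)"
  by (simp add: embed.rep_eq axis_def)

lemma sum_embed_nth:
  "blinfun_apply (\<Sum>i\<in>UNIV. embed i o\<^sub>L T i) x $ j = blinfun_apply (T (j :: 'n :: finite)) x"
  by (simp add: blinfun.sum_left embed_nth)

lemma row_op_embed: "row_op X o\<^sub>L embed i = X i"
  using entries_row_op[of X] by (simp add: entries_def fun_eq_iff)

lemma norm_vec_sq: "(norm (v :: 'a :: real_normed_vector ^ 'n :: finite))\<^sup>2 = (\<Sum>i\<in>UNIV. (norm (v $ i))\<^sup>2)"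
  by (simp add: norm_vec_def L2_set_def sum_nonneg)

lemma norm_embed_le: "norm (embed i) \<le> 1"
proof (rule norm_blinfun_bound)
  fix x :: 'a
  have "(norm (blinfun_apply (embed i) x))\<^sup>2 = (\<Sum>j\<in>UNIV. if j = i then (norm x)\<^sup>2 else 0)"
    unfolding norm_vec_sq embed_nth by (intro sum.cong) auto
  then show "norm (blinfun_apply (embed i) x) \<le> 1 * norm x" by simp
qed simp

lemma norm_le_norm_row_op: "norm (X i) \<le> norm (row_op X)"
proof -
  have "norm (row_op X o\<^sub>L embed i) \<le> norm (row_op X) * 1"
    by (intro order_trans[OF norm_blinfun_compose] mult_left_mono norm_embed_le) simp
  then show ?thesis by (simp add: row_op_embed)
qed

lemma row_op_scaleR: "row_op (\<lambda>i. r *\<^sub>R X i) = r *\<^sub>R row_op X"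
  by (rule blinfun_eqI) (simp add: row_op.rep_eq blinfun.scaleR_left scaleR_sum_right)

lemma adj_row_op:
  fixes X :: "('h :: chilbert_space, 'n :: finite) op_tuple"
  assumes "\<And>i. X i \<in> clinear_ops"
  shows "adj (row_op X) = (\<Sum>i\<in>UNIV. embed i o\<^sub>L adj (X i))"
  by (rule adj_eqI)
    (simp add: row_op.rep_eq cinner_vec_def sum_embed_nth cinner.sum_left cinner_adj_right assms)

lemma adj_row_op_nth:
  fixes X :: "('h :: chilbert_space, 'n :: finite) op_tuple"
  assumes "\<And>i. X i \<in> clinear_ops"
  shows "blinfun_apply (adj (row_op X)) x $ i = blinfun_apply (adj (X i)) x"
  by (simp add: adj_row_op assms sum_embed_nth)

text \<open>\<open>\<Sum>\<^sub>i X\<^sub>i X\<^sub>i\<^sup>*\<close> is \<open>R R\<^sup>*\<close> for the row operator \<open>R\<close>, and \<open>\<parallel>R R\<^sup>*\<parallel> = \<parallel>R\<parallel>\<^sup>2\<close>.\<close>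

lemma tuple_norm_eq_norm_row_op:
  fixes X :: "('h :: chilbert_space, 'n :: finite) op_tuple"
  assumes X: "\<And>i. X i \<in> clinear_ops"
  shows "tuple_norm X = norm (row_op X)"
proof -
  have "(\<Sum>i\<in>UNIV. X i o\<^sub>L adj (X i)) = row_op X o\<^sub>L adj (row_op X)"
    by (rule blinfun_eqI) (simp add: blinfun.sum_left row_op.rep_eq adj_row_op_nth[OF X])
  then show ?thesis
    unfolding tuple_norm_def by (simp add: norm_compose_adj clinear_ops_row_op X)
qed

lemma op_ball_iff:
  "X \<in> op_ball \<longleftrightarrow> (\<forall>i. X i \<in> clinear_ops) \<and> norm (row_op (X :: ('h :: chilbert_space, 'n :: finite) op_tuple)) < 1"
  unfolding op_ball_def by (auto simp: tuple_norm_eq_norm_row_op)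

lemma op_cball_iff:
  "X \<in> op_cball \<longleftrightarrow> (\<forall>i. X i \<in> clinear_ops) \<and> norm (row_op (X :: ('h :: chilbert_space, 'n :: finite) op_tuple)) \<le> 1"
  unfolding op_cball_def by (auto simp: tuple_norm_eq_norm_row_op)

section \<open>Neumann series\<close>

instance chilbert_space \<subseteq> banach ..

lemma blinfun_compose_assoc: "(S o\<^sub>L T) o\<^sub>L U = S o\<^sub>L (T o\<^sub>L U)"
  by (rule blinfun_eqI) simp

lemma blinfun_compose_id [simp]: "T o\<^sub>L id_blinfun = T" "id_blinfun o\<^sub>L T = T"
  by (auto intro: blinfun_eqI)

lemma sums_tail_bound:
  fixes f :: "nat \<Rightarrow> 'a :: banach"
  assumes f: "f sums S" and le: "\<And>k. norm (f k) \<le> K * q ^ k" and q: "0 \<le> q" "q < 1"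
  shows "norm (S - (\<Sum>k<N. f k)) \<le> K * q ^ N / (1 - q)"
proof -
  have geo: "summable (\<lambda>k. K * q ^ (k + N))"
    using q by (intro summable_mult summable_ignore_initial_segment[OF summable_geometric]) simp
  have "S - (\<Sum>k<N. f k) = (\<Sum>k. f (k + N))"
    using suminf_minus_initial_segment[OF sums_summable[OF f], of N] sums_unique[OF f] by simp
  also have "norm \<dots> \<le> (\<Sum>k. norm (f (k + N)))"
    by (rule summable_norm) (rule summable_comparison_test[OF _ geo], use le in auto)
  also have "\<dots> \<le> (\<Sum>k. K * q ^ (k + N))"
    by (intro suminf_le le geo summable_comparison_test[OF _ geo]) (use le in auto)
  also have "\<dots> = K * q ^ N * (\<Sum>k. q ^ k)"
  proof -
    have "(\<lambda>k. K * q ^ (k + N)) = (\<lambda>k. (K * q ^ N) * q ^ k)" by (simp add: power_add fun_eq_iff)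
    then show ?thesis using q by (simp add: suminf_mult[OF summable_geometric])
  qed
  also have "\<dots> = K * q ^ N / (1 - q)" using q by (simp add: suminf_geometric)
  finally show ?thesis .
qed

primrec op_power :: "nat \<Rightarrow> ('a :: real_normed_vector \<Rightarrow>\<^sub>L 'a) \<Rightarrow> 'a \<Rightarrow>\<^sub>L 'a" where
  "op_power 0 T = id_blinfun"
| "op_power (Suc k) T = T o\<^sub>L op_power k T"

lemma op_power_Suc_right: "op_power k T o\<^sub>L T = op_power (Suc k) T"
  by (induction k) (simp_all add: blinfun_compose_assoc)

lemma norm_op_power_le: "norm (op_power k T) \<le> norm T ^ k"
proof (induction k)
  case (Suc k)
  have "norm (op_power (Suc k) T) \<le> norm T * norm (op_power k T)"
    by (simp add: norm_blinfun_compose)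
  also have "\<dots> \<le> norm T * norm T ^ k" using Suc by (rule mult_left_mono) simp
  finally show ?case by simp
qed (simp add: norm_blinfun_id_le)

text \<open>The error bound depends on \<open>T\<close> only through \<open>q\<close>; this uniformity turns the inverses
  \<open>(I - X l\<^sup>*)\<^sup>-\<^sup>1\<close> into uniform limits of polynomials in \<open>X\<close>.\<close>

lemma neumann_series:
  fixes T :: "'a :: banach \<Rightarrow>\<^sub>L 'a"
  assumes T: "norm T \<le> q" and q: "q < 1"
  obtains C where "C o\<^sub>L (id_blinfun - T) = id_blinfun" "(id_blinfun - T) o\<^sub>L C = id_blinfun"
    "\<And>k. norm (C - (\<Sum>j<k. op_power j T)) \<le> q ^ k / (1 - q)"
proof
  have q0: "0 \<le> q" using T norm_ge_zero order_trans by blast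
  have le: "norm (op_power k T) \<le> q ^ k" for k
    using norm_op_power_le[of k T] power_mono[OF T, of k] by simp
  have geo: "summable (\<lambda>k. q ^ k)" using q q0 by (intro summable_geometric) simp
  have summ: "summable (\<lambda>k. op_power k T)"
    by (rule summable_comparison_test[OF _ geo]) (use le in auto)
  define C where "C = (\<Sum>k. op_power k T)"
  have shift: "(\<Sum>k. op_power (Suc k) T) = C - id_blinfun"
    using suminf_split_head[OF summ] by (simp add: C_def)
  have "C o\<^sub>L T = (\<Sum>k. op_power k T o\<^sub>L T)"
    unfolding C_def
    by (rule bounded_linear.suminf[OF bounded_bilinear.bounded_linear_left[OF
            bounded_bilinear_blinfun_compose] summ])
  then have "C o\<^sub>L T = C - id_blinfun" unfolding op_power_Suc_right shift .
  then show "C o\<^sub>L (id_blinfun - T) = id_blinfun"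
    by (simp add: bounded_bilinear.diff_right[OF bounded_bilinear_blinfun_compose])
  have "T o\<^sub>L C = (\<Sum>k. T o\<^sub>L op_power k T)"
    unfolding C_def
    by (rule bounded_linear.suminf[OF bounded_bilinear.bounded_linear_right[OF
            bounded_bilinear_blinfun_compose] summ])
  then have "T o\<^sub>L C = C - id_blinfun" using shift by simp
  then show "(id_blinfun - T) o\<^sub>L C = id_blinfun"
    by (simp add: bounded_bilinear.diff_left[OF bounded_bilinear_blinfun_compose])
  fix k
  show "norm (C - (\<Sum>j<k. op_power j T)) \<le> q ^ k / (1 - q)"
    using sums_tail_bound[OF summable_sums[OF summ], of 1 q k] le q q0 by (simp add: C_def)
qed

lemma inv_op_eq:
  assumes "C o\<^sub>L M = id_blinfun" "M o\<^sub>L C = id_blinfun"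
  shows "inv_op M = C"
  unfolding inv_op_def
proof (rule the_equality)
  fix S assume S: "S o\<^sub>L M = id_blinfun \<and> M o\<^sub>L S = id_blinfun"
  have "S = S o\<^sub>L (M o\<^sub>L C)" using assms by (auto intro: blinfun_eqI)
  also have "\<dots> = C" using S by (simp add: blinfun_compose_assoc[symmetric])
  finally show "S = C" .
qed (use assms in blast)

lemma clinear_ops_inverse:
  assumes "C o\<^sub>L M = id_blinfun" "M o\<^sub>L C = id_blinfun" "M \<in> clinear_ops"
  shows "C \<in> clinear_ops"
proof -
  have CM: "blinfun_apply C (blinfun_apply M x) = x" for x
    using arg_cong[OF assms(1), of "\<lambda>T. blinfun_apply T x"] by simp
  have MC: "blinfun_apply M (blinfun_apply C x) = x" for x
    using arg_cong[OF assms(2), of "\<lambda>T. blinfun_apply T x"] by simp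
  have "blinfun_apply C (c *\<^sub>C x) = c *\<^sub>C blinfun_apply C x" for c x
    using CM[of "c *\<^sub>C blinfun_apply C x"] by (simp add: clinear_opsD[OF assms(3)] MC)
  then show ?thesis by (simp add: clinear_ops_def)
qed

section \<open>The automorphisms\<close>

abbreviation scalar_row :: "complex ^ 'n \<Rightarrow> ('h :: complex_normed_vector ^ 'n :: finite) \<Rightarrow>\<^sub>L 'h" where
  "scalar_row l \<equiv> row_op (scalar_tuple l)"

lemma clinear_scalar_tuple [simp]: "scalar_tuple l i \<in> clinear_ops"
  by (simp add: scalar_tuple_def clinear_ops_intros)

lemma clinear_scalar_row [simp]: "scalar_row l \<in> clinear_ops"
  by (simp add: clinear_ops_row_op)

lemma adj_scalar_tuple: "adj (scalar_tuple l i) = cnj (l $ i) *\<^sub>C (id_blinfun :: 'h :: complex_inner \<Rightarrow>\<^sub>L 'h)"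
  by (rule adj_eqI) (simp add: scalar_tuple_def scaleC_blinfun.rep_eq cinner_linear)

lemma scalar_row_apply: "blinfun_apply (scalar_row l) v = (\<Sum>i\<in>UNIV. (l $ i) *\<^sub>C (v $ i))"
  by (simp add: row_op.rep_eq scalar_tuple_def scaleC_blinfun.rep_eq)

lemma adj_scalar_row_nth:
  "blinfun_apply (adj (scalar_row l)) (x :: 'h :: chilbert_space) $ i = cnj (l $ i) *\<^sub>C x"
  by (simp add: adj_row_op_nth adj_scalar_tuple scaleC_blinfun.rep_eq)

lemma scalar_row_adj:
  "blinfun_apply (scalar_row l) (blinfun_apply (adj (scalar_row l)) x) = (norm l)\<^sup>2 *\<^sub>R (x :: 'h :: chilbert_space)"
proof -
  have "(\<Sum>i\<in>UNIV. l $ i * cnj (l $ i)) = complex_of_real ((norm l)\<^sup>2)"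
    by (simp add: norm_vec_sq complex_norm_square[symmetric])
  then show ?thesis
    by (simp add: scalar_row_apply adj_scalar_row_nth scaleC_scaleC scaleC_sum_left[symmetric]
        scaleC_of_real[symmetric])
qed

lemma norm_scalar_row_le: "norm (scalar_row l :: ('h :: chilbert_space ^ 'n :: finite) \<Rightarrow>\<^sub>L 'h) \<le> norm l"
proof -
  let ?L = "scalar_row l :: ('h ^ 'n) \<Rightarrow>\<^sub>L 'h"
  have "?L o\<^sub>L adj ?L = (norm l)\<^sup>2 *\<^sub>R id_blinfun"
    by (rule blinfun_eqI) (simp add: scalar_row_adj blinfun.scaleR_left)
  then have "(norm ?L)\<^sup>2 = (norm l)\<^sup>2 * norm (id_blinfun :: 'h \<Rightarrow>\<^sub>L 'h)"
    using norm_compose_adj[of ?L] by simp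
  also have "\<dots> \<le> (norm l)\<^sup>2 * 1" by (intro mult_left_mono norm_blinfun_id_le) simp
  finally have "(norm ?L)\<^sup>2 \<le> (norm l)\<^sup>2" by simp
  then show ?thesis by (rule power2_le_imp_le) simp
qed

lemma norm_le_norm_scalar_row:
  fixes x :: "'h :: chilbert_space"
  assumes "x \<noteq> 0"
  shows "norm l \<le> norm (scalar_row l :: ('h ^ 'n :: finite) \<Rightarrow>\<^sub>L 'h)"
proof -
  let ?L = "scalar_row l :: ('h ^ 'n) \<Rightarrow>\<^sub>L 'h"
  have "(norm l)\<^sup>2 * norm x = norm (blinfun_apply (?L o\<^sub>L adj ?L) x)"
    by (simp add: scalar_row_adj)
  also have "\<dots> \<le> (norm ?L)\<^sup>2 * norm x"
    using norm_blinfun[of "?L o\<^sub>L adj ?L" x] by (simp add: norm_compose_adj)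
  finally have "(norm l)\<^sup>2 \<le> (norm ?L)\<^sup>2" using assms by simp
  then show ?thesis by (rule power2_le_imp_le) simp
qed

text \<open>Uniqueness of the positive square root: if \<open>S\<^sup>2 = D\<^sup>2\<close> and \<open>S\<close> commutes with \<open>D\<close>, then
  \<open>(S + D)(S - D) = 0\<close>, and \<open>S + D\<close> is bounded below because \<open>D\<close> is.  Here \<open>S\<close> commutes with
  \<open>T = S\<^sup>2\<close>, hence with \<open>D\<close> by the last hypothesis.\<close>

lemma sqrt_op_eqI:
  assumes D: "D \<in> clinear_ops" and sa: "\<And>x y. cinner (blinfun_apply D x) y = cinner x (blinfun_apply D y)"
    and s: "s > 0" and ge: "\<And>x. s * (norm x)\<^sup>2 \<le> Re (cinner (blinfun_apply D x) x)"
    and DD: "D o\<^sub>L D = T"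
    and comm: "\<And>S. S o\<^sub>L T = T o\<^sub>L S \<Longrightarrow> S o\<^sub>L D = D o\<^sub>L S"
  shows "sqrt_op T = D"
  unfolding sqrt_op_def
proof (rule the_equality)
  have "cinner (blinfun_apply D x) x \<in> \<real>" for x
    using cinner_commute[of "blinfun_apply D x" x] sa[of x x] Reals_cnj_iff by metis
  moreover have "0 \<le> Re (cinner (blinfun_apply D x) x)" for x
    using ge[of x] s by (meson mult_nonneg_nonneg less_imp_le order_trans zero_le_power2)
  ultimately show "positive_op D \<and> D o\<^sub>L D = T"
    unfolding positive_op_def using D DD by blast
next
  fix S assume S: "positive_op S \<and> S o\<^sub>L S = T"
  have "S o\<^sub>L T = T o\<^sub>L S" using S blinfun_compose_assoc by metis
  then have SD: "S o\<^sub>L D = D o\<^sub>L S" by (rule comm)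
  show "S = D"
  proof (rule blinfun_eqI)
    fix x
    define y where "y = blinfun_apply S x - blinfun_apply D x"
    have *: "blinfun_apply S (blinfun_apply S x) = blinfun_apply D (blinfun_apply D x)"
      "blinfun_apply S (blinfun_apply D x) = blinfun_apply D (blinfun_apply S x)"
      using S DD SD by (metis blinfun_apply_blinfun_compose)+
    have "blinfun_apply S y + blinfun_apply D y = 0"
      unfolding y_def blinfun.diff_right * by simp
    then have "cinner (blinfun_apply S y) y + cinner (blinfun_apply D y) y = 0"
      by (simp add: cinner_add_left[symmetric])
    then have "Re (cinner (blinfun_apply S y) y) + Re (cinner (blinfun_apply D y) y) = 0"
      by (metis plus_complex.sel(1) zero_complex.sel(1))
    moreover have "0 \<le> Re (cinner (blinfun_apply S y) y)" using S by (simp add: positive_op_def)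
    ultimately have "s * (norm y)\<^sup>2 \<le> 0" using ge[of y] by linarith
    then have "y = 0" using s by (simp add: mult_le_0_iff)
    then show "blinfun_apply S x = blinfun_apply D x" by (simp add: y_def)
  qed
qed

text \<open>Since \<open>A A\<^sup>* = \<kappa> I\<close>, the operator \<open>A\<^sup>*A\<close> is \<open>\<kappa>\<close> times a projection, so the square root is
  \<open>(1 - \<kappa>)\<^sup>1\<^sup>/\<^sup>2\<close> on its range and the identity on the complement; the coefficient is
  \<open>(1 - (1 - \<kappa>)\<^sup>1\<^sup>/\<^sup>2) / \<kappa>\<close>, written without a division by \<open>\<kappa>\<close>, which may vanish.\<close>

lemma sqrt_op_defect:
  fixes A :: "'k :: chilbert_space \<Rightarrow>\<^sub>L 'h :: chilbert_space"
  assumes A: "A \<in> clinear_ops" and AA: "\<And>x. blinfun_apply A (blinfun_apply (adj A) x) = \<kappa> *\<^sub>R x"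
    and nA: "(norm A)\<^sup>2 \<le> \<kappa>" and \<kappa>: "\<kappa> < 1"
  shows "sqrt_op (id_blinfun - (adj A o\<^sub>L A)) = id_blinfun - (1 / (1 + sqrt (1 - \<kappa>))) *\<^sub>R (adj A o\<^sub>L A)"
proof (rule sqrt_op_eqI)
  define s where "s = sqrt (1 - \<kappa>)"
  have s: "s > 0" and s2: "s\<^sup>2 = 1 - \<kappa>" using \<kappa> by (simp_all add: s_def)
  define c where "c = 1 / (1 + s)"
  have c: "c > 0" using s by (simp add: c_def)
  have cs: "c * (1 + s) = 1" using s by (simp add: c_def)
  have c\<kappa>: "c * \<kappa> = 1 - s"
  proof -
    have "\<kappa> = (1 - s) * (1 + s)" using s2 by (simp add: power2_eq_square algebra_simps)
    then show ?thesis using cs by (metis mult.assoc mult.commute mult.right_neutral)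
  qed
  let ?D = "id_blinfun - (1 / (1 + sqrt (1 - \<kappa>))) *\<^sub>R (adj A o\<^sub>L A)"
  have D: "?D = id_blinfun - c *\<^sub>R (adj A o\<^sub>L A)" by (simp add: c_def s_def)
  show "?D \<in> clinear_ops" using A by (simp add: clinear_ops_intros clinear_ops_adj)
  show "cinner (blinfun_apply ?D x) y = cinner x (blinfun_apply ?D y)" for x y
    unfolding D by (simp add: blinfun.diff_left blinfun.scaleR_left cinner_linear
        cinner_adj_left[OF A] cinner_adj_right[OF A, symmetric])
  show "s > 0" by (rule s)
  show "s * (norm x)\<^sup>2 \<le> Re (cinner (blinfun_apply ?D x) x)" for x
  proof -
    have "Re (cinner (blinfun_apply ?D x) x) = (norm x)\<^sup>2 - c * (norm (blinfun_apply A x))\<^sup>2"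
      unfolding D by (simp add: blinfun.diff_left blinfun.scaleR_left cinner_linear
        cinner_adj_left[OF A] cinner_self)
    moreover have "c * (norm (blinfun_apply A x))\<^sup>2 \<le> c * (\<kappa> * (norm x)\<^sup>2)"
    proof (rule mult_left_mono)
      have "(norm (blinfun_apply A x))\<^sup>2 \<le> (norm A * norm x)\<^sup>2"
        by (intro power_mono norm_blinfun) simp
      also have "\<dots> \<le> \<kappa> * (norm x)\<^sup>2"
        using nA by (simp add: power_mult_distrib mult_right_mono)
      finally show "(norm (blinfun_apply A x))\<^sup>2 \<le> \<kappa> * (norm x)\<^sup>2" .
    qed (use c in simp)
    moreover have "c * (\<kappa> * (norm x)\<^sup>2) = (1 - s) * (norm x)\<^sup>2"
      using c\<kappa> by (simp add: mult.assoc[symmetric])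
    ultimately show ?thesis by (simp add: algebra_simps)
  qed
  show "?D o\<^sub>L ?D = id_blinfun - (adj A o\<^sub>L A)"
  proof (rule blinfun_eqI)
    fix x
    define P where "P = blinfun_apply (adj A) (blinfun_apply A x)"
    have "blinfun_apply (?D o\<^sub>L ?D) x = x - c *\<^sub>R P - c *\<^sub>R (P - c *\<^sub>R (\<kappa> *\<^sub>R P))"
      unfolding D P_def
      by (simp add: blinfun.diff_left blinfun.scaleR_left blinfun.diff_right blinfun.scaleR_right AA)
    also have "\<dots> = x - (c + c - c * (c * \<kappa>)) *\<^sub>R P"
      by (simp only: scaleR_diff_right scaleR_diff_left scaleR_add_left scaleR_scaleR mult.assoc) simp
    also have "c + c - c * (c * \<kappa>) = 1" unfolding c\<kappa> using cs by (simp add: algebra_simps)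
    finally show "blinfun_apply (?D o\<^sub>L ?D) x = blinfun_apply (id_blinfun - (adj A o\<^sub>L A)) x"
      by (simp add: P_def blinfun.diff_left)
  qed
  show "S o\<^sub>L ?D = ?D o\<^sub>L S" if S: "S o\<^sub>L (id_blinfun - (adj A o\<^sub>L A)) = (id_blinfun - (adj A o\<^sub>L A)) o\<^sub>L S" for S
  proof (rule blinfun_eqI)
    fix x
    have "blinfun_apply S (blinfun_apply (adj A) (blinfun_apply A x))
        = blinfun_apply (adj A) (blinfun_apply A (blinfun_apply S x))"
      using arg_cong[OF S, of "\<lambda>T. blinfun_apply T x"]
      by (simp add: blinfun.diff_left blinfun.diff_right)
    then show "blinfun_apply (S o\<^sub>L ?D) x = blinfun_apply (?D o\<^sub>L S) x"
      unfolding D by (simp add: blinfun.diff_left blinfun.scaleR_left blinfun.diff_right blinfun.scaleR_right)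
  qed
qed

text \<open>The operator \<open>E = s (I - l\<^sup>*l)\<^sup>-\<^sup>1\<^sup>/\<^sup>2\<close> with \<open>s = (1 - \<parallel>l\<parallel>\<^sup>2)\<^sup>1\<^sup>/\<^sup>2\<close>: the identity on the range of
  \<open>l\<^sup>*\<close> and \<open>s\<close> on its orthogonal complement.  It occurs in the numerator \<open>l - X E\<close> of
  \<open>\<Phi>\<^sub>l(X)\<close>.\<close>

definition Phi_num :: "complex ^ 'n \<Rightarrow> ('h :: complex_inner ^ 'n :: finite) \<Rightarrow>\<^sub>L ('h ^ 'n)" where
  "Phi_num l = sqrt (1 - (norm l)\<^sup>2) *\<^sub>R id_blinfun
     + (1 / (1 + sqrt (1 - (norm l)\<^sup>2))) *\<^sub>R (adj (scalar_row l) o\<^sub>L scalar_row l)"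

context
  fixes l :: "complex ^ 'n :: finite" and s :: real
  assumes l: "norm l < 1" and s_def: "s = sqrt (1 - (norm l)\<^sup>2)"
begin

lemma defect_pos: "s > 0" and defect_sq: "s\<^sup>2 = 1 - (norm l)\<^sup>2"
proof -
  have "(norm l)\<^sup>2 < 1" using l by (simp add: power_less_one_iff)
  then show "s > 0" "s\<^sup>2 = 1 - (norm l)\<^sup>2" by (simp_all add: s_def)
qed

lemma defect_quot: "(norm l)\<^sup>2 / (1 + s) = 1 - s"
proof -
  have "(norm l)\<^sup>2 = (1 - s) * (1 + s)" using defect_sq by (simp add: power2_eq_square algebra_simps)
  then show ?thesis using defect_pos by simp
qed

lemma Phi_num_apply:
  "blinfun_apply (Phi_num l) v = s *\<^sub>R v
     + (1 / (1 + s)) *\<^sub>R blinfun_apply (adj (scalar_row l)) (blinfun_apply (scalar_row l) (v :: 'h :: chilbert_space ^ 'n))"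
  by (simp add: Phi_num_def s_def blinfun.add_left blinfun.scaleR_left)

lemma Phi_num_adj: "blinfun_apply (Phi_num l) (blinfun_apply (adj (scalar_row l)) (x :: 'h :: chilbert_space))
    = blinfun_apply (adj (scalar_row l)) x"
  using defect_quot by (simp add: Phi_num_apply scalar_row_adj blinfun.scaleR_right scaleR_add_left[symmetric])

lemma scalar_row_Phi_num: "blinfun_apply (scalar_row l) (blinfun_apply (Phi_num l) v)
    = blinfun_apply (scalar_row l) (v :: 'h :: chilbert_space ^ 'n)"
  using defect_quot by (simp add: Phi_num_apply scalar_row_adj blinfun.add_right blinfun.scaleR_right
      scaleR_add_left[symmetric])

lemma Phi_num_sq: "blinfun_apply (Phi_num l) (blinfun_apply (Phi_num l) v)
    = s\<^sup>2 *\<^sub>R v + blinfun_apply (adj (scalar_row l)) (blinfun_apply (scalar_row l) (v :: 'h :: chilbert_space ^ 'n))"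
proof -
  have "blinfun_apply (Phi_num l) (blinfun_apply (Phi_num l) v)
     = s *\<^sub>R blinfun_apply (Phi_num l) v
       + (1 / (1 + s)) *\<^sub>R blinfun_apply (adj (scalar_row l)) (blinfun_apply (scalar_row l) v)"
    by (subst (1) Phi_num_apply) (simp add: scalar_row_Phi_num)
  also have "\<dots> = s\<^sup>2 *\<^sub>R v + (s / (1 + s) + 1 / (1 + s)) *\<^sub>R
      blinfun_apply (adj (scalar_row l)) (blinfun_apply (scalar_row l) v)"
    by (simp add: Phi_num_apply scaleR_add_right scaleR_add_left power2_eq_square)
  also have "s / (1 + s) + 1 / (1 + s) = 1" using defect_pos by (simp add: add_divide_distrib[symmetric])
  finally show ?thesis by simp
qed

lemma Phi_num_self_adjoint: "cinner (blinfun_apply (Phi_num l) v) w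
   = cinner v (blinfun_apply (Phi_num l) (w :: 'h :: chilbert_space ^ 'n))"
  by (simp add: Phi_num_apply cinner_linear cinner_adj_left cinner_adj_right)

context
  fixes X :: "('h :: chilbert_space, 'n) op_tuple"
  assumes X: "\<And>i. X i \<in> clinear_ops" and X1: "norm (row_op X) \<le> 1"
begin

lemma row_adj_scalar: "(\<Sum>i\<in>UNIV. cnj (l $ i) *\<^sub>C X i) = row_op X o\<^sub>L adj (scalar_row l)"
  by (rule blinfun_eqI)
    (simp add: blinfun.sum_left scaleC_blinfun.rep_eq row_op.rep_eq adj_scalar_row_nth
      clinear_opsD X)

lemma norm_row_adj_scalar: "norm (row_op X o\<^sub>L adj (scalar_row l)) \<le> norm l"
proof -
  have "norm (row_op X o\<^sub>L adj (scalar_row l :: ('h ^ 'n) \<Rightarrow>\<^sub>L 'h)) \<le> norm (row_op X) * norm (scalar_row l :: ('h ^ 'n) \<Rightarrow>\<^sub>L 'h)"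
    by (metis norm_adj clinear_scalar_row norm_blinfun_compose)
  also have "\<dots> \<le> 1 * norm l" by (intro mult_mono X1 norm_scalar_row_le) auto
  finally show ?thesis by simp
qed

definition "resolvent = inv_op (id_blinfun - (row_op X o\<^sub>L adj (scalar_row l)))"

lemma resolvent_left: "resolvent o\<^sub>L (id_blinfun - (row_op X o\<^sub>L adj (scalar_row l))) = id_blinfun"
  and resolvent_right: "(id_blinfun - (row_op X o\<^sub>L adj (scalar_row l))) o\<^sub>L resolvent = id_blinfun"
  and resolvent_series: "norm (resolvent - (\<Sum>j<k. op_power j (row_op X o\<^sub>L adj (scalar_row l)))) \<le> norm l ^ k / (1 - norm l)"
proof -
  obtain C where C: "C o\<^sub>L (id_blinfun - (row_op X o\<^sub>L adj (scalar_row l))) = id_blinfun"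
    "(id_blinfun - (row_op X o\<^sub>L adj (scalar_row l))) o\<^sub>L C = id_blinfun"
    "\<And>k. norm (C - (\<Sum>j<k. op_power j (row_op X o\<^sub>L adj (scalar_row l)))) \<le> norm l ^ k / (1 - norm l)"
    using neumann_series[OF norm_row_adj_scalar l] by blast
  then have "resolvent = C" unfolding resolvent_def by (intro inv_op_eq)
  then show "resolvent o\<^sub>L (id_blinfun - (row_op X o\<^sub>L adj (scalar_row l))) = id_blinfun"
    "(id_blinfun - (row_op X o\<^sub>L adj (scalar_row l))) o\<^sub>L resolvent = id_blinfun"
    "norm (resolvent - (\<Sum>j<k. op_power j (row_op X o\<^sub>L adj (scalar_row l)))) \<le> norm l ^ k / (1 - norm l)"
    using C by auto
qed

lemma clinear_resolvent: "resolvent \<in> clinear_ops"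
  by (rule clinear_ops_inverse[OF resolvent_left resolvent_right])
    (simp add: clinear_ops_intros clinear_ops_adj X)

lemma resolvent_apply: "blinfun_apply resolvent (x - blinfun_apply (row_op X) (blinfun_apply (adj (scalar_row l)) x)) = x"
  using arg_cong[OF resolvent_left, of "\<lambda>T. blinfun_apply T x"] by (simp add: blinfun.diff_left)

lemma apply_resolvent: "blinfun_apply resolvent x - blinfun_apply (row_op X) (blinfun_apply (adj (scalar_row l)) (blinfun_apply resolvent x)) = x"
  using arg_cong[OF resolvent_right, of "\<lambda>T. blinfun_apply T x"] by (simp add: blinfun.diff_left)

lemma row_Phi_unfold: "row_op (Phi l X) = scalar_row l - s *\<^sub>R (resolvent o\<^sub>L row_op X
    o\<^sub>L (id_blinfun - (1 / (1 + s)) *\<^sub>R (adj (scalar_row l) o\<^sub>L scalar_row l)))"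
proof -
  have "sqrt_op (id_blinfun - (adj (scalar_row l) o\<^sub>L (scalar_row l :: ('h ^ 'n) \<Rightarrow>\<^sub>L 'h)))
      = id_blinfun - (1 / (1 + sqrt (1 - (norm l)\<^sup>2))) *\<^sub>R (adj (scalar_row l) o\<^sub>L scalar_row l)"
    by (rule sqrt_op_defect[OF clinear_scalar_row scalar_row_adj])
      (use l in \<open>simp_all add: norm_scalar_row_le power_less_one_iff power_mono\<close>)
  then show ?thesis
    unfolding Phi_def Let_def row_op_entries row_adj_scalar resolvent_def s_def by simp
qed

text \<open>In this fractional form the numerator and the denominator are affine in \<open>X\<close>, so identities
  for \<open>\<Phi>\<^sub>l\<close> can be checked after multiplication by \<open>I - X l\<^sup>*\<close>.\<close>

lemma row_Phi: "row_op (Phi l X) = resolvent o\<^sub>L (scalar_row l - (row_op X o\<^sub>L Phi_num l))"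
proof (rule blinfun_eqI)
  fix v :: "'h ^ 'n"
  let ?R = "blinfun_apply (row_op X)" and ?C = "blinfun_apply resolvent"
  define u where "u = blinfun_apply (scalar_row l) v"
  define w where "w = blinfun_apply (adj (scalar_row l)) u"
  have u: "u = ?C u - ?C (?R w)"
    using resolvent_apply[of u] by (simp add: blinfun.diff_right w_def)
  have "blinfun_apply (row_op (Phi l X)) v = u - s *\<^sub>R (?C (?R v) - (1 / (1 + s)) *\<^sub>R ?C (?R w))"
    unfolding row_Phi_unfold
    by (simp add: blinfun.diff_left blinfun.diff_right blinfun.scaleR_left blinfun.scaleR_right u_def w_def)
  also have "\<dots> = ?C u - s *\<^sub>R ?C (?R v) - (1 - s / (1 + s)) *\<^sub>R ?C (?R w)"
    by (subst u) (simp add: algebra_simps)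
  also have "1 - s / (1 + s) = 1 / (1 + s)" using defect_pos by (simp add: field_simps)
  finally show "blinfun_apply (row_op (Phi l X)) v
      = blinfun_apply (resolvent o\<^sub>L (scalar_row l - (row_op X o\<^sub>L Phi_num l))) v"
    by (simp add: Phi_num_apply blinfun.diff_left blinfun.diff_right blinfun.add_right
        blinfun.scaleR_right u_def w_def)
qed

lemma row_Phi_eqI:
  assumes "\<And>v. blinfun_apply R' v - blinfun_apply (row_op X) (blinfun_apply (adj (scalar_row l)) (blinfun_apply R' v))
      = blinfun_apply (scalar_row l) v - blinfun_apply (row_op X) (blinfun_apply (Phi_num l) v)"
  shows "row_op (Phi l X) = R'"
proof (rule blinfun_eqI)
  fix v
  show "blinfun_apply (row_op (Phi l X)) v = blinfun_apply R' v"
    unfolding row_Phi using resolvent_apply[of "blinfun_apply R' v"]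
    by (simp add: assms blinfun.diff_left)
qed

lemma Phi_entry: "Phi l X j = resolvent o\<^sub>L ((l $ j) *\<^sub>C id_blinfun
    - (s *\<^sub>R X j + ((l $ j) / complex_of_real (1 + s)) *\<^sub>C (row_op X o\<^sub>L adj (scalar_row l))))"
proof -
  have "Phi l X j = row_op (Phi l X) o\<^sub>L embed j" by (simp add: row_op_embed)
  also have "\<dots> = resolvent o\<^sub>L ((l $ j) *\<^sub>C id_blinfun
    - (s *\<^sub>R X j + ((l $ j) / complex_of_real (1 + s)) *\<^sub>C (row_op X o\<^sub>L adj (scalar_row l))))"
  proof (rule blinfun_eqI)
    fix x :: 'h
    have L: "blinfun_apply (scalar_row l) (blinfun_apply (embed j) x) = (l $ j) *\<^sub>C x"
      using arg_cong[OF row_op_embed[of "scalar_tuple l" j], of "\<lambda>T. blinfun_apply T x"]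
      by (simp add: scalar_tuple_def scaleC_blinfun.rep_eq)
    have R: "blinfun_apply (row_op X) (blinfun_apply (embed j) x) = blinfun_apply (X j) x"
      using arg_cong[OF row_op_embed[of X j], of "\<lambda>T. blinfun_apply T x"] by simp
    have quot: "(l $ j / complex_of_real (1 + s)) *\<^sub>C y = (1 / (1 + s)) *\<^sub>R (l $ j) *\<^sub>C y" for y :: 'h
      by (simp add: scaleC_of_real[symmetric] scaleC_scaleC)
    have RA: "blinfun_apply (row_op X) (blinfun_apply (adj (scalar_row l)) (c *\<^sub>C y))
        = c *\<^sub>C blinfun_apply (row_op X) (blinfun_apply (adj (scalar_row l)) y)" for c y
      by (simp add: clinear_opsD clinear_ops_adj clinear_ops_row_op X)
    show "blinfun_apply (row_op (Phi l X) o\<^sub>L embed j) x = blinfun_apply (resolvent o\<^sub>L ((l $ j) *\<^sub>C id_blinfun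
    - (s *\<^sub>R X j + ((l $ j) / complex_of_real (1 + s)) *\<^sub>C (row_op X o\<^sub>L adj (scalar_row l))))) x"
      unfolding row_Phi
      by (simp del: of_real_add add: blinfun.diff_left blinfun.add_left blinfun.scaleR_left scaleC_blinfun.rep_eq
          Phi_num_apply blinfun.add_right blinfun.scaleR_right L R quot RA)
  qed
  finally show ?thesis .
qed

lemma clinear_Phi: "Phi l X j \<in> clinear_ops"
  unfolding Phi_entry by (intro clinear_ops_intros clinear_resolvent clinear_ops_adj clinear_scalar_row X)

text \<open>With \<open>M = I - X l\<^sup>*\<close> and \<open>N = l - X E\<close> this is \<open>M M\<^sup>* - N N\<^sup>* = s\<^sup>2 (I - X X\<^sup>*)\<close>, evaluated at
  \<open>x\<close>: here \<open>y = M\<^sup>*x\<close>, and \<open>N\<^sup>*x\<close> is the adjoint of \<open>\<Phi>\<^sub>l(X) = M\<^sup>-\<^sup>1 N\<close> applied to \<open>y\<close>.\<close>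

lemma Phi_defect_identity:
  fixes x :: 'h
  defines "y \<equiv> x - blinfun_apply (scalar_row l) (blinfun_apply (adj (row_op X)) x)"
  shows "(norm y)\<^sup>2 - (norm (blinfun_apply (adj (row_op (Phi l X))) y))\<^sup>2
    = s\<^sup>2 * ((norm x)\<^sup>2 - (norm (blinfun_apply (adj (row_op X)) x))\<^sup>2)"
proof -
  have Xc: "row_op X \<in> clinear_ops" by (simp add: clinear_ops_row_op X)
  have Pc: "row_op (Phi l X) \<in> clinear_ops" by (simp add: clinear_ops_row_op clinear_Phi)
  let ?L = "blinfun_apply (scalar_row l)" and ?L' = "blinfun_apply (adj (scalar_row l))"
    and ?E = "blinfun_apply (Phi_num l)"
  define u where "u = blinfun_apply (adj (row_op X)) x"
  have adjP: "blinfun_apply (adj (row_op (Phi l X))) y = ?L' x - ?E u"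
  proof (rule cinner_ext)
    fix v :: "'h ^ 'n"
    define z where "z = blinfun_apply (row_op (Phi l X)) v"
    have z: "z - blinfun_apply (row_op X) (?L' z) = ?L v - blinfun_apply (row_op X) (?E v)"
      using apply_resolvent[of "?L v - blinfun_apply (row_op X) (?E v)"]
      by (simp add: z_def row_Phi blinfun.diff_left)
    have "cinner v (blinfun_apply (adj (row_op (Phi l X))) y) = cinner z y"
      by (simp add: cinner_adj_right[OF Pc, symmetric] z_def)
    also have "\<dots> = cinner (z - blinfun_apply (row_op X) (?L' z)) x"
      by (simp add: y_def cinner_linear cinner_adj_left cinner_adj_right Xc)
    also have "\<dots> = cinner v (?L' x - ?E u)"
      unfolding z by (simp add: cinner_linear cinner_adj_right Xc u_def Phi_num_self_adjoint)
    finally show "cinner v (blinfun_apply (adj (row_op (Phi l X))) y) = cinner v (?L' x - ?E u)" .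
  qed
  have E: "(norm (?E u))\<^sup>2 = s\<^sup>2 * (norm u)\<^sup>2 + (norm (?L u))\<^sup>2"
  proof -
    have "complex_of_real ((norm (?E u))\<^sup>2) = cinner u (?E (?E u))"
      by (simp only: cinner_self[symmetric] Phi_num_self_adjoint)
    also have "\<dots> = complex_of_real (s\<^sup>2 * (norm u)\<^sup>2 + (norm (?L u))\<^sup>2)"
      unfolding Phi_num_sq
      by (simp add: cinner_linear cinner_adj_right[symmetric] cinner_self)
    finally show ?thesis by (rule of_real_eq_iff[THEN iffD1])
  qed
  have L': "(norm (?L' x))\<^sup>2 = (norm l)\<^sup>2 * (norm x)\<^sup>2"
  proof -
    have "(norm (?L' x))\<^sup>2 = Re (cinner (?L (?L' x)) x)"
      by (simp only: Re_cinner_self[symmetric] cinner_adj_right[OF clinear_scalar_row])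
    then show ?thesis by (simp add: scalar_row_adj cinner_linear cinner_self)
  qed
  have cross: "cinner (?L' x) (?E u) = cinner x (?L u)"
    by (simp add: cinner_adj_left scalar_row_Phi_num)
  show ?thesis
    unfolding adjP
    unfolding y_def u_def[symmetric] norm_diff_sq cross E L' defect_sq by (simp add: algebra_simps)
qed

text \<open>Every \<open>y\<close> is of the form \<open>(I - l X\<^sup>*) x\<close> with \<open>\<parallel>y\<parallel> \<le> 2 \<parallel>x\<parallel>\<close>, which is where the
  \<open>4\<close> comes from.\<close>

lemma norm_Phi_le:
  assumes r: "norm (row_op X) \<le> r" "r \<le> 1"
  shows "norm (row_op (Phi l X)) \<le> sqrt (1 - s\<^sup>2 * (1 - r\<^sup>2) / 4)"
proof -
  have Xc: "row_op X \<in> clinear_ops" by (simp add: clinear_ops_row_op X)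
  have Pc: "row_op (Phi l X) \<in> clinear_ops" by (simp add: clinear_ops_row_op clinear_Phi)
  have r0: "0 \<le> r" using r norm_ge_zero order_trans by blast
  define \<rho> where "\<rho> = 1 - s\<^sup>2 * (1 - r\<^sup>2) / 4"
  have nX: "norm (blinfun_apply (adj (row_op X)) x) \<le> r * norm x" for x
    using norm_blinfun[of "adj (row_op X)" x] r(1)
    by (metis norm_adj[OF Xc] mult_right_mono norm_ge_zero order_trans)
  have r2: "r\<^sup>2 \<le> 1" using r(2) r0 by (simp add: power_le_one)
  have s1: "s\<^sup>2 \<le> 1" unfolding defect_sq by simp
  have rho0: "\<rho> \<ge> 0"
  proof -
    have "s\<^sup>2 * (1 - r\<^sup>2) \<le> 1 * 1" using s1 r2 by (intro mult_mono) auto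
    then show ?thesis by (simp add: \<rho>_def)
  qed
  have "norm (adj (row_op (Phi l X))) \<le> sqrt \<rho>"
  proof (rule norm_blinfun_bound)
    fix y :: 'h
    define x where "x = blinfun_apply (adj resolvent) y"
    have y: "y = x - blinfun_apply (scalar_row l) (blinfun_apply (adj (row_op X)) x)"
    proof (rule cinner_ext)
      fix z
      have "cinner z (x - blinfun_apply (scalar_row l) (blinfun_apply (adj (row_op X)) x))
         = cinner (blinfun_apply resolvent (z - blinfun_apply (row_op X) (blinfun_apply (adj (scalar_row l)) z))) y"
        unfolding x_def
        by (simp add: cinner_linear cinner_adj_right[OF clinear_resolvent] blinfun.diff_right
            cinner_adj_left cinner_adj_right[OF Xc])
      then show "cinner z y = cinner z (x - blinfun_apply (scalar_row l) (blinfun_apply (adj (row_op X)) x))"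
        by (simp add: resolvent_apply)
    qed
    have "norm y \<le> norm x + norm (blinfun_apply (scalar_row l) (blinfun_apply (adj (row_op X)) x))"
      by (subst y) (rule norm_triangle_ineq4)
    also have "norm (blinfun_apply (scalar_row l) (blinfun_apply (adj (row_op X)) x)) \<le> 1 * (1 * norm x)"
    proof -
      have "norm (blinfun_apply (scalar_row l) (blinfun_apply (adj (row_op X)) x))
         \<le> norm (scalar_row l :: ('h ^ 'n) \<Rightarrow>\<^sub>L 'h) * norm (blinfun_apply (adj (row_op X)) x)" by (rule norm_blinfun)
      also have "\<dots> \<le> 1 * (1 * norm x)"
        using norm_scalar_row_le[of l, where 'h = 'h] l nX[of x] mult_right_mono[OF r(2), of "norm x"]
        by (intro mult_mono) auto
      finally show ?thesis .
    qed
    finally have "norm y \<le> 2 * norm x" by simp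
    then have "(norm y)\<^sup>2 \<le> (2 * norm x)\<^sup>2" by (rule power_mono) simp
    then have y4: "(norm y)\<^sup>2 / 4 \<le> (norm x)\<^sup>2" by (simp add: power_mult_distrib)
    have "(norm (blinfun_apply (adj (row_op X)) x))\<^sup>2 \<le> (r * norm x)\<^sup>2"
      by (rule power_mono[OF nX]) simp
    then have "(1 - r\<^sup>2) * (norm x)\<^sup>2 \<le> (norm x)\<^sup>2 - (norm (blinfun_apply (adj (row_op X)) x))\<^sup>2"
      by (simp add: power_mult_distrib algebra_simps)
    then have "s\<^sup>2 * ((1 - r\<^sup>2) * (norm x)\<^sup>2)
        \<le> (norm y)\<^sup>2 - (norm (blinfun_apply (adj (row_op (Phi l X))) y))\<^sup>2"
      unfolding Phi_defect_identity[of x, folded y] by (rule mult_left_mono) simp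
    moreover have "s\<^sup>2 * ((1 - r\<^sup>2) * ((norm y)\<^sup>2 / 4)) \<le> s\<^sup>2 * ((1 - r\<^sup>2) * (norm x)\<^sup>2)"
      using y4 r2 by (intro mult_left_mono) auto
    ultimately have "(norm (blinfun_apply (adj (row_op (Phi l X))) y))\<^sup>2 \<le> \<rho> * (norm y)\<^sup>2"
      by (simp add: \<rho>_def algebra_simps)
    also have "\<dots> = (sqrt \<rho> * norm y)\<^sup>2" using rho0 by (simp add: power_mult_distrib)
    finally show "norm (blinfun_apply (adj (row_op (Phi l X))) y) \<le> sqrt \<rho> * norm y"
      by (rule power2_le_imp_le) (simp add: rho0)
  qed (simp add: rho0)
  then show ?thesis by (simp add: \<rho>_def norm_adj[OF Pc])
qed

lemma norm_Phi_le_one: "norm (row_op (Phi l X)) \<le> 1"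
  using norm_Phi_le[OF X1] by simp

end

lemma Phi_involutive:
  fixes X :: "('h :: chilbert_space, 'n) op_tuple"
  assumes X: "\<And>i. X i \<in> clinear_ops" and X1: "norm (row_op X) \<le> 1"
  shows "Phi l (Phi l X) = X"
proof -
  let ?L = "blinfun_apply (scalar_row l)" and ?L' = "blinfun_apply (adj (scalar_row l))"
    and ?E = "blinfun_apply (Phi_num l)" and ?R = "blinfun_apply (row_op X)"
    and ?Y = "blinfun_apply (row_op (Phi l X))"
  define M where "M = id_blinfun - (row_op X o\<^sub>L adj (scalar_row l))"
  have M: "blinfun_apply M x = x - ?R (?L' x)" for x by (simp add: M_def blinfun.diff_left)
  have MY: "blinfun_apply M (?Y v) = ?L v - ?R (?E v)" for v
    using apply_resolvent[OF X X1] by (simp add: M row_Phi[OF X X1] blinfun.diff_left)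
  have inj: "x = y" if "blinfun_apply M x = blinfun_apply M y" for x y
    using that resolvent_apply[OF X X1] M by metis
  have "?R v - ?Y (?L' (?R v)) = ?L v - ?Y (?E v)" for v
  proof (rule inj)
    show "blinfun_apply M (?R v - ?Y (?L' (?R v))) = blinfun_apply M (?L v - ?Y (?E v))"
      unfolding blinfun.diff_right MY
      unfolding M
      by (simp add: Phi_num_adj Phi_num_sq scalar_row_Phi_num scalar_row_adj blinfun.add_right
          blinfun.scaleR_right blinfun.diff_right defect_sq scaleR_diff_left)
  qed
  then have "row_op (Phi l (Phi l X)) = row_op X"
    by (intro row_Phi_eqI clinear_Phi X X1 norm_Phi_le_one)
  then show ?thesis by (metis entries_row_op)
qed

lemma Phi_0: "Phi l (\<lambda>_. 0) = (scalar_tuple l :: ('h :: chilbert_space, 'n) op_tuple)"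
proof -
  have 0: "row_op (\<lambda>_. 0) = (0 :: ('h ^ 'n) \<Rightarrow>\<^sub>L 'h)" by (rule blinfun_eqI) (simp add: row_op.rep_eq)
  have "row_op (Phi l (\<lambda>_. 0)) = (scalar_row l :: ('h ^ 'n) \<Rightarrow>\<^sub>L 'h)"
    by (rule row_Phi_eqI) (simp_all add: 0)
  then show ?thesis by (metis entries_row_op)
qed

lemma Phi_self: "Phi l (scalar_tuple l) = (\<lambda>_. 0 :: 'h :: chilbert_space \<Rightarrow>\<^sub>L 'h)"
proof -
  have 0: "row_op (\<lambda>_. 0) = (0 :: ('h ^ 'n) \<Rightarrow>\<^sub>L 'h)" by (rule blinfun_eqI) (simp add: row_op.rep_eq)
  have "norm (scalar_row l :: ('h ^ 'n) \<Rightarrow>\<^sub>L 'h) \<le> 1" using norm_scalar_row_le[of l, where 'h = 'h] l by simp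
  then have "row_op (Phi l (scalar_tuple l)) = row_op (\<lambda>_. 0 :: 'h \<Rightarrow>\<^sub>L 'h)"
    by (intro row_Phi_eqI) (simp_all add: 0 scalar_row_Phi_num)
  then show ?thesis by (metis entries_row_op)
qed

end

section \<open>Row isometries on an infinite-dimensional separable space\<close>

lemma norm_sum_orthogonal:
  fixes f :: "'i \<Rightarrow> 'h :: complex_inner"
  assumes "finite S" "\<And>i j. i \<in> S \<Longrightarrow> j \<in> S \<Longrightarrow> i \<noteq> j \<Longrightarrow> cinner (f i) (f j) = 0"
  shows "(norm (\<Sum>i\<in>S. f i))\<^sup>2 = (\<Sum>i\<in>S. (norm (f i))\<^sup>2)"
  using assms
proof (induction S rule: finite_induct)
  case (insert a S)
  have "cinner (f a) (\<Sum>i\<in>S. f i) = (\<Sum>i\<in>S. cinner (f a) (f i))" by (rule cinner.sum_right)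
  also have "\<dots> = 0" using insert by (intro sum.neutral) auto
  finally show ?case using insert by (simp add: norm_add_sq)
qed simp

lemma norm_orthonormal_sum:
  fixes f :: "'i \<Rightarrow> 'h :: complex_inner"
  assumes "finite S" and on: "\<And>i j. cinner (f i) (f j) = (if i = j then 1 else 0)"
  shows "(norm (\<Sum>i\<in>S. c i *\<^sub>C f i))\<^sup>2 = (\<Sum>i\<in>S. (cmod (c i))\<^sup>2)"
proof -
  have "norm (f i) = 1" for i
  proof -
    have "(norm (f i))\<^sup>2 = 1" using on[of i i] by (metis Re_cinner_self one_complex.sel(1))
    then show ?thesis by (simp add: abs_square_eq_1)
  qed
  then show ?thesis
    by (subst norm_sum_orthogonal[OF assms(1)]) (auto simp: on cinner_linear norm_scaleC)
qed

lemma bessel_inequality: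
  fixes e :: "'i \<Rightarrow> 'h :: complex_inner"
  assumes "finite S" and on: "\<And>i j. cinner (e i) (e j) = (if i = j then 1 else 0)"
  shows "(\<Sum>i\<in>S. (cmod (cinner x (e i)))\<^sup>2) \<le> (norm x)\<^sup>2"
proof -
  define p where "p = (\<Sum>i\<in>S. cinner x (e i) *\<^sub>C e i)"
  have "cinner x p = complex_of_real (\<Sum>i\<in>S. (cmod (cinner x (e i)))\<^sup>2)"
    unfolding p_def cinner.sum_right cinner_scaleC_right of_real_sum
    by (intro sum.cong refl) (subst complex_norm_square, rule mult.commute)
  then have "Re (cinner x p) = (\<Sum>i\<in>S. (cmod (cinner x (e i)))\<^sup>2)" by simp
  moreover have "(norm p)\<^sup>2 = (\<Sum>i\<in>S. (cmod (cinner x (e i)))\<^sup>2)"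
    unfolding p_def by (rule norm_orthonormal_sum[OF assms])
  moreover have "0 \<le> (norm (x - p))\<^sup>2" by simp
  ultimately show ?thesis by (simp add: norm_diff_sq)
qed

lemma orthonormal_series_summable:
  fixes f :: "nat \<Rightarrow> 'h :: chilbert_space"
  assumes on: "\<And>i j. cinner (f i) (f j) = (if i = j then 1 else 0)"
    and bdd: "\<And>N. (\<Sum>k<N. (cmod (c k))\<^sup>2) \<le> K"
  shows "summable (\<lambda>k. c k *\<^sub>C f k)"
  unfolding summable_Cauchy
proof (intro allI impI)
  fix \<epsilon> :: real assume \<epsilon>: "\<epsilon> > 0"
  have "summable (\<lambda>k. (cmod (c k))\<^sup>2)"
    by (rule bounded_imp_summable[of _ K]) (use bdd[of "Suc _"] in \<open>auto simp: lessThan_Suc_atMost\<close>)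
  then obtain N where N: "\<And>m n. m \<ge> N \<Longrightarrow> norm (\<Sum>k=m..<n. (cmod (c k))\<^sup>2) < \<epsilon>\<^sup>2"
    unfolding summable_Cauchy using \<epsilon> by (meson zero_less_power)
  show "\<exists>N. \<forall>m\<ge>N. \<forall>n. norm (\<Sum>k=m..<n. c k *\<^sub>C f k) < \<epsilon>"
  proof (intro exI allI impI)
    fix m n assume "N \<le> m"
    have "(norm (\<Sum>k=m..<n. c k *\<^sub>C f k))\<^sup>2 = (\<Sum>k=m..<n. (cmod (c k))\<^sup>2)"
      by (rule norm_orthonormal_sum[OF _ on]) simp
    also have "\<dots> < \<epsilon>\<^sup>2" using N[OF \<open>N \<le> m\<close>, of n] by simp
    finally show "norm (\<Sum>k=m..<n. c k *\<^sub>C f k) < \<epsilon>"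
      by (rule power2_less_imp_less) (use \<epsilon> in simp)
  qed
qed

text \<open>A maximal orthonormal set is total.  In a separable space it is countable, because its
  elements have mutual distance \<open>2\<^sup>1\<^sup>/\<^sup>2\<close>, and it is infinite because a finite total orthonormal set spans.\<close>

lemma exists_orthonormal_basis:
  assumes sep: "separable_space (euclidean :: 'h :: chilbert_space topology)"
    and inf: "cinfinite_dimensional TYPE('h :: chilbert_space)"
  obtains e :: "nat \<Rightarrow> 'h :: chilbert_space" where "\<And>i j. cinner (e i) (e j) = (if i = j then 1 else 0)"
    "\<And>x. (\<And>k. cinner x (e k) = 0) \<Longrightarrow> x = 0"
proof -
  define \<O> where "\<O> = {B :: 'h set. \<forall>b\<in>B. \<forall>c\<in>B. cinner b c = (if b = c then 1 else 0)}"
  have "\<exists>M\<in>\<O>. \<forall>X\<in>\<O>. M \<subseteq> X \<longrightarrow> X = M"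
  proof (rule subset_Zorn')
    fix \<C> assume C: "subset.chain \<O> \<C>"
    show "\<Union>\<C> \<in> \<O>"
      unfolding \<O>_def
    proof (intro CollectI ballI)
      fix b c assume "b \<in> \<Union>\<C>" "c \<in> \<Union>\<C>"
      then obtain X Y where XY: "X \<in> \<C>" "Y \<in> \<C>" "b \<in> X" "c \<in> Y" by blast
      then have "X \<subseteq> Y \<or> Y \<subseteq> X" "X \<in> \<O>" "Y \<in> \<O>"
        using C by (auto simp: subset_chain_def)
      then show "cinner b c = (if b = c then 1 else 0)"
        using XY unfolding \<O>_def by blast
    qed
  qed
  then obtain B where B: "B \<in> \<O>" and B_max: "\<And>X. X \<in> \<O> \<Longrightarrow> B \<subseteq> X \<Longrightarrow> X = B" by blast
  have on: "cinner b c = (if b = c then 1 else 0)" if "b \<in> B" "c \<in> B" for b c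
    using B that by (simp add: \<O>_def)
  have total: "x = 0" if x: "\<And>b. b \<in> B \<Longrightarrow> cinner x b = 0" for x
  proof (rule ccontr)
    assume "x \<noteq> 0"
    define u where "u = (1 / norm x) *\<^sub>R x"
    have uu: "cinner u u = 1" using \<open>x \<noteq> 0\<close> by (simp add: cinner_self u_def)
    have ub: "cinner u b = 0" "cinner b u = 0" if "b \<in> B" for b
      using x[OF that] cinner_commute[of b x] by (simp_all add: u_def cinner_linear)
    have "insert u B \<in> \<O>"
      unfolding \<O>_def using uu ub on by (auto; metis zero_neq_one)
    then have "u \<in> B" using B_max by blast
    then show False using ub uu by auto
  qed
  have "infinite B"
  proof
    assume fin: "finite B"
    interpret V: vector_space "scaleC :: complex \<Rightarrow> 'h \<Rightarrow> 'h" by (rule vector_space_scaleC)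
    have "x \<in> V.span B" for x
    proof -
      have "x - (\<Sum>b\<in>B. cinner x b *\<^sub>C b) = 0"
      proof (rule total)
        fix c assume c: "c \<in> B"
        have "cinner (\<Sum>b\<in>B. cinner x b *\<^sub>C b) c = (\<Sum>b\<in>B. if b = c then cinner x b else 0)"
          unfolding cinner.sum_left cinner_scaleC_left using c on by (intro sum.cong) auto
        also have "\<dots> = cinner x c" using fin c by simp
        finally show "cinner (x - (\<Sum>b\<in>B. cinner x b *\<^sub>C b)) c = 0" by (simp add: cinner_linear)
      qed
      then have "x = (\<Sum>b\<in>B. cinner x b *\<^sub>C b)" by simp
      moreover have "(\<Sum>b\<in>B. cinner x b *\<^sub>C b) \<in> V.span B"
        by (intro V.span_sum V.span_scale V.span_base)
      ultimately show ?thesis by simp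
    qed
    then show False using inf fin unfolding cinfinite_dimensional_def by blast
  qed
  have "countable B"
  proof -
    obtain U where U: "countable U" "closure U = (UNIV :: 'h set)"
      using sep unfolding separable_space_def by auto
    have "\<exists>d\<in>U. dist d b < 1 / 2" for b
      using U(2) closure_approachable[of b U] by (metis UNIV_I half_gt_zero zero_less_one)
    then obtain d where d: "\<And>b. d b \<in> U" "\<And>b. dist (d b) b < 1 / 2" by metis
    have "inj_on d B"
    proof (rule inj_onI, rule ccontr)
      fix b c assume bc: "b \<in> B" "c \<in> B" "d b = d c" "b \<noteq> c"
      have "(norm (b - c))\<^sup>2 = 2"
        using on[OF bc(1,1)] on[OF bc(2,2)] on[OF bc(1,2)] bc(4)
          Re_cinner_self[of b] Re_cinner_self[of c]
        by (simp add: norm_diff_sq)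
      moreover have "dist b c < 1" using d(2)[of b] d(2)[of c] bc(3) dist_triangle_half_r by metis
      then have "(norm (b - c))\<^sup>2 < 1\<^sup>2" unfolding dist_norm by (intro power_strict_mono) auto
      ultimately show False by simp
    qed
    moreover have "countable (d ` B)" by (rule countable_subset[OF _ U(1)]) (use d in auto)
    ultimately show ?thesis by (rule countable_image_inj_on[rotated])
  qed
  then have bij: "bij_betw (from_nat_into B) UNIV B"
    using \<open>infinite B\<close> by (rule bij_betw_from_nat_into)
  show thesis
  proof (rule that[of "from_nat_into B"])
    fix i j
    show "cinner (from_nat_into B i) (from_nat_into B j) = (if i = j then 1 else 0)"
      using on[of "from_nat_into B i" "from_nat_into B j"] bij_betw_imp_surj_on[OF bij]
        inj_eq[OF bij_betw_imp_inj_on[OF bij], of i j]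
      by (metis rangeI)
  next
    fix x assume x: "\<And>k. cinner x (from_nat_into B k) = 0"
    show "x = 0"
    proof (rule total)
      fix b assume "b \<in> B"
      then obtain k where "b = from_nat_into B k" using bij by (auto simp: bij_betw_def)
      then show "cinner x b = 0" using x by simp
    qed
  qed
qed

text \<open>The basis is split into disjoint infinite parts, one for each index \<open>i\<close>, by means of
  \<open>prod_encode\<close>; the \<open>i\<close>-th summand is moved isometrically onto the closed span of the \<open>i\<close>-th
  part.\<close>

lemma exists_row_isometry:
  assumes sep: "separable_space (euclidean :: 'h :: chilbert_space topology)"
    and inf: "cinfinite_dimensional TYPE('h :: chilbert_space)"
  obtains T :: "('h :: chilbert_space, 'k :: finite) op_tuple" where "\<And>i. T i \<in> clinear_ops"
    "\<And>v. norm (blinfun_apply (row_op T) v) = norm v"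
proof -
  obtain e :: "nat \<Rightarrow> 'h" where on: "\<And>i j. cinner (e i) (e j) = (if i = j then 1 else 0)"
    and total: "\<And>x. (\<And>k. cinner x (e k) = 0) \<Longrightarrow> x = 0"
    using exists_orthonormal_basis[OF sep inf] by blast
  obtain idx :: "'k \<Rightarrow> nat" where idx: "inj idx"
    using finite_imp_inj_to_nat_seg[of "UNIV :: 'k set"] by auto
  define S where "S \<tau> x = (\<Sum>k. cinner x (e k) *\<^sub>C e (\<tau> k))" for \<tau> :: "nat \<Rightarrow> nat" and x
  have on_\<tau>: "cinner (e (\<tau> i)) (e (\<tau> j)) = (if i = j then 1 else 0)" if "inj \<tau>" for \<tau> :: "nat \<Rightarrow> nat" and i j
    using that by (simp add: on inj_eq)
  have S: "(\<lambda>k. cinner x (e k) *\<^sub>C e (\<tau> k)) sums S \<tau> x" if "inj \<tau>" for \<tau> x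
    unfolding S_def
    by (rule summable_sums[OF orthonormal_series_summable[of "\<lambda>k. e (\<tau> k)", OF on_\<tau>[OF that]
            bessel_inequality[OF _ on]]]) simp
  have S_id: "S (\<lambda>k. k) x = x" for x
  proof -
    have "x - S (\<lambda>k. k) x = 0"
    proof (rule total)
      fix j
      have "(\<lambda>k. cinner (cinner x (e k) *\<^sub>C e k) (e j)) sums cinner (S (\<lambda>k. k) x) (e j)"
        by (rule bounded_linear.sums[OF cinner.bounded_linear_left S]) simp
      moreover have "(\<lambda>k. cinner (cinner x (e k) *\<^sub>C e k) (e j)) = (\<lambda>k. if k = j then cinner x (e k) else 0)"
        by (simp add: cinner_linear on fun_eq_iff)
      ultimately have "cinner (S (\<lambda>k. k) x) (e j) = cinner x (e j)"
        using sums_single[of j "\<lambda>k. cinner x (e k)"] sums_unique2 by metis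
      then show "cinner (x - S (\<lambda>k. k) x) (e j) = 0" by (simp add: cinner_linear)
    qed
    then show ?thesis by simp
  qed
  have norm_S: "norm (S \<tau> x) = norm x" if "inj \<tau>" for \<tau> x
  proof -
    have lim: "(\<lambda>N. \<Sum>k<N. (cmod (cinner x (e k)))\<^sup>2) \<longlonglongrightarrow> (norm (S \<tau> x))\<^sup>2" if "inj \<tau>" for \<tau>
    proof -
      have "(\<lambda>N. (norm (\<Sum>k<N. cinner x (e k) *\<^sub>C e (\<tau> k)))\<^sup>2) \<longlonglongrightarrow> (norm (S \<tau> x))\<^sup>2"
        by (intro tendsto_intros S[OF that, unfolded sums_def])
      moreover have "(norm (\<Sum>k<N. cinner x (e k) *\<^sub>C e (\<tau> k)))\<^sup>2 = (\<Sum>k<N. (cmod (cinner x (e k)))\<^sup>2)" for N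
        by (rule norm_orthonormal_sum) (simp_all add: on_\<tau>[OF that])
      ultimately show ?thesis by simp
    qed
    have "(norm (S \<tau> x))\<^sup>2 = (norm (S (\<lambda>k. k) x))\<^sup>2"
      by (rule LIMSEQ_unique[OF lim[OF that] lim]) simp
    then show ?thesis by (simp add: S_id)
  qed
  have S_add: "S \<tau> (x + y) = S \<tau> x + S \<tau> y" if "inj \<tau>" for \<tau> x y
    using sums_add[OF S[OF that, of x] S[OF that, of y]] S[OF that, of "x + y"]
    by (simp add: cinner_linear scaleC_add_left sums_iff)
  have S_scaleC: "S \<tau> (c *\<^sub>C x) = c *\<^sub>C S \<tau> x" if "inj \<tau>" for \<tau> c x
    using bounded_linear.sums[OF bounded_linear_scaleC S[OF that, of x], of c] S[OF that, of "c *\<^sub>C x"]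
    by (simp add: cinner_linear scaleC_scaleC sums_iff)
  have bl: "bounded_linear (S \<tau>)" if "inj \<tau>" for \<tau>
  proof (rule bounded_linear_intro[where K = 1])
    show "S \<tau> (r *\<^sub>R x) = r *\<^sub>R S \<tau> x" for r x
      using S_scaleC[OF that, of "complex_of_real r" x] by (simp add: scaleC_of_real)
  qed (simp_all add: S_add that norm_S)
  have S_orth: "cinner (S \<tau> x) (S \<tau>' y) = 0"
    if "inj \<tau>" "inj \<tau>'" and ne: "\<And>k l. \<tau> k \<noteq> \<tau>' l" for \<tau> \<tau>' x y
  proof -
    have "(\<lambda>k. cinner (cinner x (e k) *\<^sub>C e (\<tau> k)) (e (\<tau>' l))) sums cinner (S \<tau> x) (e (\<tau>' l))" for l
      by (rule bounded_linear.sums[OF cinner.bounded_linear_left S[OF that(1)]])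
    then have "(\<lambda>k. 0) sums cinner (S \<tau> x) (e (\<tau>' l))" for l
      by (simp add: cinner_linear on ne)
    then have *: "cinner (S \<tau> x) (e (\<tau>' l)) = 0" for l
      using sums_unique2[OF _ sums_zero] by blast
    have "(\<lambda>l. cinner (S \<tau> x) (cinner y (e l) *\<^sub>C e (\<tau>' l))) sums cinner (S \<tau> x) (S \<tau>' y)"
      by (rule bounded_linear.sums[OF cinner.bounded_linear_right S[OF that(2)]])
    then show ?thesis using sums_unique2[OF _ sums_zero] by (simp add: cinner_linear *)
  qed
  define \<sigma> where "\<sigma> i k = prod_encode (idx i, k)" for i k
  have \<sigma>: "inj (\<sigma> i)" "i \<noteq> j \<Longrightarrow> \<sigma> i k \<noteq> \<sigma> j l" for i j k l
    using idx by (auto simp: \<sigma>_def inj_def)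
  define T where "T i = Blinfun (S (\<sigma> i))" for i
  have T: "blinfun_apply (T i) = S (\<sigma> i)" for i
    unfolding T_def by (rule bounded_linear_Blinfun_apply[OF bl[OF \<sigma>(1)]])
  show thesis
  proof (rule that[of T])
    show "T i \<in> clinear_ops" for i by (simp add: clinear_ops_def T S_scaleC \<sigma>(1))
    fix v :: "'h ^ 'k"
    have "(norm (blinfun_apply (row_op T) v))\<^sup>2 = (\<Sum>i\<in>UNIV. (norm (S (\<sigma> i) (v $ i)))\<^sup>2)"
      unfolding row_op.rep_eq T
      by (rule norm_sum_orthogonal) (simp, rule S_orth[OF \<sigma>(1) \<sigma>(1) \<sigma>(2)])
    also have "\<dots> = (norm v)\<^sup>2" by (simp add: norm_S \<sigma>(1) norm_vec_sq)
    finally show "norm (blinfun_apply (row_op T) v) = norm v" by simp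
  qed
qed

lemma isometry_cinner:
  fixes T :: "'a :: complex_inner \<Rightarrow>\<^sub>L 'b :: complex_inner"
  assumes T: "T \<in> clinear_ops" and iso: "\<And>v. norm (blinfun_apply T v) = norm v"
  shows "cinner (blinfun_apply T v) (blinfun_apply T w) = cinner v w"
proof -
  have Re: "Re (cinner (blinfun_apply T v) (blinfun_apply T w)) = Re (cinner v w)" for v w
    using norm_add_sq[of "blinfun_apply T v" "blinfun_apply T w"] norm_add_sq[of v w] iso
    by (simp add: blinfun.add_right[symmetric])
  show ?thesis
    using Re[of v w] Re[of "\<i> *\<^sub>C v" w]
    by (intro complex_eqI) (simp_all add: clinear_opsD[OF T] cinner_linear)
qed

lemma row_isometry_cinner:
  assumes T: "\<And>i. T i \<in> clinear_ops" and iso: "\<And>v. norm (blinfun_apply (row_op T) v) = norm v"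
  shows "cinner (blinfun_apply (T i) x) (blinfun_apply (T j) (y :: 'h :: complex_inner)) = (if i = j then cinner x y else 0)"
proof -
  have T_row: "blinfun_apply (T i) x = blinfun_apply (row_op T) (blinfun_apply (embed i) x)" for i x
    using arg_cong[OF row_op_embed[of T i], of "\<lambda>T. blinfun_apply T x"] by simp
  have "cinner (blinfun_apply (T i) x) (blinfun_apply (T j) y)
     = cinner (blinfun_apply (embed i) x) (blinfun_apply (embed j) y)"
    unfolding T_row by (rule isometry_cinner[OF clinear_ops_row_op[OF T] iso])
  also have "\<dots> = (\<Sum>k\<in>UNIV. if k = i then (if i = j then cinner x y else 0) else 0)"
    unfolding cinner_vec_def embed_nth by (intro sum.cong) auto
  finally show ?thesis by simp
qed

text \<open>A row isometry with one index more leaves room for a vacuum vector \<open>\<Omega>\<close> orthogonal to the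
  ranges, so that the operators act like the creation operators of the full Fock space.\<close>

lemma exists_creation_operators:
  assumes sep: "separable_space (euclidean :: 'h :: chilbert_space topology)"
    and inf: "cinfinite_dimensional TYPE('h :: chilbert_space)"
  obtains T :: "('h :: chilbert_space, 'n :: finite) op_tuple" and \<Omega> where "\<And>i. T i \<in> clinear_ops"
    "\<And>v. norm (blinfun_apply (row_op T) v) = norm v"
    "norm \<Omega> = 1" "\<And>i x. cinner (blinfun_apply (T i) x) \<Omega> = 0"
proof -
  obtain W :: "('h, 'n option) op_tuple" where W: "\<And>i. W i \<in> clinear_ops"
    "\<And>v. norm (blinfun_apply (row_op W) v) = norm v"
    using exists_row_isometry[OF sep inf] by blast
  obtain e :: "nat \<Rightarrow> 'h" where on: "\<And>i j. cinner (e i) (e j) = (if i = j then 1 else 0)"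
    and "\<And>x. (\<And>k. cinner x (e k) = 0) \<Longrightarrow> x = 0"
    using exists_orthonormal_basis[OF sep inf] by blast
  note Wc = row_isometry_cinner[OF W]
  define T where "T i = W (Some i)" for i
  define \<Omega> where "\<Omega> = blinfun_apply (W None) (e 0)"
  have nT: "(norm (blinfun_apply (T i) x))\<^sup>2 = (norm x)\<^sup>2" for i x
    by (simp only: Re_cinner_self[symmetric] T_def Wc simp_thms if_True)
  show thesis
  proof (rule that[of T \<Omega>])
    show "T i \<in> clinear_ops" for i by (simp add: T_def W)
    show "cinner (blinfun_apply (T i) x) \<Omega> = 0" for i x by (simp add: T_def \<Omega>_def Wc)
    have "(norm \<Omega>)\<^sup>2 = 1" by (simp add: Re_cinner_self[symmetric] \<Omega>_def Wc on)
    then show "norm \<Omega> = 1" by (simp add: abs_square_eq_1)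
    fix v :: "'h ^ 'n"
    have "(norm (blinfun_apply (row_op T) v))\<^sup>2 = (\<Sum>i\<in>UNIV. (norm (blinfun_apply (T i) (v $ i)))\<^sup>2)"
      unfolding row_op.rep_eq by (rule norm_sum_orthogonal) (auto simp: T_def Wc)
    also have "\<dots> = (norm v)\<^sup>2" by (simp add: nT norm_vec_sq)
    finally show "norm (blinfun_apply (row_op T) v) = norm v" by simp
  qed
qed

section \<open>Homogeneous parts of free power series\<close>

lemma finite_words [simp]: "finite {w :: 'n :: finite list. length w = k}"
  using finite_lists_length_eq[of "UNIV :: 'n set" k] by simp

lemma sum_words_Suc:
  "(\<Sum>w | length w = Suc k. f w) = (\<Sum>i\<in>UNIV. \<Sum>w | length w = k. f (i # w :: 'n :: finite list))"
proof -
  have "{w :: 'n list. length w = Suc k} = (\<lambda>(i, w). i # w) ` (UNIV \<times> {w. length w = k})"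
    by (auto simp: length_Suc_conv image_iff)
  moreover have "inj_on (\<lambda>(i, w). i # w) (UNIV \<times> {w :: 'n list. length w = k})"
    by (auto simp: inj_on_def)
  ultimately show ?thesis
    by (simp add: sum.reindex sum.cartesian_product case_prod_unfold o_def)
qed

lemma word_op_Nil [simp]: "word_op X [] = id_blinfun"
  and word_op_Cons [simp]: "word_op X (i # w) = X i o\<^sub>L word_op X w"
  by (simp_all add: word_op_def)

lemma clinear_word_op: "(\<And>i. X i \<in> clinear_ops) \<Longrightarrow> word_op X w \<in> clinear_ops"
  by (induction w) (simp_all add: clinear_ops_compose)

lemma word_op_scaleR: "word_op (\<lambda>i. r *\<^sub>R X i) w = r ^ length w *\<^sub>R word_op X w"
  by (induction w) (auto intro!: blinfun_eqI simp: blinfun.scaleR_left blinfun.scaleR_right mult.commute)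

text \<open>The row of all \<open>X\<^sub>w\<close> with \<open>|w| = k\<close> factors into \<open>k\<close> ampliations of the row
  \<open>[X\<^sub>1 \<dots> X\<^sub>n]\<close>; each induction step peels off one of them.\<close>

lemma norm_sum_word_op_le:
  fixes X :: "('h :: complex_inner, 'n :: finite) op_tuple"
  shows "(norm (\<Sum>w | length w = k. blinfun_apply (word_op X w) (x w)))\<^sup>2
     \<le> norm (row_op X) ^ (2 * k) * (\<Sum>w | length w = k. (norm (x w))\<^sup>2)"
proof (induction k arbitrary: x)
  case (Suc k)
  define y where "y i = (\<Sum>w | length w = k. blinfun_apply (word_op X w) (x (i # w)))" for i
  have "(\<Sum>w | length w = Suc k. blinfun_apply (word_op X w) (x w)) = blinfun_apply (row_op X) (\<chi> i. y i)"
    by (simp add: sum_words_Suc row_op.rep_eq y_def blinfun.sum_right)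
  then have "(norm (\<Sum>w | length w = Suc k. blinfun_apply (word_op X w) (x w)))\<^sup>2
     \<le> (norm (row_op X) * norm (\<chi> i. y i))\<^sup>2"
    using norm_blinfun[of "row_op X" "\<chi> i. y i"] by (simp add: power_mono)
  also have "\<dots> = (norm (row_op X))\<^sup>2 * (\<Sum>i\<in>UNIV. (norm (y i))\<^sup>2)"
    by (simp add: power_mult_distrib norm_vec_sq)
  also have "\<dots> \<le> (norm (row_op X))\<^sup>2 * (\<Sum>i\<in>UNIV. norm (row_op X) ^ (2 * k) * (\<Sum>w | length w = k. (norm (x (i # w)))\<^sup>2))"
    unfolding y_def by (intro mult_left_mono sum_mono Suc.IH) simp
  also have "\<dots> = norm (row_op X) ^ (2 * Suc k) * (\<Sum>w | length w = Suc k. (norm (x w))\<^sup>2)"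
    by (simp add: sum_words_Suc sum_distrib_left[symmetric] power2_eq_square)
  finally show ?case .
qed simp

definition hom_part :: "('n :: finite list \<Rightarrow> complex) \<Rightarrow> nat \<Rightarrow> ('h :: complex_inner, 'n) op_tuple \<Rightarrow> 'h \<Rightarrow>\<^sub>L 'h" where
  "hom_part g k X = (\<Sum>w | length w = k. g w *\<^sub>C word_op X w)"

lemma scaleC_compose_left: "(c *\<^sub>C S) o\<^sub>L T = c *\<^sub>C (S o\<^sub>L T)"
  by (rule blinfun_eqI) (simp add: scaleC_blinfun.rep_eq)

lemma scaleC_compose_right: "S \<in> clinear_ops \<Longrightarrow> S o\<^sub>L (c *\<^sub>C T) = c *\<^sub>C (S o\<^sub>L T)"
  by (rule blinfun_eqI) (simp add: scaleC_blinfun.rep_eq clinear_opsD)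

lemma hom_part_Suc:
  assumes X: "\<And>i. X i \<in> clinear_ops"
  shows "hom_part g (Suc k) X = (\<Sum>i\<in>UNIV. X i o\<^sub>L hom_part (\<lambda>w. g (i # w)) k X)"
  unfolding hom_part_def sum_words_Suc
  by (intro sum.cong refl)
    (simp add: bounded_bilinear.sum_right[OF bounded_bilinear_blinfun_compose] scaleC_compose_right X)

lemma hom_part_0: "hom_part g 0 X = g [] *\<^sub>C id_blinfun"
proof -
  have "{w :: 'n :: finite list. length w = 0} = {[]}" by auto
  then show ?thesis by (simp add: hom_part_def)
qed

lemma hom_part_diff: "hom_part (\<lambda>w. g w - h w) k X = hom_part g k X - hom_part h k X"
proof -
  have "(g w - h w) *\<^sub>C word_op X w = g w *\<^sub>C word_op X w - h w *\<^sub>C word_op X w" for w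
    using scaleC_add_left[of "g w - h w" "h w" "word_op X w"] by (simp add: algebra_simps)
  then show ?thesis by (simp add: hom_part_def sum_subtractf)
qed

definition coeff_norm :: "('n :: finite list \<Rightarrow> complex) \<Rightarrow> nat \<Rightarrow> real" where
  "coeff_norm g k = sqrt (\<Sum>w | length w = k. (cmod (g w))\<^sup>2)"

lemma coeff_norm_nonneg: "0 \<le> coeff_norm g k"
  by (simp add: coeff_norm_def sum_nonneg)

lemma coeff_norm_sq: "(coeff_norm g k)\<^sup>2 = (\<Sum>w | length w = k. (cmod (g w))\<^sup>2)"
  by (simp add: coeff_norm_def sum_nonneg)

lemma cmod_le_coeff_norm: "cmod (g w) \<le> coeff_norm g (length w)"
  unfolding coeff_norm_def
  by (rule real_le_rsqrt) (rule member_le_sum[of w "{v. length v = length w}" "\<lambda>v. (cmod (g v))\<^sup>2"], auto)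

lemma coeff_norm_Cons_le: "coeff_norm (\<lambda>w. g (i # w)) k \<le> coeff_norm g (Suc k)"
  unfolding coeff_norm_def sum_words_Suc
  by (rule real_sqrt_le_mono)
    (rule member_le_sum[of i UNIV "\<lambda>i. \<Sum>w | length w = k. (cmod (g (i # w)))\<^sup>2"], auto intro: sum_nonneg)

lemma norm_hom_part_le:
  fixes X :: "('h :: complex_inner, 'n :: finite) op_tuple"
  assumes X: "\<And>i. X i \<in> clinear_ops"
  shows "norm (hom_part g k X) \<le> coeff_norm g k * norm (row_op X) ^ k"
proof (rule norm_blinfun_bound)
  fix x
  have "(norm (blinfun_apply (hom_part g k X) x))\<^sup>2
     = (norm (\<Sum>w | length w = k. blinfun_apply (word_op X w) (g w *\<^sub>C x)))\<^sup>2"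
    by (simp add: hom_part_def blinfun.sum_left scaleC_blinfun.rep_eq
        clinear_opsD[OF clinear_word_op[OF X]])
  also have "\<dots> \<le> norm (row_op X) ^ (2 * k) * (\<Sum>w | length w = k. (norm (g w *\<^sub>C x))\<^sup>2)"
    by (rule norm_sum_word_op_le)
  also have "\<dots> = (coeff_norm g k * norm (row_op X) ^ k * norm x)\<^sup>2"
    by (simp add: norm_scaleC power_mult_distrib coeff_norm_sq sum_distrib_right[symmetric]
        power_mult[symmetric] mult.commute[of k])
  finally show "norm (blinfun_apply (hom_part g k X) x) \<le> coeff_norm g k * norm (row_op X) ^ k * norm x"
    by (rule power2_le_imp_le) (simp add: coeff_norm_nonneg)
qed (simp add: coeff_norm_nonneg)

text \<open>Conversely, the creation operators test the coefficients: the words applied to the vacuum are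
  orthonormal, so at \<open>r T\<close> the homogeneous parts send \<open>\<Omega>\<close> to mutually orthogonal vectors of norm
  \<open>coeff_norm g k * r ^ k\<close>, none of which exceeds their sum \<open>Y \<Omega>\<close>.\<close>

lemma exists_coeff_test_tuple:
  assumes sep: "separable_space (euclidean :: 'h :: chilbert_space topology)"
    and inf: "cinfinite_dimensional TYPE('h :: chilbert_space)"
  obtains T :: "('h :: chilbert_space, 'n :: finite) op_tuple"
  where "\<And>i. T i \<in> clinear_ops" "norm (row_op T) \<le> 1"
    "\<And>g r Y k. 0 \<le> r \<Longrightarrow> (\<lambda>k. hom_part g k (\<lambda>i. r *\<^sub>R T i)) sums Y \<Longrightarrow> coeff_norm g k * r ^ k \<le> norm Y"
proof -
  obtain T :: "('h, 'n) op_tuple" and \<Omega> where T: "\<And>i. T i \<in> clinear_ops"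
    and iso: "\<And>v. norm (blinfun_apply (row_op T) v) = norm v"
    and \<Omega>: "norm \<Omega> = 1" "\<And>i x. cinner (blinfun_apply (T i) x) \<Omega> = 0"
    using exists_creation_operators[OF sep inf] by blast
  have \<Omega>': "cinner \<Omega> (blinfun_apply (T i) x) = 0" for i x
    using \<Omega>(2)[of i x] cinner_commute[of \<Omega> "blinfun_apply (T i) x"] by simp
  define e where "e w = blinfun_apply (word_op T w) \<Omega>" for w
  have on: "cinner (e v) (e w) = (if v = w then 1 else 0)" for v w
  proof (induction v arbitrary: w)
    case Nil
    then show ?case by (cases w) (simp_all add: e_def \<Omega> \<Omega>' cinner_self)
  next
    case (Cons i v)
    then show ?case by (cases w) (auto simp: e_def \<Omega> row_isometry_cinner[OF T iso])
  qed
  have "coeff_norm g k * r ^ k \<le> norm Y"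
    if r: "0 \<le> r" and Y: "(\<lambda>k. hom_part g k (\<lambda>i. r *\<^sub>R T i)) sums Y" for g r Y k
  proof -
    define h where "h k = (\<Sum>w | length w = k. (g w * complex_of_real (r ^ k)) *\<^sub>C e w)" for k
    have h: "blinfun_apply (hom_part g k (\<lambda>i. r *\<^sub>R T i)) \<Omega> = h k" for k
      unfolding hom_part_def h_def word_op_scaleR
      by (simp add: blinfun.sum_left scaleC_blinfun.rep_eq blinfun.scaleR_left e_def
          scaleC_scaleR scaleC_scaleC[symmetric] scaleC_of_real del: of_real_power)
    have nh: "(norm (h k))\<^sup>2 = (coeff_norm g k * r ^ k)\<^sup>2"
      unfolding h_def
      by (subst norm_orthonormal_sum[OF finite_words on])
        (simp add: norm_mult norm_power power_mult_distrib coeff_norm_sq sum_distrib_right r)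
    have orth: "cinner (h j) (h k) = (if j = k then complex_of_real ((norm (h k))\<^sup>2) else 0)" for j
    proof (cases "j = k")
      case False
      then show ?thesis
        by (auto simp: h_def cinner.sum_left cinner.sum_right cinner_linear on intro!: sum.neutral split: if_splits)
    qed (simp add: cinner_self)
    have "(\<lambda>j. blinfun_apply (hom_part g j (\<lambda>i. r *\<^sub>R T i)) \<Omega>) sums blinfun_apply Y \<Omega>"
      by (rule bounded_linear.sums[OF blinfun.bounded_linear_left Y])
    then have "(\<lambda>j. cinner (h j) (h k)) sums cinner (blinfun_apply Y \<Omega>) (h k)"
      unfolding h by (rule bounded_linear.sums[OF cinner.bounded_linear_left])
    moreover have "(\<lambda>j. cinner (h j) (h k)) sums complex_of_real ((norm (h k))\<^sup>2)"
      unfolding orth by (rule sums_single)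
    ultimately have "complex_of_real ((norm (h k))\<^sup>2) = cinner (blinfun_apply Y \<Omega>) (h k)"
      by (rule sums_unique2[symmetric])
    then have "(norm (h k))\<^sup>2 \<le> norm (blinfun_apply Y \<Omega>) * norm (h k)"
      using Re_cinner_le[of "blinfun_apply Y \<Omega>" "h k"] by (metis Re_complex_of_real)
    also have "\<dots> \<le> norm Y * norm (h k)"
      using norm_blinfun[of Y \<Omega>] \<Omega>(1) by (intro mult_right_mono) auto
    finally have "norm (h k) \<le> norm Y"
      by (cases "h k = 0") (auto simp: power2_eq_square)
    moreover have "norm (h k) = coeff_norm g k * r ^ k"
      using nh r by (simp add: coeff_norm_nonneg)
    ultimately show ?thesis by simp
  qed
  moreover have "norm (row_op T) \<le> 1" by (rule norm_blinfun_bound) (simp_all add: iso)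
  ultimately show thesis using that T by blast
qed

lemma free_holomorphic_iff:
  "free_holomorphic f \<longleftrightarrow> (\<exists>g. \<forall>X\<in>op_ball. (\<lambda>k. hom_part g k X) sums f X)"
  by (simp add: free_holomorphic_def hom_part_def)

section \<open>Locally uniform approximation by noncommutative polynomials\<close>

inductive nc_polynomial :: "(('h :: complex_normed_vector, 'n) op_tuple \<Rightarrow> 'h \<Rightarrow>\<^sub>L 'h) \<Rightarrow> bool" where
  one: "nc_polynomial (\<lambda>_. id_blinfun)"
| var: "nc_polynomial p \<Longrightarrow> nc_polynomial (\<lambda>X. X i o\<^sub>L p X)"
| add: "nc_polynomial p \<Longrightarrow> nc_polynomial q \<Longrightarrow> nc_polynomial (\<lambda>X. p X + q X)"
| scale: "nc_polynomial p \<Longrightarrow> nc_polynomial (\<lambda>X. c *\<^sub>C p X)"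

definition op_ball_upto :: "real \<Rightarrow> ('h :: complex_normed_vector, 'n :: finite) op_tuple set" where
  "op_ball_upto r = {X. (\<forall>i. X i \<in> clinear_ops) \<and> norm (row_op X) \<le> r}"

lemma op_ball_uptoD: "X \<in> op_ball_upto r \<Longrightarrow> X i \<in> clinear_ops" "X \<in> op_ball_upto r \<Longrightarrow> norm (row_op X) \<le> r"
  by (auto simp: op_ball_upto_def)

lemma op_ball_upto_mono: "r \<le> r' \<Longrightarrow> op_ball_upto r \<subseteq> op_ball_upto r'"
  by (auto simp: op_ball_upto_def)

lemma op_ball_upto_subset: "r < 1 \<Longrightarrow> op_ball_upto r \<subseteq> (op_ball :: ('h :: chilbert_space, 'n :: finite) op_tuple set)"
  by (auto simp: op_ball_upto_def op_ball_iff)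

text \<open>This description of the free holomorphic functions makes no reference to coefficients,
  whose behaviour under products and compositions would be laborious to track.\<close>

definition poly_approx :: "(('h :: complex_normed_vector, 'n :: finite) op_tuple \<Rightarrow> 'h \<Rightarrow>\<^sub>L 'h) \<Rightarrow> bool" where
  "poly_approx G \<longleftrightarrow> (\<forall>r<1. \<forall>\<epsilon>>0. \<exists>p. nc_polynomial p \<and> (\<forall>X\<in>op_ball_upto r. norm (G X - p X) \<le> \<epsilon>))"

lemma poly_approxD:
  assumes "poly_approx G" "r < 1" "\<epsilon> > 0"
  obtains p where "nc_polynomial p" "\<And>X. X \<in> op_ball_upto r \<Longrightarrow> norm (G X - p X) \<le> \<epsilon>"
  using assms unfolding poly_approx_def by blast

lemma nc_polynomial_0: "nc_polynomial (\<lambda>_. 0)"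
  using nc_polynomial.scale[OF nc_polynomial.one, of 0] by simp

lemma nc_polynomial_sum:
  "finite I \<Longrightarrow> (\<And>i. i \<in> I \<Longrightarrow> nc_polynomial (p i)) \<Longrightarrow> nc_polynomial (\<lambda>X. \<Sum>i\<in>I. p i X)"
  by (induction I rule: finite_induct) (simp_all add: nc_polynomial_0 nc_polynomial.add)

lemma nc_polynomial_word_op: "nc_polynomial (\<lambda>X. word_op X w)"
  by (induction w) (simp_all add: nc_polynomial.intros)

lemma nc_polynomial_hom_part: "nc_polynomial (hom_part g k)"
  unfolding hom_part_def
  by (intro nc_polynomial_sum nc_polynomial.scale nc_polynomial_word_op finite_words)

lemma nc_polynomial_mult:
  assumes "nc_polynomial p" "nc_polynomial q"
  shows "nc_polynomial (\<lambda>X. p X o\<^sub>L q X)"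
  using assms
proof (induction rule: nc_polynomial.induct)
  case one
  then show ?case by simp
next
  case (var p i)
  then show ?case by (simp add: blinfun_compose_assoc nc_polynomial.var)
next
  case (add p q)
  then show ?case
    by (simp add: bounded_bilinear.add_left[OF bounded_bilinear_blinfun_compose] nc_polynomial.add)
next
  case (scale p c)
  then show ?case by (simp add: scaleC_compose_left nc_polynomial.scale)
qed

lemma nc_polynomial_bounded:
  assumes "nc_polynomial p"
  shows "\<exists>B\<ge>0. \<forall>X\<in>op_ball_upto 1. norm (p X) \<le> B"
  using assms
proof (induction rule: nc_polynomial.induct)
  case one
  then show ?case by (intro exI[of _ 1]) (simp add: norm_blinfun_id_le)
next
  case (var p i)
  then obtain B where B: "B \<ge> 0" "\<And>X. X \<in> op_ball_upto 1 \<Longrightarrow> norm (p X) \<le> B" by blast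
  have "norm (X i o\<^sub>L p X) \<le> 1 * B" if "X \<in> op_ball_upto 1" for X
    using norm_le_norm_row_op[of X i] op_ball_uptoD(2)[OF that] B that
    by (intro order_trans[OF norm_blinfun_compose] mult_mono) auto
  then show ?case using B(1) by auto
next
  case (add p q)
  then obtain B C where "B \<ge> 0" "\<And>X. X \<in> op_ball_upto 1 \<Longrightarrow> norm (p X) \<le> B"
    "C \<ge> 0" "\<And>X. X \<in> op_ball_upto 1 \<Longrightarrow> norm (q X) \<le> C" by blast
  then show ?case by (intro exI[of _ "B + C"]) (auto intro: norm_triangle_mono)
next
  case (scale p c)
  then obtain B where "B \<ge> 0" "\<And>X. X \<in> op_ball_upto 1 \<Longrightarrow> norm (p X) \<le> B" by blast
  then show ?case by (intro exI[of _ "cmod c * B"]) (auto simp: norm_scaleC intro: mult_left_mono)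
qed

lemma nc_polynomial_imp_free_holomorphic:
  fixes p :: "('h :: chilbert_space, 'n :: finite) op_tuple \<Rightarrow> 'h \<Rightarrow>\<^sub>L 'h"
  assumes "nc_polynomial p"
  shows "free_holomorphic p"
  using assms
proof (induction rule: nc_polynomial.induct)
  case one
  define g :: "'n list \<Rightarrow> complex" where "g w = (if w = [] then 1 else 0)" for w
  have "hom_part g k X = (if k = 0 then id_blinfun else 0)" for k and X :: "('h, 'n) op_tuple"
    by (cases k) (auto simp: hom_part_0 hom_part_def g_def intro!: sum.neutral)
  then have "(\<lambda>k. hom_part g k X) sums id_blinfun" for X :: "('h, 'n) op_tuple"
    using sums_single[of 0 "\<lambda>_. id_blinfun :: 'h \<Rightarrow>\<^sub>L 'h"] by simp
  then show ?case unfolding free_holomorphic_iff by blast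
next
  case (var p i)
  then obtain g where g: "\<And>X. X \<in> op_ball \<Longrightarrow> (\<lambda>k. hom_part g k X) sums p X"
    unfolding free_holomorphic_iff by blast
  define g' where "g' w = (case w of [] \<Rightarrow> 0 | j # v \<Rightarrow> if j = i then g v else 0)" for w
  have "(\<lambda>k. hom_part g' k X) sums (X i o\<^sub>L p X)" if X: "X \<in> op_ball" for X
  proof -
    have Xc: "X i \<in> clinear_ops" for i using X by (simp add: op_ball_iff)
    have tail: "hom_part (\<lambda>w. g' (j # w)) k X = (if j = i then hom_part g k X else 0)" for j k
      by (simp add: hom_part_def g'_def)
    have "hom_part g' (Suc k) X = (\<Sum>j\<in>UNIV. if j = i then X i o\<^sub>L hom_part g k X else 0)" for k
      unfolding hom_part_Suc[OF Xc] tail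
      by (intro sum.cong) (auto intro: blinfun_eqI)
    then have "hom_part g' (Suc k) X = X i o\<^sub>L hom_part g k X" for k by simp
    moreover have "hom_part g' 0 X = 0" by (simp add: hom_part_0 g'_def)
    moreover have "(\<lambda>k. X i o\<^sub>L hom_part g k X) sums (X i o\<^sub>L p X)"
      by (rule bounded_linear.sums[OF bounded_bilinear.bounded_linear_right[OF
              bounded_bilinear_blinfun_compose] g[OF X]])
    ultimately show ?thesis using sums_Suc[of "\<lambda>k. hom_part g' k X" "X i o\<^sub>L p X"] by simp
  qed
  then show ?case unfolding free_holomorphic_iff by blast
next
  case (add p q)
  then obtain g h where g: "\<And>X. X \<in> op_ball \<Longrightarrow> (\<lambda>k. hom_part g k X) sums p X"
    and h: "\<And>X. X \<in> op_ball \<Longrightarrow> (\<lambda>k. hom_part h k X) sums q X"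
    unfolding free_holomorphic_iff by blast
  have "hom_part (\<lambda>w. g w + h w) k X = hom_part g k X + hom_part h k X" for k and X :: "('h, 'n) op_tuple"
    by (simp add: hom_part_def scaleC_add_left sum.distrib)
  then have "(\<lambda>k. hom_part (\<lambda>w. g w + h w) k X) sums (p X + q X)" if "X \<in> op_ball" for X
    using sums_add[OF g[OF that] h[OF that]] by simp
  then show ?case unfolding free_holomorphic_iff by blast
next
  case (scale p c)
  then obtain g where g: "\<And>X. X \<in> op_ball \<Longrightarrow> (\<lambda>k. hom_part g k X) sums p X"
    unfolding free_holomorphic_iff by blast
  have "hom_part (\<lambda>w. c * g w) k X = c *\<^sub>C hom_part g k X" for k and X :: "('h, 'n) op_tuple"
    by (simp add: hom_part_def scaleC_scaleC[symmetric] scaleC_sum_right)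
  then have "(\<lambda>k. hom_part (\<lambda>w. c * g w) k X) sums (c *\<^sub>C p X)" if "X \<in> op_ball" for X
    using bounded_linear.sums[OF bounded_linear_scaleC g[OF that]] by simp
  then show ?case unfolding free_holomorphic_iff by blast
qed

lemma poly_approx_polynomial: "nc_polynomial p \<Longrightarrow> poly_approx p"
  unfolding poly_approx_def by (auto intro!: exI[of _ p])

lemma poly_approx_limit:
  assumes "\<And>r \<epsilon>. r < 1 \<Longrightarrow> \<epsilon> > 0 \<Longrightarrow> \<exists>H. poly_approx H \<and> (\<forall>X\<in>op_ball_upto r. norm (G X - H X) \<le> \<epsilon>)"
  shows "poly_approx G"
  unfolding poly_approx_def
proof (intro allI impI)
  fix r \<epsilon> :: real assume r: "r < 1" and \<epsilon>: "\<epsilon> > 0"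
  obtain H where H: "poly_approx H" "\<And>X. X \<in> op_ball_upto r \<Longrightarrow> norm (G X - H X) \<le> \<epsilon> / 2"
    using assms[OF r, of "\<epsilon> / 2"] \<epsilon> by auto
  obtain p where p: "nc_polynomial p" "\<And>X. X \<in> op_ball_upto r \<Longrightarrow> norm (H X - p X) \<le> \<epsilon> / 2"
    using poly_approxD[OF H(1) r, of "\<epsilon> / 2"] \<epsilon> by auto
  have "norm (G X - p X) \<le> \<epsilon>" if "X \<in> op_ball_upto r" for X
    using norm_triangle_mono[OF H(2)[OF that] p(2)[OF that]] by simp
  then show "\<exists>p. nc_polynomial p \<and> (\<forall>X\<in>op_ball_upto r. norm (G X - p X) \<le> \<epsilon>)" using p(1) by blast
qed

lemma poly_approx_cong:
  assumes "poly_approx G" "\<And>X. X \<in> op_ball \<Longrightarrow> G X = H X"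
  shows "poly_approx (H :: ('h :: chilbert_space, 'n :: finite) op_tuple \<Rightarrow> _)"
proof (rule poly_approx_limit)
  fix r \<epsilon> :: real assume "r < 1" "\<epsilon> > 0"
  then show "\<exists>H'. poly_approx H' \<and> (\<forall>X\<in>op_ball_upto r. norm (H X - H' X) \<le> \<epsilon>)"
    using assms op_ball_upto_subset[of r, where 'h = 'h and 'n = 'n] by (intro exI[of _ G]) auto
qed

lemma poly_approx_add:
  assumes G: "poly_approx G" and H: "poly_approx H"
  shows "poly_approx (\<lambda>X. G X + H X)"
  unfolding poly_approx_def
proof (intro allI impI)
  fix r \<epsilon> :: real assume r: "r < 1" and \<epsilon>: "\<epsilon> > 0"
  obtain p where p: "nc_polynomial p" "\<And>X. X \<in> op_ball_upto r \<Longrightarrow> norm (G X - p X) \<le> \<epsilon> / 2"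
    using poly_approxD[OF G r, of "\<epsilon> / 2"] \<epsilon> by auto
  obtain q where q: "nc_polynomial q" "\<And>X. X \<in> op_ball_upto r \<Longrightarrow> norm (H X - q X) \<le> \<epsilon> / 2"
    using poly_approxD[OF H r, of "\<epsilon> / 2"] \<epsilon> by auto
  have "norm (G X + H X - (p X + q X)) \<le> \<epsilon>" if "X \<in> op_ball_upto r" for X
    using norm_triangle_mono[OF p(2)[OF that] q(2)[OF that]] by (simp add: algebra_simps)
  then show "\<exists>p. nc_polynomial p \<and> (\<forall>X\<in>op_ball_upto r. norm (G X + H X - p X) \<le> \<epsilon>)"
    using nc_polynomial.add[OF p(1) q(1)] by blast
qed

lemma poly_approx_mult:
  fixes G H :: "('h :: complex_normed_vector, 'n :: finite) op_tuple \<Rightarrow> 'h \<Rightarrow>\<^sub>L 'h"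
  assumes G: "poly_approx G" and H: "poly_approx H"
  shows "poly_approx (\<lambda>X. G X o\<^sub>L H X)"
  unfolding poly_approx_def
proof (intro allI impI)
  fix r \<epsilon> :: real assume r: "r < 1" and \<epsilon>: "\<epsilon> > 0"
  have sub: "X \<in> op_ball_upto r \<Longrightarrow> X \<in> op_ball_upto 1" for X :: "('h, 'n) op_tuple"
    using op_ball_upto_mono[of r 1] r by auto
  obtain p0 where p0: "nc_polynomial p0" "\<And>X. X \<in> op_ball_upto r \<Longrightarrow> norm (G X - p0 X) \<le> 1"
    using poly_approxD[OF G r, of 1] by auto
  obtain B0 where B0: "B0 \<ge> 0" "\<And>X. X \<in> op_ball_upto 1 \<Longrightarrow> norm (p0 X) \<le> B0"
    using nc_polynomial_bounded[OF p0(1)] by blast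
  define B where "B = 1 + B0"
  have B: "B > 0" using B0 by (simp add: B_def)
  have GB: "norm (G X) \<le> B" if X: "X \<in> op_ball_upto r" for X
    using norm_triangle_mono[OF p0(2)[OF X] B0(2)[OF sub[OF X]]] by (simp add: B_def)
  obtain q where q: "nc_polynomial q" "\<And>X. X \<in> op_ball_upto r \<Longrightarrow> norm (H X - q X) \<le> \<epsilon> / 2 / B"
    using poly_approxD[OF H r, of "\<epsilon> / 2 / B"] \<epsilon> B by auto
  obtain C0 where C0: "C0 \<ge> 0" "\<And>X. X \<in> op_ball_upto 1 \<Longrightarrow> norm (q X) \<le> C0"
    using nc_polynomial_bounded[OF q(1)] by blast
  define C where "C = C0 + 1"
  have C: "C > 0" using C0 by (simp add: C_def)
  have qC: "norm (q X) \<le> C" if X: "X \<in> op_ball_upto r" for X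
    using C0(2)[OF sub[OF X]] by (simp add: C_def)
  obtain p where p: "nc_polynomial p" "\<And>X. X \<in> op_ball_upto r \<Longrightarrow> norm (G X - p X) \<le> \<epsilon> / 2 / C"
    using poly_approxD[OF G r, of "\<epsilon> / 2 / C"] \<epsilon> C by auto
  have "norm ((G X o\<^sub>L H X) - (p X o\<^sub>L q X)) \<le> \<epsilon>" if X: "X \<in> op_ball_upto r" for X
  proof -
    have "(G X o\<^sub>L H X) - (p X o\<^sub>L q X) = (G X o\<^sub>L (H X - q X)) + ((G X - p X) o\<^sub>L q X)"
      by (rule blinfun_eqI) (simp add: blinfun.diff_left blinfun.add_left blinfun.diff_right)
    also have "norm \<dots> \<le> B * (\<epsilon> / 2 / B) + \<epsilon> / 2 / C * C"
      by (intro norm_triangle_mono order_trans[OF norm_blinfun_compose] mult_mono GB q qC p X)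
        (use B C \<epsilon> in auto)
    also have "\<dots> = \<epsilon>" using B C by simp
    finally show ?thesis .
  qed
  then show "\<exists>p. nc_polynomial p \<and> (\<forall>X\<in>op_ball_upto r. norm ((G X o\<^sub>L H X) - p X) \<le> \<epsilon>)"
    using nc_polynomial_mult[OF p(1) q(1)] by blast
qed

lemma poly_approx_one: "poly_approx (\<lambda>_. id_blinfun)"
  by (rule poly_approx_polynomial[OF nc_polynomial.one])

lemma poly_approx_scale:
  assumes G: "poly_approx G"
  shows "poly_approx (\<lambda>X. c *\<^sub>C G X)"
  using poly_approx_mult[OF poly_approx_polynomial[OF nc_polynomial.scale[OF nc_polynomial.one, of c]] G]
  by (simp add: scaleC_compose_left)

lemma poly_approx_scaleR: "poly_approx G \<Longrightarrow> poly_approx (\<lambda>X. r *\<^sub>R G X)"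
  using poly_approx_scale[of G "complex_of_real r"] by (simp add: scaleC_of_real)

lemma poly_approx_diff: "poly_approx G \<Longrightarrow> poly_approx H \<Longrightarrow> poly_approx (\<lambda>X. G X - H X)"
  using poly_approx_add[of G "\<lambda>X. (-1) *\<^sub>R H X"] poly_approx_scaleR[of H "-1"] by simp

lemma poly_approx_sum:
  "finite I \<Longrightarrow> (\<And>i. i \<in> I \<Longrightarrow> poly_approx (G i)) \<Longrightarrow> poly_approx (\<lambda>X. \<Sum>i\<in>I. G i X)"
  by (induction I rule: finite_induct)
    (simp_all add: poly_approx_add poly_approx_polynomial nc_polynomial_0)

lemma poly_approx_op_power: "poly_approx G \<Longrightarrow> poly_approx (\<lambda>X. op_power k (G X))"
  by (induction k) (simp_all add: poly_approx_one poly_approx_mult)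

lemma poly_approx_var: "poly_approx (\<lambda>X. X i)"
  using poly_approx_polynomial[OF nc_polynomial.var[OF nc_polynomial.one, of i]] by simp

lemma poly_approx_nc_polynomial_compose:
  assumes "nc_polynomial p" and Y: "\<And>j. poly_approx (\<lambda>X. Y X j)"
  shows "poly_approx (\<lambda>X. p (Y X))"
  using assms(1)
  by (induction rule: nc_polynomial.induct)
    (simp_all add: poly_approx_one poly_approx_mult Y poly_approx_add poly_approx_scale)

text \<open>The inner function has to keep balls of radius below \<open>1\<close> within balls of radius below
  \<open>1\<close>, because \<open>G\<close> is approximated uniformly only there.\<close>

lemma poly_approx_compose:
  assumes G: "poly_approx G" and Y: "\<And>j. poly_approx (\<lambda>X. Y X j)"
    and ball: "\<And>r. r < 1 \<Longrightarrow> \<exists>\<rho><1. Y ` op_ball_upto r \<subseteq> op_ball_upto \<rho>"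
  shows "poly_approx (\<lambda>X. G (Y X))"
proof (rule poly_approx_limit)
  fix r \<epsilon> :: real assume r: "r < 1" and \<epsilon>: "\<epsilon> > 0"
  obtain \<rho> where \<rho>: "\<rho> < 1" "Y ` op_ball_upto r \<subseteq> op_ball_upto \<rho>" using ball[OF r] by blast
  obtain p where p: "nc_polynomial p" "\<And>X. X \<in> op_ball_upto \<rho> \<Longrightarrow> norm (G X - p X) \<le> \<epsilon>"
    using poly_approxD[OF G \<rho>(1) \<epsilon>] by blast
  then show "\<exists>H. poly_approx H \<and> (\<forall>X\<in>op_ball_upto r. norm (G (Y X) - H X) \<le> \<epsilon>)"
    using poly_approx_nc_polynomial_compose[OF p(1) Y] \<rho>(2)
    by (intro exI[of _ "\<lambda>X. p (Y X)"]) auto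
qed

text \<open>The value of \<open>G\<close> at a multiple \<open>\<rho> T\<close> of the creation operators with \<open>r < \<rho> < 1\<close> bounds the
  coefficients, which makes the series converge geometrically and uniformly for \<open>\<parallel>X\<parallel> \<le> r\<close>.\<close>

lemma free_holomorphic_imp_poly_approx:
  fixes G :: "('h :: chilbert_space, 'n :: finite) op_tuple \<Rightarrow> 'h \<Rightarrow>\<^sub>L 'h"
  assumes sep: "separable_space (euclidean :: 'h :: chilbert_space topology)"
    and inf: "cinfinite_dimensional TYPE('h :: chilbert_space)"
    and G: "free_holomorphic G"
  shows "poly_approx G"
  unfolding poly_approx_def
proof (intro allI impI)
  fix r \<epsilon> :: real assume r: "r < 1" and \<epsilon>: "\<epsilon> > 0"
  obtain g where g: "\<And>X. X \<in> op_ball \<Longrightarrow> (\<lambda>k. hom_part g k X) sums G X"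
    using G unfolding free_holomorphic_iff by blast
  obtain T :: "('h, 'n) op_tuple" where T: "\<And>i. T i \<in> clinear_ops" "norm (row_op T) \<le> 1"
    and test: "\<And>g r Y k. 0 \<le> r \<Longrightarrow> (\<lambda>k. hom_part g k (\<lambda>i. r *\<^sub>R T i)) sums Y \<Longrightarrow> coeff_norm g k * r ^ k \<le> norm Y"
    using exists_coeff_test_tuple[OF sep inf] by blast
  define r' where "r' = max r 0"
  define \<rho> where "\<rho> = (1 + r') / 2"
  have r': "0 \<le> r'" "r \<le> r'" "r' < \<rho>" "\<rho> < 1" "0 < \<rho>" using r by (auto simp: r'_def \<rho>_def)
  have "(\<lambda>i. \<rho> *\<^sub>R T i) \<in> op_ball"
  proof -
    have "\<rho> * norm (row_op T) < 1"
      using mult_left_mono[OF T(2), of \<rho>] r'(4,5) by linarith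
    then show ?thesis using T r' by (simp add: op_ball_iff clinear_ops_scaleR row_op_scaleR)
  qed
  note Y = test[OF less_imp_le[OF r'(5)] g[OF this]]
  define K where "K = norm (G (\<lambda>i. \<rho> *\<^sub>R T i))"
  define q where "q = r' / \<rho>"
  have q: "0 \<le> q" "q < 1" using r' by (simp_all add: q_def)
  have "(\<lambda>N. K * q ^ N / (1 - q)) \<longlonglongrightarrow> K * 0 / (1 - q)"
    by (intro tendsto_intros LIMSEQ_power_zero) (use q in auto)
  then have "\<forall>\<^sub>F N in sequentially. K * q ^ N / (1 - q) < \<epsilon>"
    by (rule order_tendstoD) (use \<epsilon> in simp)
  then obtain N where N: "K * q ^ N / (1 - q) < \<epsilon>" by (auto simp: eventually_sequentially)
  have "norm (G X - (\<Sum>k<N. hom_part g k X)) \<le> \<epsilon>" if X: "X \<in> op_ball_upto r" for X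
  proof -
    have "norm (hom_part g k X) \<le> K * q ^ k" for k
    proof -
      have "norm (hom_part g k X) \<le> coeff_norm g k * norm (row_op X) ^ k"
        by (rule norm_hom_part_le[OF op_ball_uptoD(1)[OF X]])
      also have "\<dots> \<le> coeff_norm g k * r' ^ k"
        using op_ball_uptoD(2)[OF X] r' by (intro mult_left_mono power_mono) (auto simp: coeff_norm_nonneg)
      also have "\<dots> = coeff_norm g k * \<rho> ^ k * q ^ k"
        using r' by (simp add: q_def power_divide)
      also have "\<dots> \<le> K * q ^ k" using Y[of k] q unfolding K_def by (intro mult_right_mono) auto
      finally show ?thesis .
    qed
    moreover have "X \<in> op_ball" using X op_ball_upto_subset[OF r] by blast
    ultimately have "norm (G X - (\<Sum>k<N. hom_part g k X)) \<le> K * q ^ N / (1 - q)"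
      by (intro sums_tail_bound[OF g] q)
    then show ?thesis using N by simp
  qed
  moreover have "nc_polynomial (\<lambda>X. \<Sum>k<N. hom_part g k X)"
    by (intro nc_polynomial_sum nc_polynomial_hom_part) simp
  ultimately show "\<exists>p. nc_polynomial p \<and> (\<forall>X\<in>op_ball_upto r. norm (G X - p X) \<le> \<epsilon>)" by blast
qed

text \<open>An analogue of Weierstrass' convergence theorem: the differences of the approximating
  polynomials at the creation operators control the differences of their coefficients, so the
  coefficients converge; the same estimate shows that the limits are the coefficients of \<open>G\<close>.\<close>

lemma poly_approx_imp_free_holomorphic:
  fixes G :: "('h :: chilbert_space, 'n :: finite) op_tuple \<Rightarrow> 'h \<Rightarrow>\<^sub>L 'h"
  assumes sep: "separable_space (euclidean :: 'h :: chilbert_space topology)"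
    and inf: "cinfinite_dimensional TYPE('h :: chilbert_space)"
    and G: "poly_approx G"
  shows "free_holomorphic G"
proof -
  obtain T :: "('h, 'n) op_tuple" where T: "\<And>i. T i \<in> clinear_ops" "norm (row_op T) \<le> 1"
    and test: "\<And>g r Y k. 0 \<le> r \<Longrightarrow> (\<lambda>k. hom_part g k (\<lambda>i. r *\<^sub>R T i)) sums Y \<Longrightarrow> coeff_norm g k * r ^ k \<le> norm Y"
    using exists_coeff_test_tuple[OF sep inf] by blast
  define r where "r N = 1 - inverse (real (Suc N))" for N
  have r1: "r N < 1" for N by (simp add: r_def)
  have r_mono: "M \<le> N \<Longrightarrow> r M \<le> r N" for M N
    unfolding r_def by (intro diff_left_mono le_imp_inverse_le) auto
  have r_lim: "r \<longlonglongrightarrow> 1 - 0" unfolding r_def by (intro tendsto_intros LIMSEQ_inverse_real_of_nat)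
  have "\<exists>p. nc_polynomial p \<and> (\<forall>X\<in>op_ball_upto (r N). norm (G X - p X) \<le> inverse (real (Suc N)))" for N
    using G r1[of N] unfolding poly_approx_def by simp
  then obtain p where p: "\<And>N. nc_polynomial (p N)"
    and Gp: "\<And>N X. X \<in> op_ball_upto (r N) \<Longrightarrow> norm (G X - p N X) \<le> inverse (real (Suc N))" by metis
  have "\<exists>g. \<forall>X\<in>op_ball. (\<lambda>k. hom_part g k X) sums p N X" for N
    using nc_polynomial_imp_free_holomorphic[OF p[of N]] unfolding free_holomorphic_iff .
  then obtain g where g: "\<And>N X. X \<in> op_ball \<Longrightarrow> (\<lambda>k. hom_part (g N) k X) sums p N X" by metis
  have diff: "coeff_norm (\<lambda>w. g M w - g N w) k * \<rho> ^ k \<le> 2 * inverse (real (Suc N))"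
    if \<rho>: "0 \<le> \<rho>" "\<rho> \<le> r N" and "N \<le> M" for M N k \<rho>
  proof -
    define X where "X = (\<lambda>i. \<rho> *\<^sub>R T i)"
    have "\<rho> * norm (row_op T) \<le> r N"
      using mult_left_mono[OF T(2) \<rho>(1)] \<rho>(2) by linarith
    then have X: "X \<in> op_ball_upto (r N)"
      using T \<rho> by (simp add: X_def op_ball_upto_def clinear_ops_scaleR row_op_scaleR)
    have XM: "X \<in> op_ball_upto (r M)" using X op_ball_upto_mono[OF r_mono[OF \<open>N \<le> M\<close>]] by blast
    have Xb: "X \<in> op_ball" using X op_ball_upto_subset[OF r1] by blast
    have "(\<lambda>k. hom_part (\<lambda>w. g M w - g N w) k X) sums (p M X - p N X)"
      unfolding hom_part_diff by (intro sums_diff g Xb)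
    then have "coeff_norm (\<lambda>w. g M w - g N w) k * \<rho> ^ k \<le> norm (p M X - p N X)"
      unfolding X_def by (rule test[OF \<rho>(1)])
    also have "p M X - p N X = (G X - p N X) - (G X - p M X)" by simp
    also have "norm \<dots> \<le> inverse (real (Suc N)) + inverse (real (Suc M))"
      by (intro order_trans[OF norm_triangle_ineq4] add_mono Gp X XM)
    also have "\<dots> \<le> inverse (real (Suc N)) + inverse (real (Suc N))"
      using \<open>N \<le> M\<close> by (intro add_left_mono le_imp_inverse_le) auto
    finally show ?thesis by simp
  qed
  have "convergent (\<lambda>N. g N w)" for w
  proof -
    have "Cauchy (\<lambda>N. g N w)"
    proof (rule metric_CauchyI)
      fix e :: real assume e: "e > 0"
      define k where "k = length w"
      obtain N0 where N0: "real N0 > 4 * 2 ^ k / e" using reals_Archimedean2 by blast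
      define N where "N = max 1 N0"
      \<comment> \<open>for the convergence of a single coefficient any fixed radius will do\<close>
      have half: "1 / 2 \<le> r N"
        using r_mono[of 1 N] by (simp add: N_def r_def)
      have small: "2 * (2 * inverse (real (Suc N)) * 2 ^ k) < e"
      proof -
        have "4 * 2 ^ k < real N0 * e" using N0 e by (simp add: divide_less_eq)
        also have "\<dots> \<le> real (Suc N) * e" using e by (intro mult_right_mono) (auto simp: N_def)
        finally show ?thesis by (simp add: field_simps)
      qed
      have close: "dist (g M w) (g N w) \<le> 2 * inverse (real (Suc N)) * 2 ^ k" if "N \<le> M" for M
      proof -
        have "cmod (g M w - g N w) \<le> coeff_norm (\<lambda>w. g M w - g N w) k"
          unfolding k_def by (rule cmod_le_coeff_norm)
        also have "\<dots> = coeff_norm (\<lambda>w. g M w - g N w) k * (1 / 2) ^ k * 2 ^ k"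
          by (simp add: power_divide)
        also have "\<dots> \<le> 2 * inverse (real (Suc N)) * 2 ^ k"
          by (intro mult_right_mono diff half that) auto
        finally show ?thesis by (simp add: dist_norm)
      qed
      show "\<exists>M. \<forall>m\<ge>M. \<forall>n\<ge>M. dist (g m w) (g n w) < e"
      proof (intro exI allI impI)
        fix m n assume "N \<le> m" "N \<le> n"
        then show "dist (g m w) (g n w) < e"
          using close[of m] close[of n] small dist_triangle2[of "g m w" "g n w" "g N w"] by linarith
      qed
    qed
    then show ?thesis by (rule Cauchy_convergent)
  qed
  then obtain c where c: "\<And>w. (\<lambda>N. g N w) \<longlonglongrightarrow> c w" unfolding convergent_def by metis
  have c_diff: "coeff_norm (\<lambda>w. c w - g N w) k * \<rho> ^ k \<le> 2 * inverse (real (Suc N))"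
    if \<rho>: "0 \<le> \<rho>" "\<rho> \<le> r N" for N k \<rho>
  proof (rule LIMSEQ_le_const2)
    show "(\<lambda>M. coeff_norm (\<lambda>w. g M w - g N w) k * \<rho> ^ k) \<longlonglongrightarrow> coeff_norm (\<lambda>w. c w - g N w) k * \<rho> ^ k"
      unfolding coeff_norm_def by (intro tendsto_intros c)
  qed (use diff[OF \<rho>] in blast)
  have "(\<lambda>k. hom_part c k X) sums G X" if X: "X \<in> op_ball" for X
  proof -
    define q where "q = norm (row_op X)"
    define \<rho> where "\<rho> = (1 + q) / 2"
    define t where "t = q / \<rho>"
    have Xc: "X i \<in> clinear_ops" for i using X by (simp add: op_ball_iff)
    have "0 \<le> q" "q < 1" using X by (simp_all add: op_ball_iff q_def)
    then have q: "0 \<le> q" "q < \<rho>" "\<rho> < 1" "0 < \<rho>" by (simp_all add: \<rho>_def)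
    have t: "0 \<le> t" "t < 1" using q by (simp_all add: t_def)
    have "\<forall>\<^sub>F N in sequentially. \<rho> < r N" by (rule order_tendstoD(1)[OF r_lim]) (use q in simp)
    then obtain N1 where N1: "\<And>N. N \<ge> N1 \<Longrightarrow> \<rho> < r N" by (auto simp: eventually_sequentially)
    have bound: "norm (hom_part (\<lambda>w. c w - g N w) k X) \<le> 2 * inverse (real (Suc N)) * t ^ k"
      if "N \<ge> N1" for N k
    proof -
      have "norm (hom_part (\<lambda>w. c w - g N w) k X) \<le> coeff_norm (\<lambda>w. c w - g N w) k * q ^ k"
        unfolding q_def by (rule norm_hom_part_le[OF Xc])
      also have "\<dots> = coeff_norm (\<lambda>w. c w - g N w) k * \<rho> ^ k * t ^ k"
        using q by (simp add: t_def power_divide)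
      also have "\<dots> \<le> 2 * inverse (real (Suc N)) * t ^ k"
        using N1[OF that] q t by (intro mult_right_mono c_diff) auto
      finally show ?thesis .
    qed
    have summ: "summable (\<lambda>k. hom_part (\<lambda>w. c w - g N w) k X)" if "N \<ge> N1" for N
      by (rule summable_comparison_test[OF _ summable_mult[OF summable_geometric, of t "2 * inverse (real (Suc N))"]])
        (use bound[OF that] t in auto)
    have "summable (\<lambda>k. hom_part c k X)"
      using summable_add[OF summ[OF order_refl] sums_summable[OF g[OF X, of N1]]]
      by (simp add: hom_part_diff)
    then obtain Y where Y: "(\<lambda>k. hom_part c k X) sums Y" by (auto simp: summable_def)
    have le: "norm (Y - G X) \<le> (2 / (1 - t) + 1) * inverse (real (Suc N))" if N: "N \<ge> N1" for N
    proof -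
      have "(\<lambda>k. hom_part (\<lambda>w. c w - g N w) k X) sums (Y - p N X)"
        unfolding hom_part_diff by (intro sums_diff Y g X)
      from sums_tail_bound[OF this bound[OF N] t, of 0]
      have "norm (Y - p N X) \<le> 2 / (1 - t) * inverse (real (Suc N))" by simp
      moreover have "norm (G X - p N X) \<le> inverse (real (Suc N))"
        using N1[OF N] q Xc by (intro Gp) (auto simp: op_ball_upto_def q_def[symmetric])
      moreover have "norm (Y - G X) \<le> norm (Y - p N X) + norm (G X - p N X)"
        using norm_triangle_ineq4[of "Y - p N X" "G X - p N X"] by simp
      ultimately show ?thesis by (simp add: algebra_simps)
    qed
    have "(\<lambda>N. (2 / (1 - t) + 1) * inverse (real (Suc N))) \<longlonglongrightarrow> (2 / (1 - t) + 1) * 0"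
      by (intro tendsto_intros LIMSEQ_inverse_real_of_nat)
    then have "norm (Y - G X) \<le> (2 / (1 - t) + 1) * 0"
      by (rule LIMSEQ_le_const) (use le in blast)
    then show ?thesis using Y by simp
  qed
  then show ?thesis unfolding free_holomorphic_iff by blast
qed

section \<open>Composition with the automorphisms\<close>

text \<open>For \<open>\<parallel>l\<parallel> < 1\<close> the Neumann series of \<open>(I - Y(X) l\<^sup>*)\<^sup>-\<^sup>1\<close> converges uniformly on the
  whole ball, even where \<open>Y(X)\<close> has norm \<open>1\<close>.\<close>

lemma poly_approx_Phi:
  fixes Y :: "('h :: chilbert_space, 'n :: finite) op_tuple \<Rightarrow> ('h, 'm :: finite) op_tuple"
  assumes l: "norm l < 1" and Y: "\<And>j. poly_approx (\<lambda>X. Y X j)" and ball: "Y ` op_ball \<subseteq> op_cball"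
  shows "poly_approx (\<lambda>X. Phi l (Y X) j)"
proof -
  have Yc: "Y X i \<in> clinear_ops" and Y1: "norm (row_op (Y X)) \<le> 1" if "X \<in> op_ball" for X i
    using ball that by (auto simp: op_cball_iff image_subset_iff)
  define R where "R X = (\<Sum>i\<in>UNIV. cnj (l $ i) *\<^sub>C Y X i)" for X
  have R: "poly_approx R" unfolding R_def by (intro poly_approx_sum poly_approx_scale Y) simp
  have R_eq: "row_op (Y X) o\<^sub>L adj (scalar_row l) = R X" if "X \<in> op_ball" for X
    unfolding R_def by (rule row_adj_scalar[OF l refl Yc[OF that] Y1[OF that], symmetric])
  have "poly_approx (\<lambda>X. resolvent l (Y X))"
  proof (rule poly_approx_limit)
    fix r \<epsilon> :: real assume r: "r < 1" and \<epsilon>: "\<epsilon> > 0"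
    have "(\<lambda>k. norm l ^ k / (1 - norm l)) \<longlonglongrightarrow> 0 / (1 - norm l)"
      by (intro tendsto_intros LIMSEQ_power_zero) (use l in auto)
    then have "\<forall>\<^sub>F k in sequentially. norm l ^ k / (1 - norm l) < \<epsilon>"
      by (rule order_tendstoD) (use \<epsilon> in simp)
    then obtain k where k: "norm l ^ k / (1 - norm l) < \<epsilon>" by (auto simp: eventually_sequentially)
    have "norm (resolvent l (Y X) - (\<Sum>j<k. op_power j (R X))) \<le> \<epsilon>" if "X \<in> op_ball_upto r" for X
    proof -
      have X: "X \<in> op_ball" using that op_ball_upto_subset[OF r] by blast
      show ?thesis using resolvent_series[OF l refl Yc[OF X] Y1[OF X], of k] k unfolding R_eq[OF X] by simp
    qed
    moreover have "poly_approx (\<lambda>X. \<Sum>j<k. op_power j (R X))"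
      by (intro poly_approx_sum poly_approx_op_power R) simp
    ultimately show "\<exists>H. poly_approx H \<and> (\<forall>X\<in>op_ball_upto r. norm (resolvent l (Y X) - H X) \<le> \<epsilon>)" by blast
  qed
  then have "poly_approx (\<lambda>X. resolvent l (Y X) o\<^sub>L ((l $ j) *\<^sub>C id_blinfun - (sqrt (1 - (norm l)\<^sup>2) *\<^sub>R Y X j
      + (l $ j / complex_of_real (1 + sqrt (1 - (norm l)\<^sup>2))) *\<^sub>C R X)))"
    by (intro poly_approx_mult poly_approx_diff poly_approx_add poly_approx_scale poly_approx_scaleR
        poly_approx_one Y R)
  then show ?thesis
    by (rule poly_approx_cong) (simp add: Phi_entry[OF l refl Yc Y1] R_eq)
qed

lemma Phi_op_cball:
  assumes "norm l < 1" "(X :: ('h :: chilbert_space, 'n :: finite) op_tuple) \<in> op_cball"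
  shows "Phi l X \<in> op_cball"
  using assms clinear_Phi[OF _ refl, of l X] norm_Phi_le_one[OF _ refl, of l X] by (simp add: op_cball_iff)

lemma Phi_op_ball_upto:
  assumes l: "norm l < 1" and r: "r < 1"
  shows "\<exists>\<rho><1. Phi l ` op_ball_upto r \<subseteq> (op_ball_upto \<rho> :: ('h :: chilbert_space, 'n :: finite) op_tuple set)"
proof -
  define r' where "r' = max r 0"
  define s where "s = sqrt (1 - (norm l)\<^sup>2)"
  have r': "0 \<le> r'" "r \<le> r'" "r' < 1" using r by (auto simp: r'_def)
  have "r'\<^sup>2 < 1" using r' by (simp add: power_less_one_iff)
  moreover have "s\<^sup>2 > 0" using defect_pos[OF l s_def] by simp
  ultimately have "sqrt (1 - s\<^sup>2 * (1 - r'\<^sup>2) / 4) < sqrt 1"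
    by (intro real_sqrt_less_mono) simp
  then have lt: "sqrt (1 - s\<^sup>2 * (1 - r'\<^sup>2) / 4) < 1" by (simp only: real_sqrt_one)
  have "Phi l ` op_ball_upto r \<subseteq> (op_ball_upto (sqrt (1 - s\<^sup>2 * (1 - r'\<^sup>2) / 4)) :: ('h, 'n) op_tuple set)"
  proof (rule image_subsetI)
    fix X :: "('h, 'n) op_tuple" assume X: "X \<in> op_ball_upto r"
    then have Xc: "\<And>i. X i \<in> clinear_ops" and Xr: "norm (row_op X) \<le> r'" and X1: "norm (row_op X) \<le> 1"
      using r' by (auto simp: op_ball_upto_def)
    show "Phi l X \<in> op_ball_upto (sqrt (1 - s\<^sup>2 * (1 - r'\<^sup>2) / 4))"
      using clinear_Phi[OF l s_def Xc X1] norm_Phi_le[OF l s_def Xc X1 Xr] r' by (simp add: op_ball_upto_def)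
  qed
  then show ?thesis using lt by blast
qed

lemma Phi_op_ball:
  assumes l: "norm l < 1" and X: "(X :: ('h :: chilbert_space, 'n :: finite) op_tuple) \<in> op_ball"
  shows "Phi l X \<in> op_ball"
proof -
  have "norm (row_op X) < 1" "X \<in> op_ball_upto (norm (row_op X))"
    using X by (auto simp: op_ball_iff op_ball_upto_def)
  then obtain \<rho> where "\<rho> < 1" "Phi l X \<in> op_ball_upto \<rho>" using Phi_op_ball_upto[OF l] by blast
  then show ?thesis using op_ball_upto_subset by blast
qed

section \<open>The Schwarz lemma\<close>

text \<open>\<open>(I - Z)\<^sup>2 = I - T\<close> means that \<open>Z = (T + Z\<^sup>2) / 2\<close>, a fixed point problem which Banach's
  theorem solves among the self-adjoint operators of small norm.\<close>

lemma exists_sqrt_id_minus: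
  fixes T :: "'k :: chilbert_space \<Rightarrow>\<^sub>L 'k"
  assumes T: "T \<in> clinear_ops" and sa: "\<And>x y. cinner (blinfun_apply T x) y = cinner x (blinfun_apply T y)"
    and T1: "norm T < 1"
  obtains D where "D \<in> clinear_ops" "\<And>x y. cinner (blinfun_apply D x) y = cinner x (blinfun_apply D y)"
    "D o\<^sub>L D = id_blinfun - T"
proof -
  \<comment> \<open>the solution of the scalar equation \<open>\<rho> = (norm T + \<rho>\<^sup>2) / 2\<close>, so that the ball of radius \<open>\<rho>\<close>
    is invariant and \<open>\<rho> < 1\<close> is a Lipschitz constant on it\<close>
  define \<rho> where "\<rho> = 1 - sqrt (1 - norm T)"
  have \<rho>: "0 \<le> \<rho>" "\<rho> < 1" using T1 by (auto simp: \<rho>_def)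
  have \<rho>_fix: "norm T + \<rho> * \<rho> = 2 * \<rho>"
  proof -
    have "sqrt (1 - norm T) * sqrt (1 - norm T) = 1 - norm T" using T1 by simp
    then show ?thesis by (simp add: \<rho>_def algebra_simps)
  qed
  define S where "S = {Z :: 'k \<Rightarrow>\<^sub>L 'k. (\<forall>c x. blinfun_apply Z (c *\<^sub>C x) = c *\<^sub>C blinfun_apply Z x) \<and>
    (\<forall>x y. cinner (blinfun_apply Z x) y = cinner x (blinfun_apply Z y)) \<and> norm Z \<le> \<rho>}"
  define f where "f Z = (1 / 2) *\<^sub>R (T + (Z o\<^sub>L Z))" for Z
  have app: "continuous_on UNIV (\<lambda>Z. blinfun_apply Z (x :: 'k) :: 'k)" for x
    by (rule linear_continuous_on[OF blinfun.bounded_linear_left])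
  have "closed S"
    unfolding S_def
    by (intro closed_Collect_conj closed_Collect_all closed_Collect_eq closed_Collect_le
        continuous_on_const continuous_on_norm continuous_on_id app cinner.continuous_on
        bounded_linear.continuous_on[OF bounded_linear_scaleC])
  then have "complete S" by (simp add: complete_eq_closed)
  moreover have "S \<noteq> {}" using \<rho> by (auto simp: S_def intro!: exI[of _ 0])
  moreover have "f ` S \<subseteq> S"
  proof (rule image_subsetI)
    fix Z assume Z: "Z \<in> S"
    have "norm (T + (Z o\<^sub>L Z)) \<le> norm T + \<rho> * \<rho>"
      using Z \<rho> by (intro order_trans[OF norm_triangle_ineq] add_left_mono order_trans[OF norm_blinfun_compose] mult_mono)
        (auto simp: S_def)
    then have "norm (f Z) \<le> \<rho>" using \<rho>_fix by (simp add: f_def)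
    then show "f Z \<in> S"
      using Z by (auto simp: S_def f_def blinfun.scaleR_left blinfun.add_left clinear_opsD[OF T]
          scaleC_scaleR scaleC_add_right cinner_linear sa)
  qed
  moreover have "\<forall>Z\<in>S. \<forall>W\<in>S. dist (f Z) (f W) \<le> \<rho> * dist Z W"
  proof (intro ballI)
    fix Z W assume ZW: "Z \<in> S" "W \<in> S"
    have "f Z - f W = (1 / 2) *\<^sub>R ((Z o\<^sub>L (Z - W)) + ((Z - W) o\<^sub>L W))"
      by (rule blinfun_eqI)
        (simp add: f_def blinfun.scaleR_left blinfun.add_left blinfun.diff_left blinfun.diff_right
          scaleR_diff_right[symmetric])
    then have eq: "dist (f Z) (f W) = norm ((Z o\<^sub>L (Z - W)) + ((Z - W) o\<^sub>L W)) / 2"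
      by (simp add: dist_norm)
    have "norm (Z o\<^sub>L (Z - W)) \<le> \<rho> * norm (Z - W)"
      using ZW \<rho> by (intro order_trans[OF norm_blinfun_compose] mult_right_mono) (auto simp: S_def)
    moreover have "norm ((Z - W) o\<^sub>L W) \<le> norm (Z - W) * \<rho>"
      using ZW \<rho> by (intro order_trans[OF norm_blinfun_compose] mult_left_mono) (auto simp: S_def)
    ultimately have "norm ((Z o\<^sub>L (Z - W)) + ((Z - W) o\<^sub>L W)) \<le> \<rho> * norm (Z - W) + norm (Z - W) * \<rho>"
      by (rule norm_triangle_mono)
    then show "dist (f Z) (f W) \<le> \<rho> * dist Z W" unfolding eq by (simp add: dist_norm mult.commute)
  qed
  ultimately obtain Z where Z: "Z \<in> S" "f Z = Z"
    using Banach_fix[of S \<rho> f] \<rho> by blast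
  define D where "D = id_blinfun - Z"
  have Zc: "Z \<in> clinear_ops" using Z by (simp add: S_def clinear_ops_def)
  have ZZ: "blinfun_apply Z (blinfun_apply Z x) = 2 *\<^sub>R blinfun_apply Z x - blinfun_apply T x" for x
  proof -
    have "2 *\<^sub>R blinfun_apply Z x = 2 *\<^sub>R blinfun_apply (f Z) x" by (simp add: Z)
    also have "\<dots> = blinfun_apply T x + blinfun_apply Z (blinfun_apply Z x)"
      by (simp add: f_def blinfun.scaleR_left blinfun.add_left)
    finally show ?thesis by simp
  qed
  show thesis
  proof (rule that[of D])
    show "D \<in> clinear_ops" unfolding D_def by (intro clinear_ops_intros Zc)
    show "cinner (blinfun_apply D x) y = cinner x (blinfun_apply D y)" for x y
      using Z(1) by (simp add: D_def S_def blinfun.diff_left cinner_linear)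
    show "D o\<^sub>L D = id_blinfun - T"
      by (rule blinfun_eqI) (simp add: D_def blinfun.diff_left blinfun.diff_right ZZ scaleR_2)
  qed
qed

text \<open>A single step of an isometric dilation: the column with entries \<open>(I - X\<^sup>*X)\<^sup>1\<^sup>/\<^sup>2\<close> and \<open>X\<close> is an
  isometry from \<open>H\<^sup>n\<close> to \<open>H\<^sup>n \<oplus> H\<close>, and a row isometry with \<open>n + 1\<close> entries carries that space back
  into \<open>H\<close>; \<open>T\<close> is its restriction to the last summand.\<close>

lemma exists_row_dilation:
  fixes X :: "('h :: chilbert_space, 'n :: finite) op_tuple"
  assumes sep: "separable_space (euclidean :: 'h :: chilbert_space topology)"
    and inf: "cinfinite_dimensional TYPE('h :: chilbert_space)"
    and X: "X \<in> op_ball"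
  obtains V :: "('h ^ 'n) \<Rightarrow>\<^sub>L 'h" and T :: "'h \<Rightarrow>\<^sub>L 'h"
  where "V \<in> clinear_ops" "T \<in> clinear_ops" "\<And>v. norm (blinfun_apply V v) = norm v"
    "\<And>x. norm (blinfun_apply T x) = norm x" "adj T o\<^sub>L V = row_op X"
proof -
  have Xc: "row_op X \<in> clinear_ops" and X1: "norm (row_op X) < 1"
    using X by (auto simp: op_ball_iff intro: clinear_ops_row_op)
  obtain W :: "('h, 'n option) op_tuple" where W: "\<And>i. W i \<in> clinear_ops"
    "\<And>v. norm (blinfun_apply (row_op W) v) = norm v"
    using exists_row_isometry[OF sep inf] by blast
  note Wc = row_isometry_cinner[OF W]
  have norm_W: "norm (blinfun_apply (W i) x) = norm x" for i x
  proof -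
    have "(norm (blinfun_apply (W i) x))\<^sup>2 = (norm x)\<^sup>2" by (simp add: Re_cinner_self[symmetric] Wc)
    then show ?thesis by simp
  qed
  have "norm (adj (row_op X) o\<^sub>L row_op X) \<le> norm (row_op X) * norm (row_op X)"
    using norm_blinfun_compose[of "adj (row_op X)" "row_op X"] by (simp add: norm_adj Xc)
  also have "\<dots> < 1" using mult_strict_mono[OF X1 X1] by simp
  finally have nXX: "norm (adj (row_op X) o\<^sub>L row_op X) < 1" .
  obtain D where D: "D \<in> clinear_ops" "\<And>x y. cinner (blinfun_apply D x) y = cinner x (blinfun_apply D y)"
    "D o\<^sub>L D = id_blinfun - (adj (row_op X) o\<^sub>L row_op X)"
    by (rule exists_sqrt_id_minus[of "adj (row_op X) o\<^sub>L row_op X"])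
      (simp_all add: clinear_ops_compose clinear_ops_adj Xc nXX cinner_adj_left[OF Xc]
        cinner_adj_right[OF Xc, symmetric])
  define V where "V = (row_op (\<lambda>i. W (Some i)) o\<^sub>L D) + (W None o\<^sub>L row_op X)"
  have V: "blinfun_apply V v = (\<Sum>i\<in>UNIV. blinfun_apply (W (Some i)) (blinfun_apply D v $ i))
      + blinfun_apply (W None) (blinfun_apply (row_op X) v)" for v
    by (simp add: V_def blinfun.add_left row_op.rep_eq)
  show thesis
  proof (rule that[of V "W None"])
    show "V \<in> clinear_ops"
      unfolding V_def by (intro clinear_ops_add clinear_ops_compose clinear_ops_row_op W D Xc)
    show "W None \<in> clinear_ops" by (rule W)
    show "norm (blinfun_apply (W None) x) = norm x" for x by (rule norm_W)
    show "norm (blinfun_apply V v) = norm v" for v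
    proof -
      define A where "A = (\<Sum>i\<in>UNIV. blinfun_apply (W (Some i)) (blinfun_apply D v $ i))"
      define B where "B = blinfun_apply (W None) (blinfun_apply (row_op X) v)"
      have A: "(norm A)\<^sup>2 = (norm (blinfun_apply D v))\<^sup>2"
        unfolding A_def by (subst norm_sum_orthogonal) (auto simp: Wc norm_W norm_vec_sq)
      have B: "norm B = norm (blinfun_apply (row_op X) v)" by (simp add: B_def norm_W)
      have AB: "cinner A B = 0" by (simp add: A_def B_def cinner.sum_left Wc)
      have "(norm (blinfun_apply D v))\<^sup>2 = Re (cinner v (blinfun_apply (D o\<^sub>L D) v))"
        by (simp add: Re_cinner_self[symmetric] D(2))
      also have "\<dots> = (norm v)\<^sup>2 - (norm (blinfun_apply (row_op X) v))\<^sup>2"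
        unfolding D(3) by (simp add: blinfun.diff_left cinner_linear cinner_adj_right[OF Xc, symmetric] cinner_self)
      finally have "(norm (blinfun_apply V v))\<^sup>2 = (norm v)\<^sup>2"
        unfolding V A_def[symmetric] B_def[symmetric] by (simp add: norm_add_sq A B AB)
      then show ?thesis by simp
    qed
    show "adj (W None) o\<^sub>L V = row_op X"
    proof (rule blinfun_eqI, rule cinner_ext)
      fix v z
      have "cinner z (blinfun_apply (adj (W None) o\<^sub>L V) v) = cinner (blinfun_apply (W None) z) (blinfun_apply V v)"
        by (simp add: cinner_adj_right W)
      also have "\<dots> = cinner z (blinfun_apply (row_op X) v)"
        unfolding V by (simp add: cinner_add_right cinner.sum_right Wc)
      finally show "cinner z (blinfun_apply (adj (W None) o\<^sub>L V) v) = cinner z (blinfun_apply (row_op X) v)" .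
    qed
  qed
qed

lift_definition proj :: "'n :: finite \<Rightarrow> ('h :: complex_normed_vector ^ 'n) \<Rightarrow>\<^sub>L 'h" is "\<lambda>i v. v $ i"
  by (rule bounded_linear_vec_nth)

definition mat_op :: "('n :: finite \<Rightarrow> 'm :: finite \<Rightarrow> 'h :: complex_normed_vector \<Rightarrow>\<^sub>L 'h) \<Rightarrow> ('h ^ 'm) \<Rightarrow>\<^sub>L ('h ^ 'n)" where
  "mat_op M = (\<Sum>i\<in>UNIV. \<Sum>j\<in>UNIV. embed i o\<^sub>L (M i j o\<^sub>L proj j))"

lemma mat_op_nth: "blinfun_apply (mat_op M) v $ i = (\<Sum>j\<in>UNIV. blinfun_apply (M i j) (v $ j))"
  unfolding mat_op_def
  by (simp add: blinfun.sum_left proj.rep_eq embed_nth) (subst sum.swap, simp)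

lemma mat_op_sums:
  assumes "\<And>i j. f i j sums S i j"
  shows "(\<lambda>k. mat_op (\<lambda>i j. f i j k)) sums mat_op S"
  unfolding mat_op_def
  by (intro sums_sum bounded_linear.sums[OF bounded_bilinear.bounded_linear_right[OF bounded_bilinear_blinfun_compose]]
      bounded_linear.sums[OF bounded_bilinear.bounded_linear_left[OF bounded_bilinear_blinfun_compose]] assms)

text \<open>The coefficients of \<open>\<Gamma>\<close> are those of \<open>G\<close> at the words with first letter \<open>i\<close>.  For the norm
  bound at \<open>X\<close>, the function \<open>G\<close> is evaluated at the tuple \<open>Y\<^sub>i = r V e\<^sub>i S\<^sup>*\<close> built from the
  dilation \<open>S\<^sup>*V = X / r\<close>: there \<open>S\<^sup>* Y\<^sub>i = X\<^sub>i S\<^sup>*\<close>, hence \<open>S\<^sup>* \<Gamma>(Y) S = \<Gamma>(X)\<close> entrywise, and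
  \<open>G(Y) S = r V \<Gamma>(X)\<close> with \<open>V\<close> isometric.\<close>

lemma schwarz_lemma:
  fixes G :: "('h :: chilbert_space, 'n :: finite) op_tuple \<Rightarrow> ('h, 'm :: finite) op_tuple"
  assumes sep: "separable_space (euclidean :: 'h :: chilbert_space topology)"
    and inf: "cinfinite_dimensional TYPE('h :: chilbert_space)"
    and G: "free_holomorphic_tuple G" and ball: "G ` op_ball \<subseteq> op_cball" and G0: "G (\<lambda>_. 0) = (\<lambda>_. 0)"
  obtains \<Gamma> :: "('h, 'n) op_tuple \<Rightarrow> ('h ^ 'm) \<Rightarrow>\<^sub>L ('h ^ 'n)"
  where "free_holomorphic_mat \<Gamma>" "\<And>X. X \<in> op_ball \<Longrightarrow> norm (\<Gamma> X) \<le> 1"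
    "\<And>X. X \<in> op_ball \<Longrightarrow> row_op (G X) = row_op X o\<^sub>L \<Gamma> X"
proof -
  obtain T :: "('h, 'n) op_tuple" where T: "\<And>i. T i \<in> clinear_ops" "norm (row_op T) \<le> 1"
    and test: "\<And>g r Y k. 0 \<le> r \<Longrightarrow> (\<lambda>k. hom_part g k (\<lambda>i. r *\<^sub>R T i)) sums Y \<Longrightarrow> coeff_norm g k * r ^ k \<le> norm Y"
    using exists_coeff_test_tuple[OF sep inf] by blast
  have "\<forall>j. \<exists>g. \<forall>X\<in>op_ball. (\<lambda>k. hom_part g k X) sums G X j"
    using G unfolding free_holomorphic_tuple_def free_holomorphic_iff by blast
  then obtain g where g: "\<And>j X. X \<in> op_ball \<Longrightarrow> (\<lambda>k. hom_part (g j) k X) sums G X j" by metis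
  have zero_ball: "(\<lambda>_. 0 :: 'h \<Rightarrow>\<^sub>L 'h) \<in> (op_ball :: ('h, 'n) op_tuple set)"
  proof -
    have "row_op (\<lambda>_. 0) = (0 :: ('h ^ 'n) \<Rightarrow>\<^sub>L 'h)" by (rule blinfun_eqI) (simp add: row_op.rep_eq)
    then show ?thesis by (simp add: op_ball_iff)
  qed
  have g_Nil: "g j [] = 0" for j
  proof -
    \<comment> \<open>radius \<open>0\<close> isolates the constant coefficient\<close>
    have "coeff_norm (g j) 0 * 0 ^ 0 \<le> norm (0 :: 'h \<Rightarrow>\<^sub>L 'h)"
      by (rule test) (use g[OF zero_ball, of j] in \<open>simp_all add: G0\<close>)
    then show ?thesis using cmod_le_coeff_norm[of "g j" "[]"] order_trans by fastforce
  qed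
  define \<gamma> where "\<gamma> i j k X = hom_part (\<lambda>w. g j (i # w)) k X" for i j k and X :: "('h, 'n) op_tuple"
  define \<Gamma>e where "\<Gamma>e i j X = (\<Sum>k. \<gamma> i j k X)" for i j X
  have \<gamma>: "(\<lambda>k. \<gamma> i j k X) sums \<Gamma>e i j X" if X: "X \<in> op_ball" for i j X
  proof -
    have Xc: "X i \<in> clinear_ops" for i using X by (simp add: op_ball_iff)
    define q where "q = norm (row_op X)"
    define \<rho> where "\<rho> = (1 + q) / 2"
    have "0 \<le> q" "q < 1" using X by (simp_all add: op_ball_iff q_def)
    then have q: "0 \<le> q" "q < \<rho>" "\<rho> < 1" "0 < \<rho>" by (simp_all add: \<rho>_def)
    have "\<rho> * norm (row_op T) < 1"
      using mult_left_mono[OF T(2), of \<rho>] q(3,4) by linarith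
    then have "(\<lambda>i. \<rho> *\<^sub>R T i) \<in> op_ball"
      using T q by (simp add: op_ball_iff clinear_ops_scaleR row_op_scaleR)
    note K = test[OF less_imp_le[OF q(4)] g[OF this, of j]]
    define K where "K = norm (G (\<lambda>i. \<rho> *\<^sub>R T i) j)"
    have "norm (\<gamma> i j k X) \<le> K / \<rho> * (q / \<rho>) ^ k" for k
    proof -
      have "norm (\<gamma> i j k X) \<le> coeff_norm (\<lambda>w. g j (i # w)) k * q ^ k"
        unfolding \<gamma>_def q_def by (rule norm_hom_part_le[OF Xc])
      also have "\<dots> \<le> coeff_norm (g j) (Suc k) * q ^ k"
        using q by (intro mult_right_mono coeff_norm_Cons_le) auto
      also have "\<dots> = coeff_norm (g j) (Suc k) * \<rho> ^ Suc k * (1 / \<rho> * (q / \<rho>) ^ k)"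
        using q by (simp add: power_divide)
      also have "\<dots> \<le> K * (1 / \<rho> * (q / \<rho>) ^ k)"
        unfolding K_def using q by (intro mult_right_mono K) auto
      finally show ?thesis by simp
    qed
    moreover have "summable (\<lambda>k. K / \<rho> * (q / \<rho>) ^ k)"
      using q by (intro summable_mult summable_geometric) simp
    ultimately have "summable (\<lambda>k. \<gamma> i j k X)" by (rule summable_comparison_test'[rotated])
    then show ?thesis unfolding \<Gamma>e_def by (rule summable_sums)
  qed
  have factor: "G X j = (\<Sum>i\<in>UNIV. X i o\<^sub>L \<Gamma>e i j X)" if X: "X \<in> op_ball" for X j
  proof -
    have Xc: "X i \<in> clinear_ops" for i using X by (simp add: op_ball_iff)
    have "(\<lambda>k. \<Sum>i\<in>UNIV. X i o\<^sub>L \<gamma> i j k X) sums (\<Sum>i\<in>UNIV. X i o\<^sub>L \<Gamma>e i j X)"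
      by (intro sums_sum bounded_linear.sums[OF bounded_bilinear.bounded_linear_right[OF bounded_bilinear_blinfun_compose]] \<gamma> X)
    then have "(\<lambda>k. hom_part (g j) (Suc k) X) sums (\<Sum>i\<in>UNIV. X i o\<^sub>L \<Gamma>e i j X)"
      by (simp add: \<gamma>_def hom_part_Suc Xc)
    then have "(\<lambda>k. hom_part (g j) k X) sums ((\<Sum>i\<in>UNIV. X i o\<^sub>L \<Gamma>e i j X) + hom_part (g j) 0 X)"
      by (rule sums_Suc)
    then show ?thesis using sums_unique2[OF g[OF X, of j]] by (simp add: hom_part_0 g_Nil)
  qed
  define \<Gamma> where "\<Gamma> X = mat_op (\<lambda>i j. \<Gamma>e i j X)" for X
  have "free_holomorphic_mat \<Gamma>"
    unfolding free_holomorphic_mat_def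
  proof (intro exI ballI)
    fix X :: "('h, 'n) op_tuple" assume X: "X \<in> op_ball"
    have "(\<lambda>k. mat_op (\<lambda>i j. \<gamma> i j k X)) sums \<Gamma> X"
      unfolding \<Gamma>_def by (rule mat_op_sums[OF \<gamma>[OF X]])
    moreover have "mat_op (\<lambda>i j. \<gamma> i j k X) = (\<Sum>w | length w = k. tensor_mat (word_op X w) (\<chi> i j. g j (i # w)))" for k
    proof (rule blinfun_eqI)
      fix v :: "'h ^ 'm"
      show "blinfun_apply (mat_op (\<lambda>i j. \<gamma> i j k X)) v
        = blinfun_apply (\<Sum>w | length w = k. tensor_mat (word_op X w) (\<chi> i j. g j (i # w))) v"
        by (simp add: vec_eq_iff mat_op_nth \<gamma>_def hom_part_def blinfun.sum_left scaleC_blinfun.rep_eq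
            tensor_mat.rep_eq) (intro allI sum.swap)
    qed
    ultimately show "(\<lambda>k. \<Sum>w | length w = k. tensor_mat (word_op X w) ((\<lambda>w. \<chi> i j. g j (i # w)) w)) sums \<Gamma> X"
      by simp
  qed
  moreover have "row_op (G X) = row_op X o\<^sub>L \<Gamma> X" if X: "X \<in> op_ball" for X
  proof (rule blinfun_eqI)
    fix v :: "'h ^ 'm"
    show "blinfun_apply (row_op (G X)) v = blinfun_apply (row_op X o\<^sub>L \<Gamma> X) v"
      by (simp add: row_op.rep_eq factor[OF X] \<Gamma>_def mat_op_nth blinfun.sum_left blinfun.sum_right)
        (rule sum.swap)
  qed
  moreover have "norm (\<Gamma> X) \<le> 1" if X: "X \<in> op_ball" for X
  proof (rule field_le_mult_one_interval)
    fix z :: real assume z: "0 < z" "z < 1"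
    \<comment> \<open>\<open>r\<close> lies between \<open>\<parallel>X\<parallel>\<close> and \<open>1\<close>, so that \<open>X / r\<close> and a tuple of norm at most \<open>r\<close> are in
      the ball; the bound \<open>1 / r\<close> obtained below tends to \<open>1\<close>\<close>
    define q where "q = norm (row_op X)"
    define r where "r = (1 + max z q) / 2"
    have "q < 1" and Xc: "\<And>i. X i \<in> clinear_ops" using X by (auto simp: q_def op_ball_iff)
    then have r: "z < r" "q < r" "r < 1" "0 < r" using z by (auto simp: r_def)
    define X' where "X' = (\<lambda>i. (1 / r) *\<^sub>R X i)"
    have X': "X' \<in> op_ball"
      using r Xc by (simp add: op_ball_iff X'_def clinear_ops_scaleR row_op_scaleR q_def[symmetric])
    obtain V :: "('h ^ 'n) \<Rightarrow>\<^sub>L 'h" and S :: "'h \<Rightarrow>\<^sub>L 'h"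
      where V: "V \<in> clinear_ops" "\<And>v. norm (blinfun_apply V v) = norm v"
        and S: "S \<in> clinear_ops" "\<And>x. norm (blinfun_apply S x) = norm x" and SV: "adj S o\<^sub>L V = row_op X'"
      using exists_row_dilation[OF sep inf X'] by metis
    have SS: "blinfun_apply (adj S) (blinfun_apply S x) = x" for x
      by (rule cinner_ext) (simp add: cinner_adj_right[OF S(1), symmetric] isometry_cinner[OF S])
    have norm_S': "norm (blinfun_apply (adj S) x) \<le> norm x" for x
    proof -
      have "norm S \<le> 1" by (rule norm_blinfun_bound) (simp_all add: S(2))
      then have "norm (adj S) * norm x \<le> 1 * norm x"
        by (intro mult_right_mono) (simp_all add: norm_adj S(1))
      then show ?thesis using norm_blinfun[of "adj S" x] by simp
    qed
    define Y where "Y = (\<lambda>i. r *\<^sub>R (V o\<^sub>L embed i o\<^sub>L adj S))"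
    have Y_apply: "blinfun_apply (Y i) x = r *\<^sub>R blinfun_apply V (blinfun_apply (embed i) (blinfun_apply (adj S) x))" for i x
      by (simp add: Y_def blinfun.scaleR_left)
    have Y: "Y \<in> op_ball"
    proof -
      have "norm (row_op Y) \<le> r"
      proof (rule norm_blinfun_bound)
        fix v :: "'h ^ 'n"
        have "(\<Sum>i\<in>UNIV. blinfun_apply (embed i) (blinfun_apply (adj S) (v $ i))) = (\<chi> i. blinfun_apply (adj S) (v $ i))"
          by (simp add: vec_eq_iff embed_nth)
        then have "blinfun_apply (row_op Y) v = r *\<^sub>R blinfun_apply V (\<chi> i. blinfun_apply (adj S) (v $ i))"
          by (simp add: row_op.rep_eq Y_apply scaleR_sum_right[symmetric] blinfun.sum_right[symmetric])
        moreover have "norm (\<chi> i. blinfun_apply (adj S) (v $ i)) \<le> norm v"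
          unfolding norm_vec_def by (intro L2_set_mono) (simp_all add: norm_S')
        ultimately show "norm (blinfun_apply (row_op Y) v) \<le> r * norm v" using r V by simp
      qed (use r in simp)
      then show ?thesis
        using r V S by (simp add: op_ball_iff Y_def clinear_ops_scaleR clinear_ops_compose clinear_ops_adj)
    qed
    have compr: "blinfun_apply (adj S) (blinfun_apply (Y i) x) = blinfun_apply (X i) (blinfun_apply (adj S) x)" for i x
    proof -
      have "blinfun_apply (adj S) (blinfun_apply V v) = blinfun_apply (row_op X') v" for v
        using arg_cong[OF SV, of "\<lambda>T. blinfun_apply T v"] by simp
      moreover have "blinfun_apply (row_op X') (blinfun_apply (embed i) y) = blinfun_apply (X' i) y" for y
        using arg_cong[OF row_op_embed[of X' i], of "\<lambda>T. blinfun_apply T y"] by simp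
      ultimately show ?thesis using r by (simp add: Y_apply blinfun.scaleR_right X'_def blinfun.scaleR_left)
    qed
    have word: "blinfun_apply (adj S) (blinfun_apply (word_op Y w) (blinfun_apply S x)) = blinfun_apply (word_op X w) x" for w x
      by (induction w) (simp_all add: SS compr)
    have "blinfun_apply (adj S) (blinfun_apply (\<gamma> i j k Y) (blinfun_apply S x)) = blinfun_apply (\<gamma> i j k X) x" for i j k x
      by (simp add: \<gamma>_def hom_part_def blinfun.sum_left blinfun.sum_right scaleC_blinfun.rep_eq
          clinear_opsD[OF clinear_ops_adj[OF S(1)]] word)
    moreover have "(\<lambda>k. blinfun_apply (adj S) (blinfun_apply (\<gamma> i j k Y) (blinfun_apply S x)))
        sums blinfun_apply (adj S) (blinfun_apply (\<Gamma>e i j Y) (blinfun_apply S x))" for i j x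
      by (intro bounded_linear.sums[OF blinfun.bounded_linear_right]
          bounded_linear.sums[OF blinfun.bounded_linear_left] \<gamma> Y)
    moreover have "(\<lambda>k. blinfun_apply (\<gamma> i j k X) x) sums blinfun_apply (\<Gamma>e i j X) x" for i j x
      by (intro bounded_linear.sums[OF blinfun.bounded_linear_left] \<gamma> X)
    ultimately have \<Gamma>e: "blinfun_apply (adj S) (blinfun_apply (\<Gamma>e i j Y) (blinfun_apply S x)) = blinfun_apply (\<Gamma>e i j X) x" for i j x
      using sums_unique2 by (metis (no_types, lifting) sums_cong)
    have "norm (\<Gamma> X) \<le> 1 / r"
    proof (rule norm_blinfun_bound)
      fix u :: "'h ^ 'm"
      define Su where "Su = (\<chi> j. blinfun_apply S (u $ j))"
      have norm_Su: "norm Su = norm u" by (simp add: Su_def norm_vec_def S(2))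
      have "blinfun_apply (row_op (G Y)) Su
          = (\<Sum>j\<in>UNIV. \<Sum>i\<in>UNIV. r *\<^sub>R blinfun_apply V (blinfun_apply (embed i) (blinfun_apply (\<Gamma>e i j X) (u $ j))))"
        by (simp add: row_op.rep_eq Su_def factor[OF Y] blinfun.sum_left Y_apply \<Gamma>e)
      also have "\<dots> = r *\<^sub>R blinfun_apply V (\<Sum>j\<in>UNIV. \<Sum>i\<in>UNIV. blinfun_apply (embed i) (blinfun_apply (\<Gamma>e i j X) (u $ j)))"
        by (simp add: scaleR_sum_right blinfun.sum_right)
      also have "(\<Sum>j\<in>UNIV. \<Sum>i\<in>UNIV. blinfun_apply (embed i) (blinfun_apply (\<Gamma>e i j X) (u $ j))) = blinfun_apply (\<Gamma> X) u"
        by (simp add: vec_eq_iff \<Gamma>_def mat_op_nth embed_nth)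
      finally have "r * norm (blinfun_apply (\<Gamma> X) u) = norm (blinfun_apply (row_op (G Y)) Su)"
        using r V by simp
      also have "\<dots> \<le> norm (row_op (G Y)) * norm Su" by (rule norm_blinfun)
      also have "\<dots> \<le> 1 * norm u"
        unfolding norm_Su using ball Y by (intro mult_right_mono) (auto simp: op_cball_iff image_subset_iff)
      finally show "norm (blinfun_apply (\<Gamma> X) u) \<le> 1 / r * norm u"
        using r by (simp add: field_simps)
    qed (use r in simp)
    then have "r * norm (\<Gamma> X) \<le> 1" using r by (simp add: field_simps)
    moreover have "z * norm (\<Gamma> X) \<le> r * norm (\<Gamma> X)" using r by (intro mult_right_mono) auto
    ultimately show "z * norm (\<Gamma> X) \<le> 1" by linarith
  qed
  ultimately show thesis using that by blast
qed

section \<open>The Schwarz--Pick theorem\<close>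

lemma word_op_scalar: "\<exists>c. word_op (scalar_tuple a :: ('h :: complex_normed_vector, 'n :: finite) op_tuple) w = c *\<^sub>C id_blinfun"
proof (induction w)
  case Nil
  show ?case by (rule exI[of _ 1]) simp
next
  case (Cons i w)
  then obtain c where "word_op (scalar_tuple a :: ('h, 'n) op_tuple) w = c *\<^sub>C id_blinfun" by blast
  then show ?case
    by (intro exI[of _ "a $ i * c"]) (simp add: scalar_tuple_def scaleC_compose_left scaleC_scaleC)
qed

text \<open>The words are scalars at a scalar tuple.  The unit vector \<open>u\<close> turns the convergence of
  scalar operators into that of the scalars.\<close>

lemma free_holomorphic_scalar:
  fixes u :: "'h :: chilbert_space" and a :: "complex ^ 'n :: finite"
  assumes f: "free_holomorphic (f :: ('h, 'n) op_tuple \<Rightarrow> _)" and a: "scalar_tuple a \<in> (op_ball :: ('h, 'n) op_tuple set)"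
    and u: "norm u = 1"
  shows "\<exists>z. f (scalar_tuple a) = z *\<^sub>C id_blinfun"
proof -
  obtain g where g: "\<And>X. X \<in> op_ball \<Longrightarrow> (\<lambda>k. hom_part g k X) sums f X"
    using f unfolding free_holomorphic_iff by blast
  obtain c where c: "\<And>w. word_op (scalar_tuple a :: ('h, 'n) op_tuple) w = c w *\<^sub>C id_blinfun"
    using word_op_scalar by metis
  define s where "s k = (\<Sum>w | length w = k. g w * c w)" for k
  have hom: "hom_part g k (scalar_tuple a :: ('h, 'n) op_tuple) = s k *\<^sub>C id_blinfun" for k
    by (simp add: hom_part_def s_def c scaleC_scaleC scaleC_sum_left)
  have uu: "cinner u u = 1" using u by (simp add: cinner_self)
  have sums: "(\<lambda>k. s k *\<^sub>C (id_blinfun :: 'h \<Rightarrow>\<^sub>L 'h)) sums f (scalar_tuple a)"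
    using g[OF a] unfolding hom .
  have "(\<lambda>k. cinner (blinfun_apply (s k *\<^sub>C id_blinfun) u) u) sums cinner (blinfun_apply (f (scalar_tuple a)) u) u"
    by (intro bounded_linear.sums[OF cinner.bounded_linear_left]
        bounded_linear.sums[OF blinfun.bounded_linear_left] sums)
  then have "s sums cinner (blinfun_apply (f (scalar_tuple a)) u) u" (is "_ sums ?z")
    by (simp add: scaleC_blinfun.rep_eq cinner_linear uu)
  moreover have "bounded_linear (\<lambda>c. c *\<^sub>C (id_blinfun :: 'h \<Rightarrow>\<^sub>L 'h))"
    by (rule bounded_linear_intro[where K = "norm (id_blinfun :: 'h \<Rightarrow>\<^sub>L 'h)"])
      (simp_all add: scaleC_add_left norm_scaleC scaleR_conv_of_real scaleC_scaleC[symmetric] scaleC_of_real)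
  ultimately have "(\<lambda>k. s k *\<^sub>C (id_blinfun :: 'h \<Rightarrow>\<^sub>L 'h)) sums (?z *\<^sub>C id_blinfun)"
    by (rule bounded_linear.sums[rotated])
  then show ?thesis using sums_unique2[OF sums] by blast
qed

lemma tuple_scalars_scalar_tuple:
  fixes u :: "'h :: chilbert_space"
  assumes u: "norm u = 1"
  shows "tuple_scalars (scalar_tuple b :: ('h, 'n :: finite) op_tuple) = b"
  unfolding tuple_scalars_def
proof (rule the_equality)
  fix c assume c: "(scalar_tuple c :: ('h, 'n) op_tuple) = scalar_tuple b"
  have uu: "cinner u u = 1" using u by (simp add: cinner_self)
  have "c $ i = b $ i" for i
  proof -
    have "cinner (blinfun_apply (scalar_tuple c i) u) u = cinner (blinfun_apply (scalar_tuple b i) u) u"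
      by (simp add: c)
    then show ?thesis by (simp add: scalar_tuple_def scaleC_blinfun.rep_eq cinner_linear uu)
  qed
  then show "c = b" by (simp add: vec_eq_iff)
qed simp

text \<open>The claim is \<open>\<parallel>P\<^sup>*x\<parallel> \<le> \<parallel>Q\<^sup>*x\<parallel>\<close>, which follows from
  \<open>\<parallel>P\<^sup>*x\<parallel>\<^sup>2 = \<langle>P P\<^sup>*x, x\<rangle> = \<langle>\<Gamma> P\<^sup>*x, Q\<^sup>*x\<rangle> \<le> \<parallel>P\<^sup>*x\<parallel> \<parallel>Q\<^sup>*x\<parallel>\<close>.\<close>

lemma op_le_of_contractive_factor:
  fixes P :: "'k :: chilbert_space \<Rightarrow>\<^sub>L 'h :: chilbert_space" and Q :: "'l :: chilbert_space \<Rightarrow>\<^sub>L 'h"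
  assumes P: "P \<in> clinear_ops" and Q: "Q \<in> clinear_ops" and fac: "P = Q o\<^sub>L \<Gamma>" and \<Gamma>: "norm \<Gamma> \<le> 1"
  shows "P o\<^sub>L adj P \<le>\<^sub>o\<^sub>p Q o\<^sub>L adj Q"
proof -
  have le: "norm (blinfun_apply (adj P) x) \<le> norm (blinfun_apply (adj Q) x)" for x
  proof -
    define y where "y = blinfun_apply (adj P) x"
    have "(norm y)\<^sup>2 = Re (cinner (blinfun_apply P y) x)"
      unfolding cinner_adj_right[OF P] y_def by (simp add: cinner_self)
    also have "\<dots> = Re (cinner (blinfun_apply \<Gamma> y) (blinfun_apply (adj Q) x))"
      by (simp add: fac cinner_adj_right[OF Q])
    also have "\<dots> \<le> norm (blinfun_apply \<Gamma> y) * norm (blinfun_apply (adj Q) x)" by (rule Re_cinner_le)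
    also have "\<dots> \<le> norm y * norm (blinfun_apply (adj Q) x)"
    proof (rule mult_right_mono)
      show "norm (blinfun_apply \<Gamma> y) \<le> norm y"
        using norm_blinfun[of \<Gamma> y] mult_right_mono[OF \<Gamma>, of "norm y"] by simp
    qed simp
    finally show ?thesis
      unfolding y_def[symmetric] by (cases "y = 0") (auto simp: power2_eq_square)
  qed
  have "cinner (blinfun_apply ((Q o\<^sub>L adj Q) - (P o\<^sub>L adj P)) x) x
      = complex_of_real ((norm (blinfun_apply (adj Q) x))\<^sup>2 - (norm (blinfun_apply (adj P) x))\<^sup>2)" for x
    by (simp add: blinfun.diff_left cinner_linear cinner_adj_right[OF P] cinner_adj_right[OF Q] cinner_self)
  moreover have "0 \<le> (norm (blinfun_apply (adj Q) x))\<^sup>2 - (norm (blinfun_apply (adj P) x))\<^sup>2" for x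
    using power_mono[OF le, of x 2] by simp
  ultimately show ?thesis
    unfolding op_le_def positive_op_def
    by (simp del: of_real_diff of_real_power add: clinear_ops_diff clinear_ops_compose clinear_ops_adj P Q)
qed

theorem theorem6p1:
  fixes F :: "('h :: chilbert_space, 'n :: finite) op_tuple \<Rightarrow> ('h, 'm :: finite) op_tuple"
    and a :: "complex ^ 'n"
  assumes "separable_space (euclidean :: 'h topology)"
    and "cinfinite_dimensional TYPE('h)"
    and "free_holomorphic_tuple F"
    and "F ` op_ball \<subseteq> op_cball"
    and "tuple_norm (F (\<lambda>_. 0)) < 1"
    and "norm a < 1"
  shows "let b = tuple_scalars (F (scalar_tuple a)) in
    (\<exists>\<Gamma> :: ('h, 'n) op_tuple \<Rightarrow> ('h ^ 'm) \<Rightarrow>\<^sub>L ('h ^ 'n).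
       free_holomorphic_mat \<Gamma> \<and> sup_norm \<Gamma> \<le> 1 \<and>
       (\<forall>X \<in> op_ball. row_op (Phi b (F X)) = row_op (Phi a X) o\<^sub>L \<Gamma> (Phi a X))) \<and>
    (\<forall>X \<in> op_ball. row_op (Phi b (F X)) o\<^sub>L adj (row_op (Phi b (F X)))
                      \<le>\<^sub>o\<^sub>p row_op (Phi a X) o\<^sub>L adj (row_op (Phi a X))) \<and>
    (\<forall>X \<in> op_ball. tuple_norm (Phi b (F X)) \<le> tuple_norm (Phi a X))"
proof -
  note sep = assms(1) and inf = assms(2) and F = assms(3) and ball = assms(4) and a = assms(6)
  obtain e :: "nat \<Rightarrow> 'h" where "\<And>i j. cinner (e i) (e j) = (if i = j then 1 else 0)"
    and "\<And>x. (\<And>k. cinner x (e k) = 0) \<Longrightarrow> x = 0"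
    using exists_orthonormal_basis[OF sep inf] by blast
  then have "(norm (e 0))\<^sup>2 = 1" by (simp add: Re_cinner_self[symmetric])
  then have u: "norm (e 0) = 1" by (simp add: abs_square_eq_1)
  then have e0: "e 0 \<noteq> 0" by auto
  have Fpa: "poly_approx (\<lambda>X. F X j)" for j
    using F free_holomorphic_imp_poly_approx[OF sep inf, of "\<lambda>X. F X j"]
    by (simp add: free_holomorphic_tuple_def)
  have scalar_ball: "(scalar_tuple c :: ('h, 'k :: finite) op_tuple) \<in> op_ball" if "norm c < 1" for c
    using norm_scalar_row_le[of c, where 'h = 'h] that by (simp add: op_ball_iff)
  have "\<exists>b. F (scalar_tuple c) = scalar_tuple b" if c: "norm c < 1" for c
  proof -
    have "\<exists>z. F (scalar_tuple c) j = z *\<^sub>C id_blinfun" for j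
      using free_holomorphic_scalar[of "\<lambda>X. F X j", OF _ scalar_ball[OF c] u] F
      by (simp add: free_holomorphic_tuple_def)
    then obtain z where "\<And>j. F (scalar_tuple c) j = z j *\<^sub>C id_blinfun" by metis
    then show ?thesis by (intro exI[of _ "\<chi> j. z j"]) (simp add: scalar_tuple_def fun_eq_iff)
  qed
  then obtain \<beta> where \<beta>: "\<And>c. norm c < 1 \<Longrightarrow> F (scalar_tuple c) = scalar_tuple (\<beta> c)" by metis
  have norm_\<beta>: "norm (\<beta> c) \<le> norm (row_op (F (scalar_tuple c)))" if "norm c < 1" for c
    using norm_le_norm_scalar_row[OF e0, of "\<beta> c"] \<beta>[OF that] by simp
  have zero: "(scalar_tuple 0 :: ('h, 'n) op_tuple) = (\<lambda>_. 0)" by (simp add: scalar_tuple_def fun_eq_iff)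
  have FX: "F X j \<in> clinear_ops" "norm (row_op (F X)) \<le> 1" if "X \<in> op_ball" for X j
    using ball that by (auto simp: op_cball_iff image_subset_iff)
  have PhiF_cball: "(\<lambda>X. Phi l (F X)) ` op_ball \<subseteq> op_cball" if "norm l < 1" for l
    using ball Phi_op_cball[OF that] by auto
  have holo: "free_holomorphic_tuple H" if "\<And>j. poly_approx (\<lambda>X. H X j)"
    for H :: "('h, 'n) op_tuple \<Rightarrow> ('h, 'm) op_tuple"
    using poly_approx_imp_free_holomorphic[OF sep inf that] by (simp add: free_holomorphic_tuple_def)
  define b where "b = \<beta> a"
  \<comment> \<open>a maximum principle: by the Schwarz lemma \<open>\<Phi>\<^bsub>F(0)\<^esub>\<close> moves \<open>F(a)\<close> into the open ball, and it is
    an involution preserving that ball\<close>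
  have b: "norm b < 1"
  proof -
    define b0 where "b0 = \<beta> 0"
    have F0: "F (\<lambda>_. 0) = scalar_tuple b0" using \<beta>[of 0] by (simp add: zero b0_def)
    have b0: "norm b0 < 1"
      using norm_\<beta>[of 0] assms(5) by (simp add: zero b0_def[symmetric] F0 tuple_norm_eq_norm_row_op)
    obtain \<Gamma> :: "('h, 'n) op_tuple \<Rightarrow> ('h ^ 'm) \<Rightarrow>\<^sub>L ('h ^ 'n)"
      where \<Gamma>: "\<And>X. X \<in> op_ball \<Longrightarrow> norm (\<Gamma> X) \<le> 1"
        "\<And>X. X \<in> op_ball \<Longrightarrow> row_op (Phi b0 (F X)) = row_op X o\<^sub>L \<Gamma> X"
      using schwarz_lemma[OF sep inf holo[OF poly_approx_Phi[OF b0 Fpa ball]] PhiF_cball[OF b0]]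
      by (metis F0 Phi_self[OF b0 refl])
    define A where "A = (scalar_tuple a :: ('h, 'n) op_tuple)"
    have A: "A \<in> op_ball" unfolding A_def by (rule scalar_ball[OF a])
    have "norm (row_op (Phi b0 (F A))) \<le> norm (row_op A) * norm (\<Gamma> A)"
      unfolding \<Gamma>(2)[OF A] by (rule norm_blinfun_compose)
    also have "\<dots> \<le> norm (row_op A) * 1" by (intro mult_left_mono \<Gamma>(1) A) simp
    also have "\<dots> < 1" using A by (simp add: op_ball_iff)
    finally have "Phi b0 (F A) \<in> op_ball"
      using clinear_Phi[OF b0 refl FX[OF A]] by (simp add: op_ball_iff)
    then have "Phi b0 (Phi b0 (F A)) \<in> op_ball" by (rule Phi_op_ball[OF b0])
    then have "F A \<in> op_ball" using Phi_involutive[OF b0 refl FX[OF A]] by simp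
    then show ?thesis using norm_\<beta>[OF a] by (simp add: op_ball_iff A_def b_def)
  qed
  have Fa: "F (scalar_tuple a) = scalar_tuple b" using \<beta>[OF a] by (simp add: b_def)
  have b_eq: "tuple_scalars (F (scalar_tuple a)) = b"
    unfolding Fa by (rule tuple_scalars_scalar_tuple[OF u])
  define G where "G = (\<lambda>X. Phi b (F (Phi a X)))"
  have "poly_approx (\<lambda>X :: ('h, 'n) op_tuple. Phi a X i)" for i
  proof (rule poly_approx_Phi[of a "\<lambda>X. X", OF a poly_approx_var])
    show "(\<lambda>X. X) ` op_ball \<subseteq> (op_cball :: ('h, 'n) op_tuple set)"
      by (auto simp: op_ball_iff op_cball_iff)
  qed
  then have "poly_approx (\<lambda>X. F (Phi a X) j)" for j
    by (rule poly_approx_compose[OF Fpa _ Phi_op_ball_upto[OF a]])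
  moreover have "(\<lambda>X. F (Phi a X)) ` op_ball \<subseteq> op_cball"
    using ball Phi_op_ball[OF a] by auto
  ultimately have "poly_approx (\<lambda>X. G X j)" for j
    unfolding G_def by (rule poly_approx_Phi[OF b])
  moreover have "G ` op_ball \<subseteq> op_cball"
    using PhiF_cball[OF b] Phi_op_ball[OF a] by (auto simp: G_def)
  moreover have "G (\<lambda>_. 0) = (\<lambda>_. 0)"
    by (simp add: G_def Phi_0[OF a refl] Fa Phi_self[OF b refl])
  ultimately obtain \<Gamma> :: "('h, 'n) op_tuple \<Rightarrow> ('h ^ 'm) \<Rightarrow>\<^sub>L ('h ^ 'n)"
    where \<Gamma>: "free_holomorphic_mat \<Gamma>" "\<And>X. X \<in> op_ball \<Longrightarrow> norm (\<Gamma> X) \<le> 1"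
      "\<And>X. X \<in> op_ball \<Longrightarrow> row_op (G X) = row_op X o\<^sub>L \<Gamma> X"
    using schwarz_lemma[OF sep inf holo] by metis
  have factor: "row_op (Phi b (F X)) = row_op (Phi a X) o\<^sub>L \<Gamma> (Phi a X)" if X: "X \<in> op_ball" for X
  proof -
    have "Phi a (Phi a X) = X"
      by (rule Phi_involutive[OF a refl]) (use X in \<open>auto simp: op_ball_iff\<close>)
    then show ?thesis using \<Gamma>(3)[OF Phi_op_ball[OF a X]] by (simp add: G_def)
  qed
  have sup: "sup_norm \<Gamma> \<le> 1"
    unfolding sup_norm_def using \<Gamma>(2) by (intro SUP_least) (simp add: one_ereal_def)
  have P: "row_op (Phi b (F X)) \<in> clinear_ops" "\<And>j. Phi b (F X) j \<in> clinear_ops" if "X \<in> op_ball" for X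
    using clinear_Phi[OF b refl FX[OF that]] by (auto intro: clinear_ops_row_op)
  have Q: "row_op (Phi a X) \<in> clinear_ops" "\<And>j. Phi a X j \<in> clinear_ops" if "X \<in> op_ball"
    for X :: "('h, 'n) op_tuple"
    using Phi_op_ball[OF a that] by (auto simp: op_ball_iff intro: clinear_ops_row_op)
  have le: "row_op (Phi b (F X)) o\<^sub>L adj (row_op (Phi b (F X))) \<le>\<^sub>o\<^sub>p row_op (Phi a X) o\<^sub>L adj (row_op (Phi a X))"
    if X: "X \<in> op_ball" for X
    by (rule op_le_of_contractive_factor[OF P(1)[OF X] Q(1)[OF X] factor[OF X] \<Gamma>(2)[OF Phi_op_ball[OF a X]]])
  have norm_le: "tuple_norm (Phi b (F X)) \<le> tuple_norm (Phi a X)" if X: "X \<in> op_ball" for X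
  proof -
    have "norm (row_op (Phi b (F X))) \<le> norm (row_op (Phi a X)) * norm (\<Gamma> (Phi a X))"
      unfolding factor[OF X] by (rule norm_blinfun_compose)
    also have "\<dots> \<le> norm (row_op (Phi a X)) * 1"
      by (intro mult_left_mono \<Gamma>(2) Phi_op_ball a X) simp
    finally show ?thesis by (simp add: tuple_norm_eq_norm_row_op P(2)[OF X] Q(2)[OF X])
  qed
  show ?thesis
    unfolding Let_def b_eq using \<Gamma>(1) sup factor le norm_le by blast
qed

end
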